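(* Let $p,q\ge 2$ be even integers with $p\ne q$, let $A\subset S^p\times S^q$ be a $\mathbb{Q}$-acyclic neighborhood, and let $f:(S^p\times S^q,A)\to(S^p\times S^q,A)$ be a continuous map of pairs. Let $a$ be the eigenvalue of the linear map $f^{\ast p}$ induced by $f$ on $H^p(S^p\times S^q;\mathbb{Q})\cong\mathbb{Q}$ and let $b$ be the eigenvalue of the linear map $f^{\ast q}$ induced by $f$ on $H^q(S^p\times S^q;\mathbb{Q})\cong\mathbb{Q}$. Then $L(f^m,S^p\times S^q,A)=0$ for all integers $m\ge 1$ if and only if $a=b=0$.
   Context: A neighborhood here is a neighborhood of some point (a subset with non-empty interior). A space $A$ is $\mathbb{Q}$-acyclic if it has the rational homology of a point: $H_0(A;\mathbb{Q})=\mathbb{Q}$ and $H_k(A;\mathbb{Q})=0$ for $k>0$. For a map of pairs $g:(X,A)\to(X,A)$ such that the groups $H_k(X,A;\mathbb{Q})$ are finite-dimensional and vanish for almost all $k$, the relative Lefschetz number is $L(g,X,A)=\sum_k(-1)^k\operatorname{tr}\big(g_{\ast k}:H_k(X,A;\mathbb{Q})\to H_k(X,A;\mathbb{Q})\big)$ (equivalently, defined using relative rational cohomology). $f^m$ is the $m$-th iterate of $f$. *)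

theory Defs
  imports "HOL-Homology.Homology" "HOL-Library.Function_Algebras"
begin

section \<open>Quotients of spaces of rational-valued functions\<close>

text \<open>
  A pair \<open>(Z, B)\<close> of subspaces \<open>B \<subseteq> Z\<close> of the rational vector space of functions \<open>'b \<Rightarrow> rat\<close>
  stands for the quotient vector space \<open>Z / B\<close>: its elements are represented by the elements
  of \<open>Z\<close>, and two of them represent the same class iff they are related by \<open>class_eq\<close>.
  A linear map \<open>T\<close> of \<open>Z\<close> into itself that preserves \<open>B\<close> represents the endomorphism it
  induces on \<open>Z / B\<close>.
\<close>

type_synonym 'b quotient_space = "('b \<Rightarrow> rat) set \<times> ('b \<Rightarrow> rat) set"

definition scale :: "rat \<Rightarrow> ('b \<Rightarrow> rat) \<Rightarrow> 'b \<Rightarrow> rat"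
  where "scale r u = (\<lambda>x. r * u x)"

definition reps :: "'b quotient_space \<Rightarrow> ('b \<Rightarrow> rat) set"
  where "reps H = fst H"

definition class_eq :: "'b quotient_space \<Rightarrow> ('b \<Rightarrow> rat) \<Rightarrow> ('b \<Rightarrow> rat) \<Rightarrow> bool"
  where "class_eq H u v \<longleftrightarrow> u - v \<in> snd H"

definition is_basis :: "'b quotient_space \<Rightarrow> nat \<Rightarrow> (nat \<Rightarrow> 'b \<Rightarrow> rat) \<Rightarrow> bool"
  where "is_basis H n e \<longleftrightarrow>
    (\<forall>i<n. e i \<in> reps H) \<and>
    (\<forall>z\<in>reps H. \<exists>!c. (\<forall>i\<ge>n. c i = 0) \<and> class_eq H z (\<Sum>i<n. scale (c i) (e i)))"

definition has_dim :: "'b quotient_space \<Rightarrow> nat \<Rightarrow> bool"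
  where "has_dim H n \<longleftrightarrow> (\<exists>e. is_basis H n e)"

text \<open>\<open>M i j\<close> is the entry in row \<open>i\<close>, column \<open>j\<close>.\<close>

definition is_matrix_of ::
  "'b quotient_space \<Rightarrow> (('b \<Rightarrow> rat) \<Rightarrow> 'b \<Rightarrow> rat) \<Rightarrow> nat \<Rightarrow> (nat \<Rightarrow> 'b \<Rightarrow> rat) \<Rightarrow>
    (nat \<Rightarrow> nat \<Rightarrow> rat) \<Rightarrow> bool"
  where "is_matrix_of H T n e M \<longleftrightarrow>
    (\<forall>j<n. class_eq H (T (e j)) (\<Sum>i<n. scale (M i j) (e i)))"

text \<open>The trace of an endomorphism of a finite-dimensional quotient space is the common value
  of the traces of its matrices over all bases. It is unspecified in infinite dimension.\<close>

definition endo_trace :: "'b quotient_space \<Rightarrow> (('b \<Rightarrow> rat) \<Rightarrow> 'b \<Rightarrow> rat) \<Rightarrow> rat"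
  where "endo_trace H T =
    (THE t. \<exists>n e M. is_basis H n e \<and> is_matrix_of H T n e M \<and> t = (\<Sum>i<n. M i i))"

definition is_eigenvalue :: "'b quotient_space \<Rightarrow> (('b \<Rightarrow> rat) \<Rightarrow> 'b \<Rightarrow> rat) \<Rightarrow> rat \<Rightarrow> bool"
  where "is_eigenvalue H T a \<longleftrightarrow>
    (\<exists>z\<in>reps H. \<not> class_eq H z 0 \<and> class_eq H (T z) (scale a z))"


section \<open>Singular homology with rational coefficients\<close>

text \<open>Rational chains are the finitely supported functions on singular simplices. As with
  \<open>singular_relcycle\<close> and \<open>singular_relboundary\<close>, the group of the pair \<open>(X, S)\<close> is presented as
  the chains of \<open>X\<close> with boundary in \<open>S\<close>, modulo boundaries and chains of \<open>S\<close>; the absolute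
  group is the case \<open>S = {}\<close>.\<close>

type_synonym 'a simplex = "(nat \<Rightarrow> real) \<Rightarrow> 'a"

definition rat_chains :: "nat \<Rightarrow> 'a topology \<Rightarrow> ('a simplex \<Rightarrow> rat) set"
  where "rat_chains k X =
    {c. finite {\<sigma>. c \<sigma> \<noteq> 0} \<and> {\<sigma>. c \<sigma> \<noteq> 0} \<subseteq> singular_simplex_set k X}"

definition simplex_chain :: "'a simplex \<Rightarrow> 'a simplex \<Rightarrow> rat"
  where "simplex_chain \<sigma> = (\<lambda>\<tau>. if \<tau> = \<sigma> then 1 else 0)"

definition rat_boundary :: "nat \<Rightarrow> ('a simplex \<Rightarrow> rat) \<Rightarrow> 'a simplex \<Rightarrow> rat"
  where "rat_boundary k c =
    (if k = 0 then 0
     else \<Sum>\<sigma> | c \<sigma> \<noteq> 0. \<Sum>i\<le>k. scale ((-1) ^ i * c \<sigma>) (simplex_chain (singular_face k i \<sigma>)))"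

definition rat_chain_map ::
  "nat \<Rightarrow> ('a \<Rightarrow> 'b) \<Rightarrow> ('a simplex \<Rightarrow> rat) \<Rightarrow> 'b simplex \<Rightarrow> rat"
  where "rat_chain_map k g c = (\<Sum>\<sigma> | c \<sigma> \<noteq> 0. scale (c \<sigma>) (simplex_chain (simplex_map k g \<sigma>)))"

definition rat_relcycles :: "nat \<Rightarrow> 'a topology \<Rightarrow> 'a set \<Rightarrow> ('a simplex \<Rightarrow> rat) set"
  where "rat_relcycles k X S =
    {c \<in> rat_chains k X. rat_boundary k c \<in> rat_chains (k - 1) (subtopology X S)}"

definition rat_relboundaries :: "nat \<Rightarrow> 'a topology \<Rightarrow> 'a set \<Rightarrow> ('a simplex \<Rightarrow> rat) set"
  where "rat_relboundaries k X S =
    {c \<in> rat_chains k X. \<exists>d \<in> rat_chains (Suc k) X.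
       c - rat_boundary (Suc k) d \<in> rat_chains k (subtopology X S)}"

definition rat_homology :: "nat \<Rightarrow> 'a topology \<Rightarrow> 'a set \<Rightarrow> 'a simplex quotient_space"
  where "rat_homology k X S = (rat_relcycles k X S, rat_relboundaries k X S)"

definition rat_acyclic :: "'a topology \<Rightarrow> bool"
  where "rat_acyclic X \<longleftrightarrow>
    has_dim (rat_homology 0 X {}) 1 \<and> (\<forall>k>0. has_dim (rat_homology k X {}) 0)"

text \<open>This is meaningful when all \<open>H\<^sub>k(X, S; \<rat>)\<close> are finite-dimensional and almost all of them
  vanish; the sum then has finitely many terms.\<close>

definition lefschetz_number :: "('a \<Rightarrow> 'a) \<Rightarrow> 'a topology \<Rightarrow> 'a set \<Rightarrow> rat"
  where "lefschetz_number g X S =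
    (\<Sum>k | \<not> has_dim (rat_homology k X S) 0.
       (-1) ^ k * endo_trace (rat_homology k X S) (rat_chain_map k g))"


section \<open>Singular cohomology with rational coefficients\<close>

text \<open>A linear functional on the \<open>k\<close>-chains of \<open>X\<close> is given by its values on the singular
  \<open>k\<close>-simplices of \<open>X\<close>; it is extended by \<open>0\<close> to all other functions of the simplex type.\<close>

definition rat_cochains :: "nat \<Rightarrow> 'a topology \<Rightarrow> ('a simplex \<Rightarrow> rat) set"
  where "rat_cochains k X = {\<phi>. {\<sigma>. \<phi> \<sigma> \<noteq> 0} \<subseteq> singular_simplex_set k X}"

definition rat_coboundary ::
  "nat \<Rightarrow> 'a topology \<Rightarrow> ('a simplex \<Rightarrow> rat) \<Rightarrow> 'a simplex \<Rightarrow> rat"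
  where "rat_coboundary k X \<phi> = (\<lambda>\<sigma>. if singular_simplex (Suc k) X \<sigma>
    then \<Sum>i\<le>Suc k. (-1) ^ i * \<phi> (singular_face (Suc k) i \<sigma>) else 0)"

definition rat_cochain_map ::
  "nat \<Rightarrow> 'a topology \<Rightarrow> ('a \<Rightarrow> 'b) \<Rightarrow> ('b simplex \<Rightarrow> rat) \<Rightarrow> 'a simplex \<Rightarrow> rat"
  where "rat_cochain_map k X g \<phi> = (\<lambda>\<sigma>. if singular_simplex k X \<sigma>
    then \<phi> (simplex_map k g \<sigma>) else 0)"

definition rat_cocycles :: "nat \<Rightarrow> 'a topology \<Rightarrow> ('a simplex \<Rightarrow> rat) set"
  where "rat_cocycles k X = {\<phi> \<in> rat_cochains k X. rat_coboundary k X \<phi> = 0}"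

definition rat_coboundaries :: "nat \<Rightarrow> 'a topology \<Rightarrow> ('a simplex \<Rightarrow> rat) set"
  where "rat_coboundaries k X =
    (case k of 0 \<Rightarrow> {0} | Suc j \<Rightarrow> rat_coboundary j X ` rat_cochains j X)"

definition rat_cohomology :: "nat \<Rightarrow> 'a topology \<Rightarrow> 'a simplex quotient_space"
  where "rat_cohomology k X = (rat_cocycles k X, rat_coboundaries k X)"


abbreviation sphere_product :: "nat \<Rightarrow> nat \<Rightarrow> ((nat \<Rightarrow> real) \<times> (nat \<Rightarrow> real)) topology"
  where "sphere_product p q \<equiv> prod_topology (nsphere p) (nsphere q)"

end

theory Submission
  imports Defs
begin

text \<open>
  Since \<open>A\<close> is acyclic, \<open>H\<^sub>k(X, A) = H\<^sub>k(X)\<close> for \<open>k > 0\<close> and \<open>H\<^sub>0(X, A) = 0\<close>, where \<open>X = S\<^sup>p \<times> S\<^sup>q\<close>. So only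
  degrees \<open>p\<close>, \<open>q\<close> and \<open>p + q\<close> contribute to the Lefschetz number. On the first two \<open>f\<^sup>m\<close> acts by \<open>a\<^sup>m\<close>
  and \<open>b\<^sup>m\<close>; the third is detected by the cup product of the classes pulled back from the factors, so
  \<open>f\<^sup>m\<close> acts by \<open>(ab)\<^sup>m\<close>. As \<open>p\<close> and \<open>q\<close> are even, \<open>L(f\<^sup>m) = a\<^sup>m + b\<^sup>m + (ab)\<^sup>m\<close>, which for \<open>m = 2\<close> is a
  sum of squares.

  The homology of \<open>Y \<times> S\<^sup>n\<close> is computed by induction on \<open>n\<close>, with the slant product by a generating
  cocycle of \<open>S\<^sup>n\<close> as the second component of the isomorphism \<open>H\<^sub>k(Y \<times> S\<^sup>n) \<rightarrow> H\<^sub>k(Y) \<oplus> H\<^sub>k\<^sub>-\<^sub>n(Y)\<close>: cover the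
  sphere by two contractible open sets, split a cycle accordingly, and pass to the common boundary of
  the two pieces. Homotopy invariance and the splitting of cycles are transferred from integral chains
  by clearing denominators.
\<close>

section \<open>Linear extension of functions on simplices\<close>

text \<open>The data live in two theories: \<open>a\<close> and \<open>b\<close> are eigenvalues on
  cohomology, the Lefschetz number is a trace on homology. They meet in the evaluation of cochains
  on cycles: a degree with one-dimensional homology is recorded by a cycle and a cocycle that reads
  off coordinates (\<open>rank_one\<close>). The slant product is an explicit chain-level map given
  by front and back faces; it takes the place of a chain equivalence with a tensor product, and the
  cochain that detects degree \<open>p + q\<close> is the same formula (\<open>cross\<close>), which
  ties it to the cup product. The factor \<open>Y\<close> stays arbitrary: a point gives the spheres
  themselves, a sphere gives the product. In the induction the cocycle on the intersection of the
  two open sets is not chosen but determined by the one above, so the statement is made for every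
  cocycle that is nontrivial on reduced homology. The induction runs over punctured Euclidean
  spaces, because there the intersection of the two open sets is literally the space of one
  dimension less.\<close>

definition fin_supp :: "('a \<Rightarrow> rat) \<Rightarrow> bool"
  where "fin_supp c \<longleftrightarrow> finite {x. c x \<noteq> 0}"

text \<open>Evaluation of a cochain on a chain. The sum over an infinite set is 0, so additivity in
  \<open>c\<close> is available only for finitely supported chains; hence \<open>fin_supp\<close> in
  the rules below. The cochain may be any function.\<close>

definition pairing :: "('a \<Rightarrow> rat) \<Rightarrow> ('a \<Rightarrow> rat) \<Rightarrow> rat"
  where "pairing \<phi> c = (\<Sum>x | c x \<noteq> 0. c x * \<phi> x)"

text \<open>Reading each coefficient of the result as a \<open>pairing\<close> lets linearity be
  proved once, for \<open>pairing\<close>.\<close>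

definition lin_ext :: "('a \<Rightarrow> 'b \<Rightarrow> rat) \<Rightarrow> ('a \<Rightarrow> rat) \<Rightarrow> 'b \<Rightarrow> rat"
  where "lin_ext g c = (\<lambda>y. pairing (\<lambda>x. g x y) c)"

lemma sum_fun_apply: "(\<Sum>x\<in>S. f x) y = (\<Sum>x\<in>S. f x y :: rat)"
  by (induction S rule: infinite_finite_induct) auto

lemma lin_ext_alt: "lin_ext g c = (\<Sum>x | c x \<noteq> 0. scale (c x) (g x))"
  by (rule ext) (simp add: lin_ext_def pairing_def sum_fun_apply scale_def)

lemma pairing_superset:
  assumes "finite S" "{x. c x \<noteq> 0} \<subseteq> S"
  shows "pairing \<phi> c = (\<Sum>x\<in>S. c x * \<phi> x)"
  unfolding pairing_def using assms by (intro sum.mono_neutral_left) auto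

lemma fin_supp_simps [simp, intro]:
  "fin_supp 0"
  "fin_supp c \<Longrightarrow> fin_supp d \<Longrightarrow> fin_supp (c + d)"
  "fin_supp c \<Longrightarrow> fin_supp d \<Longrightarrow> fin_supp (c - d)"
  "fin_supp c \<Longrightarrow> fin_supp (- c)"
  "fin_supp c \<Longrightarrow> fin_supp (scale r c)"
  "fin_supp (simplex_chain \<sigma>)"
proof -
  show "fin_supp 0"
    by (simp add: fin_supp_def)
  show "fin_supp (c + d)" "fin_supp (c - d)" if "fin_supp c" "fin_supp d"
    using that unfolding fin_supp_def
    by (auto intro: finite_subset[of _ "{x. c x \<noteq> 0} \<union> {x. d x \<noteq> 0}"])
  show "fin_supp (- c)" if "fin_supp c"
    using that by (simp add: fin_supp_def)
  show "fin_supp (scale r c)" if "fin_supp c"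
    using that unfolding fin_supp_def by (rule finite_subset[rotated]) (auto simp: scale_def)
  show "fin_supp (simplex_chain \<sigma>)"
    unfolding fin_supp_def by (rule finite_subset[of _ "{\<sigma>}"]) (auto simp: simplex_chain_def)
qed

lemma fin_supp_sum [intro]: "(\<And>i. i \<in> I \<Longrightarrow> fin_supp (f i)) \<Longrightarrow> fin_supp (\<Sum>i\<in>I. f i)"
  by (induction I rule: infinite_finite_induct) auto

lemma fin_supp_lin_ext [intro]:
  assumes "\<And>x. c x \<noteq> 0 \<Longrightarrow> fin_supp (g x)"
  shows "fin_supp (lin_ext g c)"
  unfolding lin_ext_alt using assms by auto

lemma pairing_zero [simp]: "pairing \<phi> 0 = 0" "pairing 0 c = 0" "pairing (\<lambda>_. 0) c = 0"
  by (simp_all add: pairing_def)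

lemma pairing_add:
  assumes "fin_supp c" "fin_supp d"
  shows "pairing \<phi> (c + d) = pairing \<phi> c + pairing \<phi> d"
proof -
  let ?S = "{x. c x \<noteq> 0} \<union> {x. d x \<noteq> 0}"
  have S: "finite ?S"
    using assms by (simp add: fin_supp_def)
  have "pairing \<phi> c = (\<Sum>x\<in>?S. c x * \<phi> x)" "pairing \<phi> d = (\<Sum>x\<in>?S. d x * \<phi> x)"
       "pairing \<phi> (c + d) = (\<Sum>x\<in>?S. (c + d) x * \<phi> x)"
    using S by (intro pairing_superset; force)+
  then show ?thesis
    by (simp add: algebra_simps sum.distrib)
qed

lemma pairing_scale [simp]: "pairing \<phi> (scale r c) = r * pairing \<phi> c"
proof (cases "r = 0")
  case False
  then show ?thesis
    by (simp add: pairing_def scale_def sum_distrib_left mult.assoc)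
qed (simp add: pairing_def scale_def)

lemma scale_simps [simp]:
  "scale 0 c = 0" "scale 1 c = c" "scale r 0 = 0" "scale (-1) c = - c" "scale r (scale s c) = scale (r * s) c"
  "scale (- r) c = - scale r c" "scale r (- c) = - scale r c"
  by (auto simp: scale_def algebra_simps)

lemma scale_add: "scale r (c + d) = scale r c + scale r d" "scale r (c - d) = scale r c - scale r d"
  "scale (r + s) c = scale r c + scale s c" "scale (r - s) c = scale r c - scale s c"
  by (auto simp: scale_def algebra_simps)

lemma scale_sum: "scale r (\<Sum>i\<in>I. f i) = (\<Sum>i\<in>I. scale r (f i))"
  by (rule ext) (simp add: scale_def sum_fun_apply sum_distrib_left)

lemma pairing_minus [simp]: "pairing \<phi> (- c) = - pairing \<phi> c"
  using pairing_scale[of \<phi> "-1" c] by simp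

lemma pairing_diff:
  assumes "fin_supp c" "fin_supp d"
  shows "pairing \<phi> (c - d) = pairing \<phi> c - pairing \<phi> d"
  using pairing_add[of c "- d" \<phi>] assms by simp

lemma pairing_simplex_chain [simp]: "pairing \<phi> (simplex_chain \<sigma>) = \<phi> \<sigma>"
  by (subst pairing_superset[of "{\<sigma>}"]) (auto simp: simplex_chain_def)

lemma pairing_sum:
  "(\<And>i. i \<in> I \<Longrightarrow> fin_supp (f i)) \<Longrightarrow> pairing \<phi> (\<Sum>i\<in>I. f i) = (\<Sum>i\<in>I. pairing \<phi> (f i))"
  by (induction I rule: infinite_finite_induct) (auto simp: pairing_add fin_supp_sum)

lemma pairing_cong: "(\<And>x. c x \<noteq> 0 \<Longrightarrow> \<phi> x = \<psi> x) \<Longrightarrow> pairing \<phi> c = pairing \<psi> c"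
  unfolding pairing_def by (intro sum.cong) auto

lemma pairing_left:
  "pairing (\<lambda>x. \<phi> x + \<psi> x) c = pairing \<phi> c + pairing \<psi> c"
  "pairing (\<lambda>x. \<phi> x - \<psi> x) c = pairing \<phi> c - pairing \<psi> c"
  "pairing (\<lambda>x. r * \<phi> x) c = r * pairing \<phi> c"
  "pairing (\<lambda>x. - \<phi> x) c = - pairing \<phi> c"
  by (auto simp: pairing_def algebra_simps sum.distrib sum_subtractf sum_distrib_left sum_negf)

lemma lin_ext_add: "fin_supp c \<Longrightarrow> fin_supp d \<Longrightarrow> lin_ext g (c + d) = lin_ext g c + lin_ext g d"
  and lin_ext_diff: "fin_supp c \<Longrightarrow> fin_supp d \<Longrightarrow> lin_ext g (c - d) = lin_ext g c - lin_ext g d"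
  and lin_ext_scale: "lin_ext g (scale r c) = scale r (lin_ext g c)"
  and lin_ext_minus: "lin_ext g (- c) = - lin_ext g c"
  by (auto simp: lin_ext_def pairing_add pairing_diff scale_def[of r] simp flip: pairing_scale)

lemma lin_ext_simplex_chain: "lin_ext g (simplex_chain \<sigma>) = g \<sigma>"
  by (simp add: lin_ext_def)

lemma lin_ext_zero: "lin_ext g 0 = 0" "lin_ext (\<lambda>_. 0) c = 0"
  by (auto simp: lin_ext_def)

lemma lin_ext_sum:
  "(\<And>i. i \<in> I \<Longrightarrow> fin_supp (f i)) \<Longrightarrow> lin_ext g (\<Sum>i\<in>I. f i) = (\<Sum>i\<in>I. lin_ext g (f i))"
  by (induction I rule: infinite_finite_induct) (auto simp: lin_ext_add lin_ext_zero fin_supp_sum)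

lemma lin_ext_cong: "(\<And>x. c x \<noteq> 0 \<Longrightarrow> g x = h x) \<Longrightarrow> lin_ext g c = lin_ext h c"
  unfolding lin_ext_alt by (intro sum.cong) auto

text \<open>Adjointness. Its instances for the boundary, chain maps and the slant product are
  \<open>pairing_cobd\<close>, \<open>pairing_pullback\<close> and
  \<open>pairing_slant\<close>.\<close>

lemma pairing_lin_ext:
  assumes "\<And>x. c x \<noteq> 0 \<Longrightarrow> fin_supp (g x)"
  shows "pairing \<phi> (lin_ext g c) = pairing (\<lambda>x. pairing \<phi> (g x)) c"
  unfolding lin_ext_alt using assms by (subst pairing_sum) (auto simp: pairing_def[of "\<lambda>x. pairing \<phi> (g x)"])

lemma lin_ext_lin_ext:
  assumes "\<And>x. c x \<noteq> 0 \<Longrightarrow> fin_supp (g x)"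
  shows "lin_ext h (lin_ext g c) = lin_ext (\<lambda>x. lin_ext h (g x)) c"
  using assms by (simp add: lin_ext_def[of h] pairing_lin_ext) (simp add: lin_ext_def)

lemma lin_ext_id: "fin_supp c \<Longrightarrow> lin_ext simplex_chain c = c"
  unfolding lin_ext_def
proof
  fix x assume c: "fin_supp c"
  show "pairing (\<lambda>\<sigma>. simplex_chain \<sigma> x) c = c x"
    using c by (subst pairing_superset[of "insert x {\<sigma>. c \<sigma> \<noteq> 0}"])
      (auto simp: fin_supp_def simplex_chain_def if_distrib cong: if_cong)
qed

section \<open>Rational chains, boundaries and induced maps\<close>

lemma rat_chains_iff: "c \<in> rat_chains k X \<longleftrightarrow> fin_supp c \<and> (\<forall>\<sigma>. c \<sigma> \<noteq> 0 \<longrightarrow> singular_simplex k X \<sigma>)"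
  by (auto simp: rat_chains_def fin_supp_def)

lemma rat_chains_fin_supp [simp]: "c \<in> rat_chains k X \<Longrightarrow> fin_supp c"
  by (simp add: rat_chains_iff)

lemma rat_chains_zero [simp]: "0 \<in> rat_chains k X"
  by (simp add: rat_chains_iff)

lemma rat_chains_add [intro]: "c \<in> rat_chains k X \<Longrightarrow> d \<in> rat_chains k X \<Longrightarrow> c + d \<in> rat_chains k X"
  unfolding rat_chains_iff
proof (intro conjI allI impI)
  fix \<sigma> assume "fin_supp c \<and> (\<forall>\<sigma>. c \<sigma> \<noteq> 0 \<longrightarrow> singular_simplex k X \<sigma>)"
    "fin_supp d \<and> (\<forall>\<sigma>. d \<sigma> \<noteq> 0 \<longrightarrow> singular_simplex k X \<sigma>)" "(c + d) \<sigma> \<noteq> 0"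
  then show "singular_simplex k X \<sigma>"
    by (cases "c \<sigma> = 0") auto
qed auto

lemma rat_chains_scale [intro]: "c \<in> rat_chains k X \<Longrightarrow> scale r c \<in> rat_chains k X"
  by (auto simp: rat_chains_iff) (simp add: scale_def)

lemma rat_chains_minus [intro]: "c \<in> rat_chains k X \<Longrightarrow> - c \<in> rat_chains k X"
  by (auto simp: rat_chains_iff)

lemma rat_chains_diff [intro]: "c \<in> rat_chains k X \<Longrightarrow> d \<in> rat_chains k X \<Longrightarrow> c - d \<in> rat_chains k X"
  using rat_chains_add[of c k X "- d"] by auto

lemma rat_chains_simplex [intro]: "singular_simplex k X \<sigma> \<Longrightarrow> simplex_chain \<sigma> \<in> rat_chains k X"
  by (auto simp: rat_chains_iff) (auto simp: simplex_chain_def split: if_splits)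

lemma rat_chains_sum [intro]: "(\<And>i. i \<in> I \<Longrightarrow> f i \<in> rat_chains k X) \<Longrightarrow> (\<Sum>i\<in>I. f i) \<in> rat_chains k X"
  by (induction I rule: infinite_finite_induct) auto

lemma rat_chains_lin_ext:
  assumes "c \<in> rat_chains k X" "\<And>\<sigma>. singular_simplex k X \<sigma> \<Longrightarrow> g \<sigma> \<in> rat_chains l Y"
  shows "lin_ext g c \<in> rat_chains l Y"
  using assms unfolding lin_ext_alt by (auto simp: rat_chains_iff[of c])

definition simplex_boundary :: "nat \<Rightarrow> 'a simplex \<Rightarrow> 'a simplex \<Rightarrow> rat"
  where "simplex_boundary k \<sigma> =
    (if k = 0 then 0 else \<Sum>i\<le>k. scale ((-1) ^ i) (simplex_chain (singular_face k i \<sigma>)))"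

lemma fin_supp_simplex_boundary [simp]: "fin_supp (simplex_boundary k \<sigma>)"
  by (auto simp: simplex_boundary_def)

lemma rat_boundary_lin_ext: "rat_boundary k = lin_ext (simplex_boundary k)"
  by (rule ext) (auto simp: rat_boundary_def lin_ext_alt simplex_boundary_def scale_sum mult.commute)

lemma rat_chain_map_lin_ext: "rat_chain_map k g = lin_ext (\<lambda>\<sigma>. simplex_chain (simplex_map k g \<sigma>))"
  by (rule ext) (simp add: rat_chain_map_def lin_ext_alt)

lemma rat_boundary_simps [simp]:
  "rat_boundary k 0 = 0"
  "rat_boundary 0 c = 0"
  "rat_boundary k (scale r c) = scale r (rat_boundary k c)"
  "rat_boundary k (- c) = - rat_boundary k c"
  "rat_boundary k (simplex_chain \<sigma>) = simplex_boundary k \<sigma>"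
  "fin_supp c \<Longrightarrow> fin_supp d \<Longrightarrow> rat_boundary k (c + d) = rat_boundary k c + rat_boundary k d"
  "fin_supp c \<Longrightarrow> fin_supp d \<Longrightarrow> rat_boundary k (c - d) = rat_boundary k c - rat_boundary k d"
  "fin_supp (rat_boundary k c)"
  by (auto simp: rat_boundary_lin_ext lin_ext_add lin_ext_diff lin_ext_scale lin_ext_minus
      lin_ext_zero lin_ext_simplex_chain) (auto simp: lin_ext_alt simplex_boundary_def)

lemma rat_chain_map_simps [simp]:
  "rat_chain_map k g 0 = 0"
  "rat_chain_map k g (scale r c) = scale r (rat_chain_map k g c)"
  "rat_chain_map k g (- c) = - rat_chain_map k g c"
  "rat_chain_map k g (simplex_chain \<sigma>) = simplex_chain (simplex_map k g \<sigma>)"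
  "fin_supp c \<Longrightarrow> fin_supp d \<Longrightarrow> rat_chain_map k g (c + d) = rat_chain_map k g c + rat_chain_map k g d"
  "fin_supp c \<Longrightarrow> fin_supp d \<Longrightarrow> rat_chain_map k g (c - d) = rat_chain_map k g c - rat_chain_map k g d"
  "fin_supp (rat_chain_map k g c)"
  by (auto simp: rat_chain_map_lin_ext lin_ext_add lin_ext_diff lin_ext_scale lin_ext_minus
      lin_ext_zero lin_ext_simplex_chain)

lemma rat_boundary_in_chains [intro]:
  assumes "c \<in> rat_chains k X"
  shows "rat_boundary k c \<in> rat_chains (k - 1) X"
proof (cases "k = 0")
  case False
  with assms show ?thesis
    unfolding rat_boundary_lin_ext
    by (auto elim!: rat_chains_lin_ext intro!: rat_chains_sum rat_chains_scale rat_chains_simplex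
        simp: simplex_boundary_def singular_simplex_singular_face[of k, simplified])
qed auto

lemma rat_boundary_Suc_in_chains [intro]:
  "c \<in> rat_chains (Suc k) X \<Longrightarrow> rat_boundary (Suc k) c \<in> rat_chains k X"
  using rat_boundary_in_chains[of c "Suc k"] by simp

lemma rat_chain_map_in_chains [intro]:
  "c \<in> rat_chains k X \<Longrightarrow> continuous_map X Y g \<Longrightarrow> rat_chain_map k g c \<in> rat_chains k Y"
  unfolding rat_chain_map_lin_ext
  by (auto elim!: rat_chains_lin_ext intro: singular_simplex_simplex_map)

lemma rat_chains_mono:
  "c \<in> rat_chains k (subtopology X S) \<Longrightarrow> S \<subseteq> T \<Longrightarrow> c \<in> rat_chains k (subtopology X T)"
  "c \<in> rat_chains k (subtopology X S) \<Longrightarrow> c \<in> rat_chains k X"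
  by (auto simp: rat_chains_iff singular_simplex_subtopology)

lemma rat_chains_Int:
  "c \<in> rat_chains k (subtopology X S) \<Longrightarrow> c \<in> rat_chains k (subtopology X T)
    \<Longrightarrow> c \<in> rat_chains k (subtopology X (S \<inter> T))"
  by (auto simp: rat_chains_iff singular_simplex_subtopology)

lemma rat_chains_empty: "topspace X = {} \<Longrightarrow> rat_chains k X = {0}"
  by (auto simp: rat_chains_iff singular_simplex_empty)


section \<open>Clearing denominators\<close>

text \<open>Change of coefficients from integral chains to rational ones. It is injective and
  commutes with boundaries and induced maps, so facts about integral chains can be carried
  over.\<close>

definition ratify :: "('a \<Rightarrow>\<^sub>0 int) \<Rightarrow> 'a \<Rightarrow> rat"
  where "ratify z = (\<lambda>x. of_int (Poly_Mapping.lookup z x))"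

lemma fin_supp_ratify [simp]: "fin_supp (ratify z)"
  by (simp add: fin_supp_def ratify_def)

lemma ratify_simps [simp]:
  "ratify 0 = 0" "ratify (x + y) = ratify x + ratify y" "ratify (x - y) = ratify x - ratify y"
  "ratify (frag_cmul n x) = scale (of_int n) (ratify x)" "ratify (frag_of \<sigma>) = simplex_chain \<sigma>"
  by (auto simp: ratify_def lookup_add lookup_minus scale_def lookup_single when_def simplex_chain_def)

lemma ratify_sum: "ratify (\<Sum>i\<in>I. f i) = (\<Sum>i\<in>I. ratify (f i))"
  by (induction I rule: infinite_finite_induct) auto

lemma ratify_inject: "ratify x = ratify y \<longleftrightarrow> x = y"
  by (auto simp: ratify_def fun_eq_iff poly_mapping_eq_iff)

lemma ratify_frag_extend: "ratify (frag_extend g z) = lin_ext (\<lambda>x. ratify (g x)) (ratify z)"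
proof -
  have "{x. ratify z x \<noteq> 0} = Poly_Mapping.keys z"
    by (auto simp: ratify_def in_keys_iff)
  then show ?thesis
    by (simp add: frag_extend_def lin_ext_alt ratify_sum) (simp add: ratify_def)
qed

lemma ratify_chain_boundary: "ratify (chain_boundary k z) = rat_boundary k (ratify z)"
  by (cases "k = 0")
    (auto simp: chain_boundary_def ratify_frag_extend rat_boundary_lin_ext simplex_boundary_def ratify_sum
      lin_ext_zero cong: lin_ext_cong)

lemma ratify_chain_map: "ratify (chain_map k g z) = rat_chain_map k g (ratify z)"
  by (simp add: chain_map_def ratify_frag_extend rat_chain_map_lin_ext)

lemma ratify_in_chains: "ratify z \<in> rat_chains k X \<longleftrightarrow> singular_chain k X z"
  using fin_supp_ratify[of z] by (auto simp: rat_chains_iff singular_chain_def ratify_def in_keys_iff)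

text \<open>\<open>N\<close> is the product of the denominators of the nonzero coefficients.\<close>

lemma clear_denominators:
  assumes "c \<in> rat_chains k X"
  obtains N z where "N > 0" "singular_chain k X z" "ratify z = scale (of_int N) c"
proof -
  let ?S = "{\<sigma>. c \<sigma> \<noteq> 0}"
  have fin: "finite ?S"
    using assms by (simp add: rat_chains_def)
  define N where "N = (\<Prod>\<sigma>\<in>?S. snd (quotient_of (c \<sigma>)))"
  have N: "N > 0"
    unfolding N_def by (intro prod_pos) (auto simp: quotient_of_denom_pos')
  have "of_int N * c \<sigma> \<in> \<int>" for \<sigma>
  proof (cases "c \<sigma> = 0")
    case False
    then have "N = snd (quotient_of (c \<sigma>)) * (\<Prod>\<sigma>\<in>?S - {\<sigma>}. snd (quotient_of (c \<sigma>)))"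
      unfolding N_def using fin by (subst prod.remove[of _ \<sigma>]) auto
    moreover have "of_int (snd (quotient_of (c \<sigma>))) * c \<sigma> = of_int (fst (quotient_of (c \<sigma>)))"
      using quotient_of_div[of "c \<sigma>" "fst (quotient_of (c \<sigma>))" "snd (quotient_of (c \<sigma>))"]
        quotient_of_denom_pos'[of "c \<sigma>"] by (simp add: field_simps)
    ultimately have "of_int N * c \<sigma> = of_int (fst (quotient_of (c \<sigma>)) * (\<Prod>\<sigma>\<in>?S - {\<sigma>}. snd (quotient_of (c \<sigma>))))"
      by (simp add: algebra_simps)
    then show ?thesis
      by (metis Ints_of_int)
  qed auto
  then have floor: "of_int \<lfloor>of_int N * c \<sigma>\<rfloor> = of_int N * c \<sigma>" for \<sigma>
    by (rule of_int_floor)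
  \<comment> \<open>The scaled coefficients are integers, so the floors change nothing.\<close>
  define z where "z = Abs_poly_mapping (\<lambda>\<sigma>. \<lfloor>of_int N * c \<sigma>\<rfloor>)"
  have "Poly_Mapping.lookup z = (\<lambda>\<sigma>. \<lfloor>of_int N * c \<sigma>\<rfloor>)"
    unfolding z_def
    by (rule lookup_Abs_poly_mapping, rule finite_subset[OF _ fin]) auto
  then have z: "ratify z = scale (of_int N) c"
    by (simp add: ratify_def floor scale_def)
  then have "singular_chain k X z"
    using rat_chains_scale[OF assms, of "of_int N"] by (simp flip: ratify_in_chains)
  then show thesis
    using N z that by blast
qed

lemma scale_cancel: "r \<noteq> 0 \<Longrightarrow> scale r c = scale r d \<longleftrightarrow> c = d"
  by (auto simp: scale_def fun_eq_iff)

text \<open>The pattern of every transfer: the claim holds for an integral multiple of the chain,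
  and the nonzero factor cancels.\<close>

lemma rat_boundary_boundary:
  assumes "c \<in> rat_chains (Suc k) X"
  shows "rat_boundary k (rat_boundary (Suc k) c) = 0"
proof -
  obtain N z where N: "N > 0" "singular_chain (Suc k) X z" "ratify z = scale (of_int N) c"
    using clear_denominators[OF assms] .
  then have "ratify (chain_boundary k (chain_boundary (Suc k) z)) = 0"
    using chain_boundary_boundary[of "Suc k" X z] by simp
  then have "scale (of_int N) (rat_boundary k (rat_boundary (Suc k) c)) = scale (of_int N) 0"
    by (simp add: ratify_chain_boundary N)
  then show ?thesis
    using N(1) by (subst (asm) scale_cancel) auto
qed

lemma rat_boundary_chain_map:
  assumes "c \<in> rat_chains k X"
  shows "rat_boundary k (rat_chain_map k g c) = rat_chain_map (k - 1) g (rat_boundary k c)"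
proof -
  obtain N z where N: "N > 0" "singular_chain k X z" "ratify z = scale (of_int N) c"
    using clear_denominators[OF assms] .
  have "ratify (chain_boundary k (chain_map k g z)) = ratify (chain_map (k - 1) g (chain_boundary k z))"
    using chain_boundary_chain_map[OF N(2), of g] by simp
  then have "scale (of_int N) (rat_boundary k (rat_chain_map k g c))
      = scale (of_int N) (rat_chain_map (k - 1) g (rat_boundary k c))"
    by (simp add: ratify_chain_boundary ratify_chain_map N)
  then show ?thesis
    using N(1) by (simp add: scale_cancel)
qed

lemma rat_chain_map_id:
  assumes "c \<in> rat_chains k X" "\<And>x. x \<in> topspace X \<Longrightarrow> f x = x"
  shows "rat_chain_map k f c = c"
proof -
  have "rat_chain_map k f c = lin_ext simplex_chain c"
    unfolding rat_chain_map_lin_ext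
  proof (rule lin_ext_cong)
    fix \<sigma> assume "c \<sigma> \<noteq> 0"
    then have "singular_simplex k X \<sigma>"
      using assms(1) by (auto simp: rat_chains_iff)
    then show "simplex_chain (simplex_map k f \<sigma>) = simplex_chain \<sigma>"
      using assms(2) by (simp add: simplex_map_id_gen)
  qed
  then show ?thesis
    using assms(1) by (simp add: lin_ext_id)
qed

lemma rat_chain_map_compose:
  "rat_chain_map k g (rat_chain_map k f c) = rat_chain_map k (g \<circ> f) c"
  by (simp add: rat_chain_map_lin_ext lin_ext_lin_ext lin_ext_simplex_chain simplex_map_compose)


section \<open>Rational cycles and boundaries\<close>

text \<open>The absolute case, identified with the relative one for the empty subspace in
  \<open>rat_relcycles_empty\<close>. As \<open>rat_boundary 0\<close> is 0, every 0-chain is a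
  cycle and degree 0 is unreduced.\<close>

definition rat_cycles :: "nat \<Rightarrow> 'a topology \<Rightarrow> ('a simplex \<Rightarrow> rat) set"
  where "rat_cycles k X = {c \<in> rat_chains k X. rat_boundary k c = 0}"

definition rat_boundaries :: "nat \<Rightarrow> 'a topology \<Rightarrow> ('a simplex \<Rightarrow> rat) set"
  where "rat_boundaries k X = rat_boundary (Suc k) ` rat_chains (Suc k) X"

lemma rat_cyclesD: "c \<in> rat_cycles k X \<Longrightarrow> c \<in> rat_chains k X" "c \<in> rat_cycles k X \<Longrightarrow> rat_boundary k c = 0"
  "c \<in> rat_cycles k X \<Longrightarrow> fin_supp c"
  by (auto simp: rat_cycles_def)

lemma rat_boundariesI: "c \<in> rat_chains (Suc k) X \<Longrightarrow> rat_boundary (Suc k) c \<in> rat_boundaries k X"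
  by (auto simp: rat_boundaries_def)

lemma rat_boundaries_cycles: "c \<in> rat_boundaries k X \<Longrightarrow> c \<in> rat_cycles k X"
  by (auto simp: rat_boundaries_def rat_cycles_def rat_boundary_boundary)

lemma rat_boundaries_fin_supp: "c \<in> rat_boundaries k X \<Longrightarrow> fin_supp c"
  by (auto simp: rat_boundaries_def)

lemma rat_cycles_closed [intro]:
  "0 \<in> rat_cycles k X"
  "c \<in> rat_cycles k X \<Longrightarrow> d \<in> rat_cycles k X \<Longrightarrow> c + d \<in> rat_cycles k X"
  "c \<in> rat_cycles k X \<Longrightarrow> d \<in> rat_cycles k X \<Longrightarrow> c - d \<in> rat_cycles k X"
  "c \<in> rat_cycles k X \<Longrightarrow> - c \<in> rat_cycles k X"
  "c \<in> rat_cycles k X \<Longrightarrow> scale r c \<in> rat_cycles k X"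
  by (auto simp: rat_cycles_def)

lemma rat_boundaries_closed [intro]:
  "0 \<in> rat_boundaries k X"
  "c \<in> rat_boundaries k X \<Longrightarrow> d \<in> rat_boundaries k X \<Longrightarrow> c + d \<in> rat_boundaries k X"
  "c \<in> rat_boundaries k X \<Longrightarrow> d \<in> rat_boundaries k X \<Longrightarrow> c - d \<in> rat_boundaries k X"
  "c \<in> rat_boundaries k X \<Longrightarrow> - c \<in> rat_boundaries k X"
  "c \<in> rat_boundaries k X \<Longrightarrow> scale r c \<in> rat_boundaries k X"
proof -
  show "0 \<in> rat_boundaries k X"
    using rat_boundariesI[of 0 k X] by simp
  show "c + d \<in> rat_boundaries k X" "c - d \<in> rat_boundaries k X"
    if cd: "c \<in> rat_boundaries k X" "d \<in> rat_boundaries k X"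
  proof -
    obtain x y where "c = rat_boundary (Suc k) x" "d = rat_boundary (Suc k) y"
      "x \<in> rat_chains (Suc k) X" "y \<in> rat_chains (Suc k) X"
      using cd unfolding rat_boundaries_def by blast
    then show "c + d \<in> rat_boundaries k X" "c - d \<in> rat_boundaries k X"
      using rat_boundariesI[of "x + y" k X] rat_boundariesI[of "x - y" k X] by auto
  qed
  show "scale r c \<in> rat_boundaries k X" "- c \<in> rat_boundaries k X" if c: "c \<in> rat_boundaries k X"
  proof -
    obtain x where "c = rat_boundary (Suc k) x" "x \<in> rat_chains (Suc k) X"
      using c by (auto simp: rat_boundaries_def)
    then show "scale r c \<in> rat_boundaries k X" "- c \<in> rat_boundaries k X"
      using rat_boundariesI[of "scale r x" k X] rat_boundariesI[of "- x" k X] by auto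
  qed
qed

lemma rat_boundaries_scale_iff: "r \<noteq> 0 \<Longrightarrow> scale r c \<in> rat_boundaries k X \<longleftrightarrow> c \<in> rat_boundaries k X"
  using rat_boundaries_closed(5)[of "scale r c" k X "1 / r"] by auto

text \<open>Being a boundary depends only on the homology class; later proofs exchange
  representatives by this rule.\<close>

lemma rat_boundaries_diff_cancel:
  "c - d \<in> rat_boundaries k X \<Longrightarrow> c \<in> rat_boundaries k X \<longleftrightarrow> d \<in> rat_boundaries k X"
  using rat_boundaries_closed(2)[of "c - d" k X d] rat_boundaries_closed(3)[of c k X "c - d"] by auto

lemma rat_boundaries_trans:
  "c - d \<in> rat_boundaries k X \<Longrightarrow> d - e \<in> rat_boundaries k X \<Longrightarrow> c - e \<in> rat_boundaries k X"
  using rat_boundaries_closed(2)[of "c - d" k X "d - e"] by simp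

lemma rat_chain_map_cycles [intro]:
  "c \<in> rat_cycles k X \<Longrightarrow> continuous_map X Y g \<Longrightarrow> rat_chain_map k g c \<in> rat_cycles k Y"
  by (auto simp: rat_cycles_def rat_boundary_chain_map)

lemma rat_chain_map_boundaries [intro]:
  assumes "c \<in> rat_boundaries k X" "continuous_map X Y g"
  shows "rat_chain_map k g c \<in> rat_boundaries k Y"
proof -
  obtain d where d: "c = rat_boundary (Suc k) d" "d \<in> rat_chains (Suc k) X"
    using assms(1) by (auto simp: rat_boundaries_def)
  then have "rat_chain_map k g c = rat_boundary (Suc k) (rat_chain_map (Suc k) g d)"
    by (simp add: rat_boundary_chain_map)
  then show ?thesis
    using d assms(2) by (auto intro: rat_boundariesI)
qed

lemma rat_cycles_mono: "c \<in> rat_cycles k (subtopology X S) \<Longrightarrow> c \<in> rat_cycles k X"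
  unfolding rat_cycles_def using rat_chains_mono(2) by blast

lemma rat_boundaries_mono: "c \<in> rat_boundaries k (subtopology X S) \<Longrightarrow> c \<in> rat_boundaries k X"
  unfolding rat_boundaries_def using rat_chains_mono(2) by blast

lemma singular_cycle_ratify: "singular_relcycle k X {} z \<longleftrightarrow> ratify z \<in> rat_cycles k X"
  using ratify_inject[of "chain_boundary k z" 0]
  by (auto simp: singular_cycle rat_cycles_def ratify_in_chains ratify_chain_boundary)

text \<open>The converse fails for torsion classes; its substitute is
  \<open>singular_boundary_of_ratify\<close>.\<close>

lemma singular_boundary_ratify: "singular_relboundary k X {} z \<Longrightarrow> ratify z \<in> rat_boundaries k X"
  by (auto simp: singular_boundary ratify_chain_boundary ratify_in_chains intro!: rat_boundariesI)

text \<open>Integral homotopy invariance is applied to an integral multiple of \<open>c\<close>;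
  dividing by \<open>N\<close> is possible because the boundaries form a rational subspace.\<close>

lemma rat_boundaries_homotopic:
  assumes "homotopic_with (\<lambda>_. True) X Y f g" "c \<in> rat_cycles k X"
  shows "rat_chain_map k f c - rat_chain_map k g c \<in> rat_boundaries k Y"
proof -
  obtain N z where N: "N > 0" "singular_chain k X z" "ratify z = scale (of_int N) c"
    using clear_denominators[of c k X] assms(2) by (auto simp: rat_cycles_def)
  have "singular_relcycle k X {} z"
    using assms(2) by (auto simp: singular_cycle_ratify N(3))
  then have "homologous_rel k Y {} (chain_map k f z) (chain_map k g z)"
    using assms(1) by (intro homotopic_imp_homologous_rel_chain_maps[where T = "{}"]) auto
  then have "ratify (chain_map k f z - chain_map k g z) \<in> rat_boundaries k Y"
    unfolding homologous_rel_def by (rule singular_boundary_ratify)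
  then have "scale (of_int N) (rat_chain_map k f c - rat_chain_map k g c) \<in> rat_boundaries k Y"
    by (simp add: ratify_chain_map N scale_add)
  then show ?thesis
    using N(1) by (simp add: rat_boundaries_scale_iff)
qed

text \<open>Some integral multiple of \<open>c\<close> is homologous to a cycle of small simplices,
  by subdivision. After division by \<open>N\<close> its simplices are sorted by the open set that
  contains them.\<close>

lemma rat_cycle_small:
  assumes "openin X U" "openin X V" "topspace X \<subseteq> U \<union> V" "c \<in> rat_cycles k X"
  obtains u v where "u \<in> rat_chains k (subtopology X U)" "v \<in> rat_chains k (subtopology X V)"
    "c - (u + v) \<in> rat_boundaries k X"
proof -
  obtain N z where N: "N > 0" "singular_chain k X z" "ratify z = scale (of_int N) c"
    using clear_denominators[of c k X] assms(4) by (auto simp: rat_cycles_def)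
  have "singular_relcycle k X {} z"
    using assms(4) by (auto simp: singular_cycle_ratify N(3))
  then obtain z' where z': "singular_relcycle k X {} z'" "homologous_rel k X {} z z'"
    "\<And>f. f \<in> Poly_Mapping.keys z' \<Longrightarrow> \<exists>V \<in> {U, V}. f \<in> (standard_simplex k) \<rightarrow> V"
    using small_homologous_rel_relcycle_exists[of "{U, V}" X k "{}" z] assms by auto
  define c' where "c' = scale (1 / of_int N) (ratify z')"
  have c': "c' \<in> rat_cycles k X"
    unfolding c'_def using z'(1) by (auto simp: singular_cycle_ratify)
  have "ratify (z - z') \<in> rat_boundaries k X"
    using z'(2) unfolding homologous_rel_def by (rule singular_boundary_ratify)
  then have cc': "c - c' \<in> rat_boundaries k X"
    using rat_boundaries_closed(5)[of "ratify (z - z')" k X "1 / of_int N"] N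
    by (simp add: c'_def scale_add)
  have small: "singular_simplex k (subtopology X U) f \<or> singular_simplex k (subtopology X V) f" if "c' f \<noteq> 0" for f
  proof -
    have "f \<in> Poly_Mapping.keys z'"
      using that by (auto simp: c'_def scale_def ratify_def in_keys_iff)
    moreover have "singular_simplex k X f"
      using c' that by (auto simp: rat_cycles_def rat_chains_iff)
    ultimately show ?thesis
      using z'(3) by (auto simp: singular_simplex_subtopology)
  qed
  \<comment> \<open>A simplex that lies in both open sets is assigned to \<open>u\<close>, so that
    nothing is counted twice.\<close>
  define u where "u = (\<lambda>f. if singular_simplex k (subtopology X U) f then c' f else 0)"
  define v where "v = (\<lambda>f. if singular_simplex k (subtopology X U) f then 0 else c' f)"
  have fin: "finite {f. c' f \<noteq> 0}"
    using c' by (auto simp: rat_cycles_def rat_chains_def)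
  have "{f. u f \<noteq> 0} \<subseteq> {f. c' f \<noteq> 0}" "{f. v f \<noteq> 0} \<subseteq> {f. c' f \<noteq> 0}"
    by (auto simp: u_def v_def split: if_splits)
  then have "fin_supp u" "fin_supp v"
    by (auto simp: fin_supp_def finite_subset[OF _ fin])
  moreover have "singular_simplex k (subtopology X U) f" if "u f \<noteq> 0" for f
    using that by (simp add: u_def split: if_splits)
  moreover have "singular_simplex k (subtopology X V) f" if "v f \<noteq> 0" for f
    using that small[of f] by (simp add: v_def split: if_splits)
  ultimately have "u \<in> rat_chains k (subtopology X U)" "v \<in> rat_chains k (subtopology X V)"
    unfolding rat_chains_iff by blast+
  moreover have "u + v = c'"
    by (auto simp: u_def v_def)
  ultimately show thesis
    using cc' that by metis
qed

section \<open>Cochains\<close>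

text \<open>Unlike \<open>rat_coboundary\<close>, this is not cut off outside a space, so one
  cochain serves a space and its subspaces; \<open>cocycle\<close> restricts the condition to
  simplices of \<open>X\<close>.\<close>

definition cobd :: "nat \<Rightarrow> ('a simplex \<Rightarrow> rat) \<Rightarrow> 'a simplex \<Rightarrow> rat"
  where "cobd k \<phi> \<sigma> = (\<Sum>i\<le>Suc k. (-1) ^ i * \<phi> (singular_face (Suc k) i \<sigma>))"

lemma pairing_cobd:
  assumes "fin_supp c"
  shows "pairing (cobd k \<phi>) c = pairing \<phi> (rat_boundary (Suc k) c)"
proof -
  have "pairing \<phi> (simplex_boundary (Suc k) \<sigma>) = cobd k \<phi> \<sigma>" for \<sigma>
    unfolding simplex_boundary_def cobd_def by (simp del: sum.atMost_Suc) (subst pairing_sum; simp)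
  then show ?thesis
    by (simp add: rat_boundary_lin_ext pairing_lin_ext)
qed

definition cocycle :: "nat \<Rightarrow> 'a topology \<Rightarrow> ('a simplex \<Rightarrow> rat) \<Rightarrow> bool"
  where "cocycle k X \<phi> \<longleftrightarrow> (\<forall>\<sigma>. singular_simplex (Suc k) X \<sigma> \<longrightarrow> cobd k \<phi> \<sigma> = 0)"

lemma pairing_vanish:
  "c \<in> rat_chains k X \<Longrightarrow> (\<And>\<sigma>. singular_simplex k X \<sigma> \<Longrightarrow> \<phi> \<sigma> = 0) \<Longrightarrow> pairing \<phi> c = 0"
  unfolding pairing_def by (rule sum.neutral) (auto simp: rat_chains_iff)

lemma pairing_cocycle_boundary:
  "cocycle k X \<phi> \<Longrightarrow> c \<in> rat_boundaries k X \<Longrightarrow> pairing \<phi> c = 0"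
  unfolding rat_boundaries_def cocycle_def
  using pairing_vanish[of _ "Suc k" X "cobd k \<phi>"] by (auto simp: pairing_cobd)

text \<open>The boundaries of single simplices suffice as test chains.\<close>

lemma cocycleI:
  assumes "\<And>c. c \<in> rat_boundaries k X \<Longrightarrow> pairing \<phi> c = 0"
  shows "cocycle k X \<phi>"
  unfolding cocycle_def
proof (intro allI impI)
  fix \<sigma> assume "singular_simplex (Suc k) X \<sigma>"
  then have "pairing \<phi> (rat_boundary (Suc k) (simplex_chain \<sigma>)) = 0"
    by (intro assms rat_boundariesI rat_chains_simplex)
  then show "cobd k \<phi> \<sigma> = 0"
    using pairing_cobd[of "simplex_chain \<sigma>" k \<phi>] fin_supp_simps(6)[of \<sigma>] by simp
qed

lemma cocycle_homologous:
  assumes "cocycle k X \<phi>" "c - d \<in> rat_boundaries k X" "fin_supp c" "fin_supp d"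
  shows "pairing \<phi> c = pairing \<phi> d"
  using pairing_cocycle_boundary[OF assms(1,2)] assms(3,4) by (simp add: pairing_diff)

definition pullback :: "nat \<Rightarrow> ('a \<Rightarrow> 'b) \<Rightarrow> ('b simplex \<Rightarrow> rat) \<Rightarrow> 'a simplex \<Rightarrow> rat"
  where "pullback k g \<phi> \<sigma> = \<phi> (simplex_map k g \<sigma>)"

lemma pairing_pullback: "pairing (pullback k g \<phi>) c = pairing \<phi> (rat_chain_map k g c)"
  by (simp add: rat_chain_map_lin_ext pairing_lin_ext pullback_def[abs_def])

lemma cocycle_pullback:
  assumes "cocycle k Y \<phi>" "continuous_map X Y g"
  shows "cocycle k X (pullback k g \<phi>)"
  using assms by (auto intro!: cocycleI pairing_cocycle_boundary[OF assms(1)] simp: pairing_pullback)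

section \<open>Separation by linear functionals\<close>

interpretation fun_space: vector_space "scale :: rat \<Rightarrow> ('b \<Rightarrow> rat) \<Rightarrow> _"
  by unfold_locales (simp_all add: scale_add)

interpretation fun_space_rat: vector_space_pair "scale :: rat \<Rightarrow> ('b \<Rightarrow> rat) \<Rightarrow> _" "(*) :: rat \<Rightarrow> rat \<Rightarrow> rat"
  by unfold_locales (simp_all add: algebra_simps)

text \<open>A basis of \<open>S\<close> stays independent when \<open>v\<close> is added, so values
  can be prescribed: 1 at \<open>v\<close>, 0 on the rest.\<close>

lemma separating_functional:
  assumes "fun_space.subspace S" "v \<notin> S"
  obtains L where "Vector_Spaces.linear (scale :: rat \<Rightarrow> ('b \<Rightarrow> rat) \<Rightarrow> _) (*) L"
    "\<And>u. u \<in> S \<Longrightarrow> L u = 0" "L v = 1"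
proof -
  obtain B where B: "B \<subseteq> S" "fun_space.independent B" "S \<subseteq> fun_space.span B"
    using fun_space.maximal_independent_subset by blast
  have "fun_space.span B \<subseteq> S"
    using B(1) assms(1) by (rule fun_space.span_minimal)
  then have v: "v \<notin> fun_space.span B"
    using assms(2) by blast
  then have "fun_space.independent (insert v B)"
    using B(2) by (simp add: fun_space.independent_insert)
  then obtain L where L: "Vector_Spaces.linear scale (*) L"
    "\<forall>x\<in>insert v B. L x = (if x = v then 1 else 0 :: rat)"
    using fun_space_rat.linear_independent_extend[of "insert v B" "\<lambda>x. if x = v then 1 else 0"] by blast
  have "L u = 0" if "u \<in> S" for u
  proof -
    have "u \<in> fun_space.span B"
      using B(3) that by blast
    moreover have "L x = 0" if "x \<in> B" for x
      using L(2) that v fun_space.span_base[of x B] by auto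
    ultimately show ?thesis
      using fun_space_rat.linear_eq_0_on_span[OF L(1), of B u] by blast
  qed
  then show thesis
    using L that by auto
qed

text \<open>\<open>L\<close> lives on all functions, but the indicators of simplices span only the
  finitely supported ones. On these \<open>L\<close> is evaluation of a cochain.\<close>

lemma functional_pairing:
  assumes "Vector_Spaces.linear scale (*) L" "fin_supp c"
  shows "L c = pairing (\<lambda>\<sigma>. L (simplex_chain \<sigma>)) c"
proof -
  interpret Vector_Spaces.linear scale "(*)" L by fact
  have "L c = L (lin_ext simplex_chain c)"
    by (simp only: lin_ext_id[OF assms(2)])
  also have "\<dots> = pairing (\<lambda>\<sigma>. L (simplex_chain \<sigma>)) c"
    unfolding lin_ext_alt pairing_def by (simp only: sum scale)
  finally show ?thesis .
qed

lemma subspace_rat_boundaries: "fun_space.subspace (rat_boundaries k X)"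
  by (auto simp: fun_space.subspace_def)

text \<open>A functional that vanishes on all boundaries is a cocycle, and one exists that is 1 on
  \<open>s\<close>.\<close>

lemma exists_cocycle:
  assumes "s \<in> rat_cycles k X" "s \<notin> rat_boundaries k X"
  obtains \<phi> where "cocycle k X \<phi>" "pairing \<phi> s = 1"
proof -
  obtain L where L: "Vector_Spaces.linear scale (*) L" "\<And>u. u \<in> rat_boundaries k X \<Longrightarrow> L u = 0" "L s = 1"
    using separating_functional[OF subspace_rat_boundaries assms(2)] by blast
  have "cocycle k X (\<lambda>\<sigma>. L (simplex_chain \<sigma>))"
    using L by (intro cocycleI) (simp flip: functional_pairing add: rat_boundaries_fin_supp)
  moreover have "pairing (\<lambda>\<sigma>. L (simplex_chain \<sigma>)) s = 1"
    using functional_pairing[OF L(1) rat_cyclesD(3)[OF assms(1)]] L(3) by simp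
  ultimately show thesis
    using that by blast
qed

text \<open>The graph of \<open>\<partial>c \<mapsto> \<langle>\<psi>, c\<rangle>\<close> is a subspace not containing \<open>(0, 1)\<close>; a functional that
  separates the two is the primitive. Pairs are encoded as functions on an option type.\<close>

lemma exists_primitive:
  assumes "\<And>c. c \<in> rat_cycles (Suc k) X \<Longrightarrow> pairing \<psi> c = 0"
  obtains \<phi> where "\<And>\<sigma>. singular_simplex (Suc k) X \<sigma> \<Longrightarrow> cobd k \<phi> \<sigma> = \<psi> \<sigma>"
proof -
  define pr :: "('a simplex \<Rightarrow> rat) \<Rightarrow> rat \<Rightarrow> 'a simplex option \<Rightarrow> rat"
    where "pr c t = (\<lambda>x. case x of None \<Rightarrow> t | Some \<sigma> \<Rightarrow> c \<sigma>)" for c t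
  have pr: "pr c t + pr d u = pr (c + d) (t + u)" "scale r (pr c t) = pr (scale r c) (r * t)"
    "pr c t = pr d u \<longleftrightarrow> c = d \<and> t = u" for c d t u r
  proof -
    show "pr c t + pr d u = pr (c + d) (t + u)" "scale r (pr c t) = pr (scale r c) (r * t)"
      by (auto simp: pr_def scale_def split: option.splits)
    have "pr c t (Some \<sigma>) = c \<sigma>" "pr c t None = t" for c t \<sigma>
      by (simp_all add: pr_def)
    then show "pr c t = pr d u \<longleftrightarrow> c = d \<and> t = u"
      by (metis ext)
  qed
  define S where "S = (\<lambda>c. pr (rat_boundary (Suc k) c) (pairing \<psi> c)) ` rat_chains (Suc k) X"
  have S: "fun_space.subspace S"
    unfolding fun_space.subspace_def
  proof (intro conjI ballI allI)
    have "pr 0 0 \<in> S"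
      unfolding S_def by (intro image_eqI[of _ _ 0]) auto
    moreover have "pr 0 0 = 0"
      by (auto simp: pr_def split: option.splits)
    ultimately show "0 \<in> S"
      by simp
    show "x + y \<in> S" if xy: "x \<in> S" "y \<in> S" for x y
    proof -
      obtain c d where "c \<in> rat_chains (Suc k) X" "d \<in> rat_chains (Suc k) X"
        "x = pr (rat_boundary (Suc k) c) (pairing \<psi> c)" "y = pr (rat_boundary (Suc k) d) (pairing \<psi> d)"
        using xy unfolding S_def by blast
      then show ?thesis
        unfolding S_def by (intro image_eqI[of _ _ "c + d"]) (auto simp: pr pairing_add)
    qed
    show "scale r x \<in> S" if x: "x \<in> S" for r x
    proof -
      obtain c where "c \<in> rat_chains (Suc k) X" "x = pr (rat_boundary (Suc k) c) (pairing \<psi> c)"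
        using x unfolding S_def by blast
      then show ?thesis
        unfolding S_def by (intro image_eqI[of _ _ "scale r c"]) (auto simp: pr)
    qed
  qed
  have "pr 0 1 \<notin> S"
  proof
    assume "pr 0 1 \<in> S"
    then obtain c where "c \<in> rat_chains (Suc k) X" "pr 0 1 = pr (rat_boundary (Suc k) c) (pairing \<psi> c)"
      unfolding S_def by blast
    then have "c \<in> rat_cycles (Suc k) X" "pairing \<psi> c = 1"
      by (simp_all add: pr(3) rat_cycles_def)
    then show False
      using assms[of c] by simp
  qed
  then obtain L where L: "Vector_Spaces.linear scale (*) L" "\<And>u. u \<in> S \<Longrightarrow> L u = 0" "L (pr 0 1) = 1"
    using separating_functional[OF S] by blast
  \<comment> \<open>As \<open>L\<close> kills \<open>S\<close> and is 1 at \<open>pr 0 1\<close>,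
    its value at the pair of a boundary and 0 is minus the value of \<open>\<psi>\<close> on the
    chain. The sign in \<open>M\<close> corrects this.\<close>
  define M where "M c = - L (pr c 0)" for c
  interpret L: Vector_Spaces.linear scale "(*)" L by (rule L(1))
  have M: "Vector_Spaces.linear scale (*) M"
  proof unfold_locales
    show "M (x + y) = M x + M y" for x y
      using L.add[of "pr x 0" "pr y 0"] by (simp add: pr M_def)
    show "M (scale r x) = r * M x" for r x
      using L.scale[of r "pr x 0"] by (simp add: pr M_def)
  qed
  define \<phi> where "\<phi> \<sigma> = M (simplex_chain \<sigma>)" for \<sigma>
  have "cobd k \<phi> \<sigma> = \<psi> \<sigma>" if \<sigma>: "singular_simplex (Suc k) X \<sigma>" for \<sigma>
  proof -
    let ?b = "simplex_boundary (Suc k) \<sigma>"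
    have "pr ?b (\<psi> \<sigma>) \<in> S"
      unfolding S_def using \<sigma> by (intro image_eqI[of _ _ "simplex_chain \<sigma>"]) auto
    then have "0 = L (pr ?b 0 + scale (\<psi> \<sigma>) (pr 0 1))"
      using L(2) by (simp add: pr)
    also have "\<dots> = - M ?b + \<psi> \<sigma>"
      by (subst L.add) (simp add: L.scale L(3) M_def)
    also have "M ?b = pairing \<phi> ?b"
      unfolding \<phi>_def by (rule functional_pairing[OF M]) simp
    also have "\<dots> = cobd k \<phi> \<sigma>"
      using pairing_cobd[of "simplex_chain \<sigma>" k \<phi>] fin_supp_simps(6)[of \<sigma>] by simp
    finally show ?thesis
      by simp
  qed
  then show thesis
    using that by blast
qed


section \<open>The slant product\<close>

definition front_face :: "nat \<Rightarrow> 'a simplex \<Rightarrow> 'a simplex"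
  where "front_face k \<sigma> = restrict \<sigma> (standard_simplex k)"

text \<open>The face on the last \<open>n + 1\<close> vertices: barycentric coordinates are shifted
  up by \<open>k\<close>. The restriction is there because singular simplices are extensional on the
  standard simplex.\<close>

definition back_face :: "nat \<Rightarrow> nat \<Rightarrow> 'a simplex \<Rightarrow> 'a simplex"
  where "back_face k n \<sigma> = restrict (\<lambda>x. \<sigma> (\<lambda>i. if i < k then 0 else x (i - k))) (standard_simplex n)"

lemma sum_shift: "(\<Sum>i\<le>k + n :: nat. if i < k then 0 else x (i - k)) = (\<Sum>i\<le>n. x i :: real)"
proof -
  have "(\<Sum>i\<le>k + n. if i < k then 0 else x (i - k)) = (\<Sum>i\<in>{k..k + n}. x (i - k))"
    by (rule sum.mono_neutral_cong_right) (auto simp: not_le)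
  also have "\<dots> = (\<Sum>i\<le>n. x i)"
    by (rule sum.reindex_bij_witness[of _ "\<lambda>i. i + k" "\<lambda>i. i - k"]) auto
  finally show ?thesis .
qed

lemma shift_standard_simplex:
  "x \<in> standard_simplex n \<Longrightarrow> (\<lambda>i. if i < k then 0 else x (i - k)) \<in> standard_simplex (k + n)"
  by (auto simp: standard_simplex_def sum_shift)

lemma singular_simplex_front_face:
  assumes "singular_simplex (k + n) X \<sigma>"
  shows "singular_simplex k X (front_face k \<sigma>)"
proof -
  have "standard_simplex k \<subseteq> standard_simplex (k + n)"
    by (simp add: standard_simplex_mono)
  then have "continuous_map (subtopology (powertop_real UNIV) (standard_simplex k)) X \<sigma>"
    using assms continuous_map_from_subtopology_mono unfolding singular_simplex_def by blast
  then show ?thesis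
    unfolding singular_simplex_def front_face_def by (auto elim: continuous_map_eq)
qed

lemma singular_simplex_back_face:
  assumes "singular_simplex (k + n) X \<sigma>"
  shows "singular_simplex n X (back_face k n \<sigma>)"
proof -
  let ?s = "\<lambda>(x::nat \<Rightarrow> real) i. if i < k then 0 else x (i - k)"
  have cont: "continuous_map (subtopology (powertop_real UNIV) (standard_simplex n)) euclideanreal (\<lambda>x. ?s x i)" for i
    by (cases "i < k") (auto intro!: continuous_map_from_subtopology continuous_map_product_projection)
  have "continuous_map (subtopology (powertop_real UNIV) (standard_simplex n))
      (subtopology (powertop_real UNIV) (standard_simplex (k + n))) ?s"
    using cont by (auto simp: continuous_map_in_subtopology continuous_map_componentwise_UNIV shift_standard_simplex)
  then have "continuous_map (subtopology (powertop_real UNIV) (standard_simplex n)) X (\<sigma> \<circ> ?s)"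
    using assms unfolding singular_simplex_def by (blast intro: continuous_map_compose)
  then show ?thesis
    unfolding singular_simplex_def back_face_def by (auto elim!: continuous_map_eq)
qed

section \<open>Faces of a simplex against its front and back faces\<close>

lemma standard_simplex_gt: "x \<in> standard_simplex p \<Longrightarrow> i > p \<Longrightarrow> x i = 0"
  by (auto simp: standard_simplex_def)

text \<open>The case \<open>i = Suc k\<close> is included: together with
  \<open>front_face_face_ge\<close> it identifies the last face of
  \<open>front_face (Suc k) \<sigma>\<close> as \<open>front_face k \<sigma>\<close>.\<close>

lemma front_face_face_lt:
  assumes "i \<le> Suc k"
  shows "front_face k (singular_face (Suc (k + n)) i \<sigma>) = singular_face (Suc k) i (front_face (Suc k) \<sigma>)"
proof
  fix x
  have "x \<in> standard_simplex (k + n)" if "x \<in> standard_simplex k"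
    using that standard_simplex_mono[of k "k + n"] by auto
  moreover have "simplical_face i x \<in> standard_simplex (Suc k)" if "x \<in> standard_simplex k"
    using that assms simplical_face_in_standard_simplex[of "Suc k" i x] by simp
  ultimately show "front_face k (singular_face (Suc (k + n)) i \<sigma>) x = singular_face (Suc k) i (front_face (Suc k) \<sigma>) x"
    by (auto simp: front_face_def singular_face_def restrict_def)
qed

lemma front_face_face_ge:
  assumes "i > k"
  shows "front_face k (singular_face (Suc (k + n)) i \<sigma>) = front_face k \<sigma>"
proof
  fix x
  have "x \<in> standard_simplex (k + n)" "simplical_face i x = x" if x: "x \<in> standard_simplex k"
  proof -
    show "x \<in> standard_simplex (k + n)"
      using x standard_simplex_mono[of k "k + n"] by auto
    have "simplical_face i x j = x j" for j
      using standard_simplex_gt[OF x, of j] standard_simplex_gt[OF x, of "j - 1"] assms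
      by (auto simp: simplical_face_def)
    then show "simplical_face i x = x"
      by blast
  qed
  then show "front_face k (singular_face (Suc (k + n)) i \<sigma>) x = front_face k \<sigma> x"
    by (auto simp: front_face_def singular_face_def restrict_def)
qed

lemma back_face_face_lt:
  assumes "i \<le> k"
  shows "back_face k n (singular_face (Suc (k + n)) i \<sigma>) = back_face (Suc k) n \<sigma>"
proof
  fix x :: "nat \<Rightarrow> real"
  have "simplical_face i (\<lambda>j. if j < k then 0 else x (j - k)) = (\<lambda>j. if j < Suc k then 0 else x (j - Suc k))"
    using assms by (auto simp: simplical_face_def fun_eq_iff)
  then show "back_face k n (singular_face (Suc (k + n)) i \<sigma>) x = back_face (Suc k) n \<sigma> x"
    by (simp add: back_face_def singular_face_def restrict_def shift_standard_simplex)
qed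

text \<open>For \<open>j = 0\<close> this overlaps with \<open>back_face_face_lt\<close>, and
  together they identify face 0 of \<open>back_face k (Suc n) \<sigma>\<close> as
  \<open>back_face (Suc k) n \<sigma>\<close>.\<close>

lemma back_face_face_ge:
  assumes "j \<le> Suc n"
  shows "back_face k n (singular_face (Suc (k + n)) (k + j) \<sigma>) = singular_face (Suc n) j (back_face k (Suc n) \<sigma>)"
proof
  fix x :: "nat \<Rightarrow> real"
  have "simplical_face (k + j) (\<lambda>i. if i < k then 0 else x (i - k))
      = (\<lambda>i. if i < k then 0 else simplical_face j x (i - k))"
    by (auto simp: simplical_face_def fun_eq_iff diff_diff_eq add.commute)
  moreover have "simplical_face j x \<in> standard_simplex (Suc n)" if "x \<in> standard_simplex n"
    using that assms simplical_face_in_standard_simplex[of "Suc n" j x] by simp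
  ultimately show "back_face k n (singular_face (Suc (k + n)) (k + j) \<sigma>) x
      = singular_face (Suc n) j (back_face k (Suc n) \<sigma>) x"
    by (simp add: back_face_def singular_face_def restrict_def shift_standard_simplex)
qed

lemma front_face_simplex_map: "front_face k (simplex_map (k + n) g \<sigma>) = simplex_map k g (front_face k \<sigma>)"
  using standard_simplex_mono[of k "k + n"] by (auto simp: front_face_def simplex_map_def restrict_def fun_eq_iff)

lemma back_face_simplex_map: "back_face k n (simplex_map (k + n) g \<sigma>) = simplex_map n g (back_face k n \<sigma>)"
  by (auto simp: back_face_def simplex_map_def restrict_def fun_eq_iff shift_standard_simplex)

text \<open>The slant product in Alexander-Whitney form: \<open>\<psi>\<close> consumes the back
  face, projected to the second factor, and the front face, projected to the first, remains.\<close>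

definition slant :: "nat \<Rightarrow> nat \<Rightarrow> ('w simplex \<Rightarrow> rat) \<Rightarrow> (('y \<times> 'w) simplex \<Rightarrow> rat) \<Rightarrow> 'y simplex \<Rightarrow> rat"
  where "slant k n \<psi> = lin_ext (\<lambda>\<sigma>. scale (\<psi> (simplex_map n snd (back_face k n \<sigma>)))
           (simplex_chain (simplex_map k fst (front_face k \<sigma>))))"

lemma slant_simps [simp]:
  "slant k n \<psi> 0 = 0"
  "slant k n \<psi> (scale r c) = scale r (slant k n \<psi> c)"
  "slant k n \<psi> (- c) = - slant k n \<psi> c"
  "fin_supp c \<Longrightarrow> fin_supp d \<Longrightarrow> slant k n \<psi> (c + d) = slant k n \<psi> c + slant k n \<psi> d"
  "fin_supp c \<Longrightarrow> fin_supp d \<Longrightarrow> slant k n \<psi> (c - d) = slant k n \<psi> c - slant k n \<psi> d"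
  "fin_supp (slant k n \<psi> c)"
  by (auto simp: slant_def lin_ext_add lin_ext_diff lin_ext_scale lin_ext_minus lin_ext_zero)

lemma slant_in_chains [intro]:
  assumes "c \<in> rat_chains (k + n) (prod_topology Y W)"
  shows "slant k n \<psi> c \<in> rat_chains k Y"
  unfolding slant_def
  using assms
  by (rule rat_chains_lin_ext)
    (auto intro!: rat_chains_scale rat_chains_simplex singular_simplex_simplex_map singular_simplex_front_face
      continuous_map_fst)

text \<open>This allows a coboundary to be replaced by 0, or by the cochain it is a primitive of,
  when they agree on the simplices of \<open>W\<close> only.\<close>

lemma slant_cong:
  assumes "c \<in> rat_chains (k + n) (prod_topology Y W)" "\<And>\<sigma>. singular_simplex n W \<sigma> \<Longrightarrow> \<phi> \<sigma> = \<psi> \<sigma>"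
  shows "slant k n \<phi> c = slant k n \<psi> c"
  unfolding slant_def
proof (rule lin_ext_cong)
  fix \<sigma> assume "c \<sigma> \<noteq> 0"
  then have "singular_simplex (k + n) (prod_topology Y W) \<sigma>"
    using assms(1) by (auto simp: rat_chains_iff)
  then have "singular_simplex n W (simplex_map n snd (back_face k n \<sigma>))"
    by (meson singular_simplex_simplex_map singular_simplex_back_face continuous_map_snd)
  then show "scale (\<phi> (simplex_map n snd (back_face k n \<sigma>))) (simplex_chain (simplex_map k fst (front_face k \<sigma>)))
    = scale (\<psi> (simplex_map n snd (back_face k n \<sigma>))) (simplex_chain (simplex_map k fst (front_face k \<sigma>)))"
    using assms(2) by simp
qed

lemma slant_zero: "slant k n (\<lambda>_. 0) c = 0"
  by (simp add: slant_def lin_ext_zero)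

lemma slant_diff_left: "slant k n (\<lambda>\<sigma>. \<phi> \<sigma> - \<psi> \<sigma>) c = slant k n \<phi> c - slant k n \<psi> c"
  and slant_scale_left: "slant k n (\<lambda>\<sigma>. r * \<phi> \<sigma>) c = scale r (slant k n \<phi> c)"
  by (auto simp: slant_def lin_ext_def scale_def pairing_left algebra_simps simp flip: pairing_left(3))

lemma slant_natural:
  "slant k n \<psi> (rat_chain_map (k + n) (\<lambda>z. (g (fst z), h (snd z))) c)
    = rat_chain_map k g (slant k n (pullback n h \<psi>) c)"
proof -
  let ?m = "\<lambda>z. (g (fst z), h (snd z))"
  have fst: "simplex_map k fst (simplex_map k ?m \<tau>) = simplex_map k g (simplex_map k fst \<tau>)" for \<tau>
    by (auto simp: simplex_map_def restrict_def fun_eq_iff)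
  have snd: "simplex_map n snd (simplex_map n ?m \<tau>) = simplex_map n h (simplex_map n snd \<tau>)" for \<tau>
    by (auto simp: simplex_map_def restrict_def fun_eq_iff)
  show ?thesis
    by (simp add: slant_def rat_chain_map_lin_ext lin_ext_lin_ext lin_ext_simplex_chain lin_ext_scale
        front_face_simplex_map back_face_simplex_map fst snd pullback_def)
qed

lemma singular_face_simplex_map':
  "i \<le> Suc k \<Longrightarrow> singular_face (Suc k) i (simplex_map (Suc k) g \<sigma>) = simplex_map k g (singular_face (Suc k) i \<sigma>)"
  by (auto simp: singular_face_def simplex_map_def restrict_def fun_eq_iff simplical_face_in_standard_simplex)

lemma cobd_pullback: "cobd k (pullback k g \<phi>) = pullback (Suc k) g (cobd k \<phi>)"
  by (rule ext) (simp del: sum.atMost_Suc add: cobd_def pullback_def singular_face_simplex_map')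

lemma scale_left_sum: "scale (\<Sum>i\<in>I. f i) c = (\<Sum>i\<in>I. scale (f i) c)"
  by (rule ext) (simp add: scale_def sum_fun_apply sum_distrib_right)

text \<open>Leibniz rule. Faces up to \<open>k\<close> shorten the front face and later ones the
  back face. The boundary of the front face and the coboundary of \<open>\<psi>\<close> each have
  one term more; the two extra terms are equal up to sign and cancel.\<close>

lemma slant_boundary:
  fixes c :: "('y \<times> 'w) simplex \<Rightarrow> rat"
  assumes "fin_supp c"
  shows "rat_boundary (Suc k) (slant (Suc k) n \<psi> c)
    = slant k n \<psi> (rat_boundary (Suc (k + n)) c) + scale ((-1) ^ Suc k) (slant k (Suc n) (cobd n \<psi>) c)"
proof -
  define F where "F \<tau> = simplex_chain (simplex_map k fst \<tau>)" for \<tau> :: "('y \<times> 'w) simplex"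
  define \<omega> :: "('y \<times> 'w) simplex \<Rightarrow> rat" where "\<omega> = pullback n snd \<psi>"
  have *: "scale (\<omega> (back_face (Suc k) n \<sigma>)) (simplex_boundary (Suc k) (simplex_map (Suc k) fst (front_face (Suc k) \<sigma>)))
     = slant k n \<psi> (simplex_boundary (Suc (k + n)) \<sigma>)
       + scale ((-1) ^ Suc k) (scale (cobd n \<omega> (back_face k (Suc n) \<sigma>)) (F (front_face k \<sigma>)))"
    (is "?L = ?S + ?D") for \<sigma> :: "('y \<times> 'w) simplex"
  proof -
    let ?t = "\<lambda>i. scale ((-1) ^ i * \<omega> (back_face k n (singular_face (Suc (k + n)) i \<sigma>)))
      (F (front_face k (singular_face (Suc (k + n)) i \<sigma>)))"
    let ?b = "\<omega> (back_face (Suc k) n \<sigma>)"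
    have "?S = (\<Sum>i\<le>Suc (k + n). ?t i)"
      unfolding slant_def simplex_boundary_def
      by (simp del: sum.atMost_Suc) (subst lin_ext_sum; simp add: lin_ext_scale lin_ext_simplex_chain F_def \<omega>_def pullback_def)
    also have "{..Suc (k + n)} = {..k} \<union> {Suc k..Suc (k + n)}"
      by auto
    also have "sum ?t \<dots> = sum ?t {..k} + sum ?t {Suc k..Suc (k + n)}"
      by (rule sum.union_disjoint) auto
    also have "sum ?t {..k} = (\<Sum>i\<le>k. scale ?b (scale ((-1) ^ i) (F (singular_face (Suc k) i (front_face (Suc k) \<sigma>)))))"
      using back_face_face_lt[of _ k n \<sigma>] front_face_face_lt[of _ k n \<sigma>]
      by (intro sum.cong) (auto simp: mult.commute)
    \<comment> \<open>The full boundary of the front face also contains face \<open>Suc k\<close>,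
      which is split off here.\<close>
    also have "\<dots> = ?L - scale ((-1) ^ Suc k * ?b) (F (front_face k \<sigma>))"
    proof -
      have "?L = (\<Sum>i\<le>Suc k. scale ?b (scale ((-1) ^ i) (F (singular_face (Suc k) i (front_face (Suc k) \<sigma>)))))"
        unfolding simplex_boundary_def
        by (simp del: sum.atMost_Suc add: scale_sum F_def singular_face_simplex_map')
      moreover have "singular_face (Suc k) (Suc k) (front_face (Suc k) \<sigma>) = front_face k \<sigma>"
        using front_face_face_lt[of "Suc k" k n \<sigma>] front_face_face_ge[of k "Suc k" n \<sigma>] by simp
      ultimately show ?thesis
        by (simp add: mult.commute)
    qed
    also have "sum ?t {Suc k..Suc (k + n)}
      = (\<Sum>j\<in>{1..Suc n}. scale ((-1) ^ (k + j) * \<omega> (singular_face (Suc n) j (back_face k (Suc n) \<sigma>))) (F (front_face k \<sigma>)))"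
    proof (rule sum.reindex_bij_witness[of _ "\<lambda>j. k + j" "\<lambda>i. i - k"])
      fix i assume i: "i \<in> {Suc k..Suc (k + n)}"
      then show "scale ((-1) ^ (k + (i - k)) * \<omega> (singular_face (Suc n) (i - k) (back_face k (Suc n) \<sigma>))) (F (front_face k \<sigma>)) = ?t i"
        using back_face_face_ge[of "i - k" n k \<sigma>] front_face_face_ge[of k i n \<sigma>] by auto
    qed auto
    also have "\<dots> = scale ((-1) ^ k * (\<Sum>j\<in>{1..Suc n}. (-1) ^ j * \<omega> (singular_face (Suc n) j (back_face k (Suc n) \<sigma>))))
        (F (front_face k \<sigma>))"
      by (simp only: sum_distrib_left scale_left_sum power_add mult.assoc)
    \<comment> \<open>The full coboundary also contains face 0, whose value \<open>?b\<close>
      matches the term split off above.\<close>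
    also have "(\<Sum>j\<in>{1..Suc n}. (-1) ^ j * \<omega> (singular_face (Suc n) j (back_face k (Suc n) \<sigma>)))
        = cobd n \<omega> (back_face k (Suc n) \<sigma>) - ?b"
    proof -
      have "{..Suc n} = insert 0 {1..Suc n}"
        by auto
      then have "cobd n \<omega> (back_face k (Suc n) \<sigma>) = \<omega> (singular_face (Suc n) 0 (back_face k (Suc n) \<sigma>))
        + (\<Sum>j\<in>{1..Suc n}. (-1) ^ j * \<omega> (singular_face (Suc n) j (back_face k (Suc n) \<sigma>)))"
        unfolding cobd_def by simp
      moreover have "singular_face (Suc n) 0 (back_face k (Suc n) \<sigma>) = back_face (Suc k) n \<sigma>"
        using back_face_face_ge[of 0 n k \<sigma>] back_face_face_lt[of k k n \<sigma>] by simp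
      ultimately show ?thesis
        by simp
    qed
    finally show ?thesis
      by (simp add: fun_eq_iff scale_def algebra_simps)
  qed
  have "rat_boundary (Suc k) (slant (Suc k) n \<psi> c)
     = lin_ext (\<lambda>\<sigma>. scale (\<omega> (back_face (Suc k) n \<sigma>)) (simplex_boundary (Suc k) (simplex_map (Suc k) fst (front_face (Suc k) \<sigma>)))) c"
    by (simp add: rat_boundary_lin_ext slant_def lin_ext_lin_ext lin_ext_scale lin_ext_simplex_chain \<omega>_def pullback_def)
  also have "\<dots> = lin_ext (\<lambda>\<sigma>. slant k n \<psi> (simplex_boundary (Suc (k + n)) \<sigma>)) c
      + scale ((-1) ^ Suc k) (lin_ext (\<lambda>\<sigma>. scale (cobd n \<omega> (back_face k (Suc n) \<sigma>)) (F (front_face k \<sigma>))) c)"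
    unfolding * lin_ext_def by (auto simp: scale_def pairing_left simp flip: pairing_left(3))
  also have "lin_ext (\<lambda>\<sigma>. slant k n \<psi> (simplex_boundary (Suc (k + n)) \<sigma>)) c = slant k n \<psi> (rat_boundary (Suc (k + n)) c)"
    unfolding slant_def rat_boundary_lin_ext by (simp add: lin_ext_lin_ext)
  also have "lin_ext (\<lambda>\<sigma>. scale (cobd n \<omega> (back_face k (Suc n) \<sigma>)) (F (front_face k \<sigma>))) c = slant k (Suc n) (cobd n \<psi>) c"
    unfolding slant_def \<omega>_def cobd_pullback F_def by (simp add: pullback_def)
  finally show ?thesis .
qed

section \<open>The homology of a product with a sphere\<close>

lemma cocycle_subtopology: "cocycle k X \<phi> \<Longrightarrow> cocycle k (subtopology X S) \<phi>"
  by (simp add: cocycle_def singular_simplex_subtopology)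

lemma cocycle_diff_cobd:
  assumes "cocycle (Suc k) X \<phi>"
  shows "cocycle (Suc k) X (\<lambda>\<sigma>. \<phi> \<sigma> - cobd k \<psi> \<sigma>)"
proof (rule cocycleI)
  fix c assume c: "c \<in> rat_boundaries (Suc k) X"
  then show "pairing (\<lambda>\<sigma>. \<phi> \<sigma> - cobd k \<psi> \<sigma>) c = 0"
    using pairing_cocycle_boundary[OF assms c] rat_cyclesD[OF rat_boundaries_cycles[OF c]]
    by (simp add: pairing_left pairing_cobd)
qed

text \<open>The constant cochain 1 is a cocycle, since a 1-simplex has two faces of opposite
  sign.\<close>

lemma pairing_augmentation: "c \<in> rat_boundaries 0 X \<Longrightarrow> pairing (\<lambda>_. 1) c = 0"
  by (rule pairing_cocycle_boundary[of 0 X]) (auto simp: cocycle_def cobd_def)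

lemma pairing_augmentation_chain_map [simp]:
  "pairing (\<lambda>_. 1) (rat_chain_map k g c) = pairing (\<lambda>_. 1) c"
  using pairing_pullback[of k g "\<lambda>_. 1" c] by (simp add: pullback_def[abs_def])

lemma rat_cycles_singleton:
  assumes "k > 0" "topspace X = {a}" "c \<in> rat_cycles k X"
  shows "c \<in> rat_boundaries k X"
proof -
  obtain N z where N: "N > 0" "singular_chain k X z" "ratify z = scale (of_int N) c"
    using clear_denominators[of c k X] assms(3) by (auto simp: rat_cycles_def)
  have "singular_relcycle k X {} z"
    using assms(3) by (auto simp: singular_cycle_ratify N(3))
  moreover have "X = subtopology X {a}"
    by (metis assms(2) subtopology_topspace)
  ultimately have "singular_relboundary k X {} z"
    using singular_boundary_eq_cycle_singleton[of X a k z] assms(1,2) by auto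
  then show ?thesis
    using N singular_boundary_ratify[of k X z] by (simp add: rat_boundaries_scale_iff)
qed

lemma rat_cycles_contractible:
  assumes "k > 0" "contractible_space X" "c \<in> rat_cycles k X"
  shows "c \<in> rat_boundaries k X"
proof (cases "topspace X = {}")
  case True
  then show ?thesis
    using assms(3) rat_chains_empty[of X k] by (auto simp: rat_cycles_def)
next
  case False
  then obtain a where a: "a \<in> topspace X"
    by blast
  then have "homotopic_with (\<lambda>_. True) X X id (\<lambda>_. a)"
    using assms(2) by (simp add: contractible_space_alt)
  then have 1: "c - rat_chain_map k (\<lambda>_. a) c \<in> rat_boundaries k X"
    using rat_boundaries_homotopic[OF _ assms(3), of X id "\<lambda>_. a"] rat_chain_map_id[of c k X id] assms(3)
    by (simp add: rat_cycles_def)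
  have "rat_chain_map k (\<lambda>_. a) c \<in> rat_cycles k (subtopology X {a})"
    using assms(3) a by (intro rat_chain_map_cycles) auto
  then have "rat_chain_map k (\<lambda>_. a) c \<in> rat_boundaries k (subtopology X {a})"
    using a assms(1) by (intro rat_cycles_singleton[of k _ a]) auto
  then show ?thesis
    using rat_boundaries_diff_cancel[OF 1] rat_boundaries_mono by blast
qed

text \<open>Contracting the second factor to \<open>p\<close> deforms the product onto a copy of
  \<open>Y\<close>.\<close>

lemma rat_cycles_prod_contractible:
  assumes "contractible_space V" "p \<in> topspace V" "c \<in> rat_cycles k (prod_topology Y V)"
  shows "c - rat_chain_map k (\<lambda>z. (fst z, p)) c \<in> rat_boundaries k (prod_topology Y V)"
proof -
  have "homotopic_with (\<lambda>_. True) V V id (\<lambda>_. p)"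
    using assms(1,2) by (simp add: contractible_space_alt)
  then have "homotopic_with (\<lambda>_. True) (prod_topology Y V) (prod_topology Y V)
      (\<lambda>z. (id (fst z), id (snd z))) (\<lambda>z. (id (fst z), p))"
    by (rule homotopic_with_prod_topology[where p = "\<lambda>_. True" and q = "\<lambda>_. True", rotated])
      (simp_all add: homotopic_with_refl)
  then have "rat_chain_map k (\<lambda>z. z) c - rat_chain_map k (\<lambda>z. (fst z, p)) c \<in> rat_boundaries k (prod_topology Y V)"
    using rat_boundaries_homotopic[OF _ assms(3)] by simp
  then show ?thesis
    using rat_chain_map_id[of c k "prod_topology Y V" "\<lambda>z. z"] assms(3) by (simp add: rat_cycles_def)
qed

lemma continuous_map_section: "p \<in> topspace W \<Longrightarrow> continuous_map Y (prod_topology Y W) (\<lambda>y. (y, p))"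
  by (auto simp: continuous_map_pairwise o_def)

lemma rat_chains_prod_subtopology:
  "c \<in> rat_chains k (prod_topology Y (subtopology W U)) \<Longrightarrow> c \<in> rat_chains k (prod_topology Y W)"
  "c \<in> rat_cycles k (prod_topology Y (subtopology W U)) \<Longrightarrow> c \<in> rat_cycles k (prod_topology Y W)"
  "c \<in> rat_boundaries k (prod_topology Y (subtopology W U)) \<Longrightarrow> c \<in> rat_boundaries k (prod_topology Y W)"
  unfolding prod_topology_subtopology(2)
  by (fact rat_chains_mono(2) rat_cycles_mono rat_boundaries_mono)+

lemma rat_chains_prod_Int:
  assumes "c \<in> rat_chains k (prod_topology Y (subtopology W U))" "c \<in> rat_chains k (prod_topology Y (subtopology W V))"
  shows "c \<in> rat_chains k (prod_topology Y (subtopology W (U \<inter> V)))"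
  using assms rat_chains_Int[of c k "prod_topology Y W" "topspace Y \<times> U" "topspace Y \<times> V"]
  unfolding prod_topology_subtopology(2) by (simp add: Times_Int_Times)

lemma rat_chains_prod_mono:
  assumes "c \<in> rat_chains k (prod_topology Y (subtopology W U))" "U \<subseteq> V"
  shows "c \<in> rat_chains k (prod_topology Y (subtopology W V))"
  using assms rat_chains_mono(1)[of c k "prod_topology Y W" "topspace Y \<times> U" "topspace Y \<times> V"]
  unfolding prod_topology_subtopology(2) by auto

text \<open>The coboundary term in \<open>slant_boundary\<close> drops out, so the slant of a
  boundary is the boundary of a slant.\<close>

lemma slant_rat_boundaries:
  assumes "cocycle n W \<psi>" "c \<in> rat_boundaries (k + n) (prod_topology Y W)"
  shows "slant k n \<psi> c \<in> rat_boundaries k Y"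
proof -
  obtain d where d: "c = rat_boundary (Suc (k + n)) d" "d \<in> rat_chains (Suc (k + n)) (prod_topology Y W)"
    using assms(2) by (auto simp: rat_boundaries_def)
  have "slant k (Suc n) (cobd n \<psi>) d = slant k (Suc n) (\<lambda>_. 0) d"
    using d(2) assms(1) by (intro slant_cong[where Y = Y and W = W]) (auto simp: cocycle_def)
  then have "slant k n \<psi> c = rat_boundary (Suc k) (slant (Suc k) n \<psi> d)"
    using slant_boundary[of d k n \<psi>] d by (simp add: slant_zero)
  moreover have "slant (Suc k) n \<psi> d \<in> rat_chains (Suc k) Y"
    using d(2) by (intro slant_in_chains) simp
  ultimately show ?thesis
    by (auto intro: rat_boundariesI)
qed

text \<open>Hence on homology the slant product depends only on the cohomology class of the
  cochain.\<close>

lemma slant_cobd: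
  assumes "c \<in> rat_cycles (Suc (k + n)) (prod_topology Y W)"
  shows "slant k (Suc n) (cobd n \<psi>) c \<in> rat_boundaries k Y"
proof -
  have c: "c \<in> rat_chains (Suc (k + n)) (prod_topology Y W)" "rat_boundary (Suc (k + n)) c = 0"
    using assms by (auto simp: rat_cycles_def)
  then have "rat_boundary (Suc k) (slant (Suc k) n \<psi> c) = scale ((-1) ^ Suc k) (slant k (Suc n) (cobd n \<psi>) c)"
    using slant_boundary[of c k n \<psi>] by simp
  moreover have "slant (Suc k) n \<psi> c \<in> rat_chains (Suc k) Y"
    using c by (intro slant_in_chains) simp
  ultimately have "scale ((-1) ^ Suc k) (slant k (Suc n) (cobd n \<psi>) c) \<in> rat_boundaries k Y"
    by (metis rat_boundariesI)
  then show ?thesis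
    by (subst (asm) rat_boundaries_scale_iff) auto
qed

lemma slant_cycles:
  assumes "cocycle n W \<psi>" "c \<in> rat_cycles (k + n) (prod_topology Y W)"
  shows "slant k n \<psi> c \<in> rat_cycles k Y"
proof (cases k)
  \<comment> \<open>\<open>slant_boundary\<close> speaks of positive degrees only; in degree 0 every
    chain is a cycle.\<close>
  case 0
  then show ?thesis
    using assms(2) slant_in_chains[of c 0 n Y W \<psi>] by (auto simp: rat_cycles_def)
next
  case (Suc j)
  have c: "c \<in> rat_chains (Suc (j + n)) (prod_topology Y W)" "rat_boundary (Suc (j + n)) c = 0"
    using assms(2) by (auto simp: rat_cycles_def Suc)
  have "slant j (Suc n) (cobd n \<psi>) c = slant j (Suc n) (\<lambda>_. 0) c"
    using c assms(1) by (intro slant_cong[where Y = Y and W = W]) (auto simp: cocycle_def)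
  then have "rat_boundary (Suc j) (slant (Suc j) n \<psi> c) = 0"
    using slant_boundary[of c j n \<psi>] c by (simp add: slant_zero)
  then show ?thesis
    using slant_in_chains[of c k n Y W \<psi>] c by (simp add: rat_cycles_def Suc)
qed

lemma slant_map_snd:
  assumes "c \<in> rat_chains (k + n) (prod_topology Y W)"
  shows "slant k n \<psi> (rat_chain_map (k + n) (\<lambda>z. (fst z, h (snd z))) c) = slant k n (pullback n h \<psi>) c"
proof -
  have "slant k n (pullback n h \<psi>) c \<in> rat_chains k Y"
    using assms by (rule slant_in_chains)
  then show ?thesis
    using slant_natural[of k n \<psi> "\<lambda>y. y" h c] rat_chain_map_id[of _ k Y "\<lambda>y. y"] by simp
qed

text \<open>Nonzero on reduced homology. The augmentation condition for \<open>n = 0\<close>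
  excludes the constant cocycles on the two-point sphere.\<close>

definition nontrivial_on :: "nat \<Rightarrow> 'a topology \<Rightarrow> ('a simplex \<Rightarrow> rat) \<Rightarrow> bool"
  where "nontrivial_on n W \<psi> \<longleftrightarrow>
    (\<exists>s\<in>rat_cycles n W. (n = 0 \<longrightarrow> pairing (\<lambda>_. 1) s = 0) \<and> pairing \<psi> s \<noteq> 0)"

text \<open>Elementwise form of the isomorphism given by the projection and the slant product. Below
  degree \<open>n\<close> the projection alone is injective; writing the other degrees as
  \<open>k + n\<close> avoids truncated subtraction. Surjectivity is demanded within the kernel of
  the projection: in the induction such cycles bound over either contractible piece.\<close>

definition kunneth_sphere :: "'y topology \<Rightarrow> nat \<Rightarrow> 'w topology \<Rightarrow> bool"
  where "kunneth_sphere Y n W \<longleftrightarrow>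
    (\<forall>k<n. \<forall>z\<in>rat_cycles k (prod_topology Y W).
       rat_chain_map k fst z \<in> rat_boundaries k Y \<longrightarrow> z \<in> rat_boundaries k (prod_topology Y W)) \<and>
    (\<forall>\<psi>. cocycle n W \<psi> \<longrightarrow> nontrivial_on n W \<psi> \<longrightarrow>
      (\<forall>k. (\<forall>z\<in>rat_cycles (k + n) (prod_topology Y W).
               rat_chain_map (k + n) fst z \<in> rat_boundaries (k + n) Y \<longrightarrow>
               slant k n \<psi> z \<in> rat_boundaries k Y \<longrightarrow> z \<in> rat_boundaries (k + n) (prod_topology Y W)) \<and>
           (\<forall>\<zeta>\<in>rat_cycles k Y. \<exists>z\<in>rat_cycles (k + n) (prod_topology Y W).
               rat_chain_map (k + n) fst z \<in> rat_boundaries (k + n) Y \<and>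
               slant k n \<psi> z - \<zeta> \<in> rat_boundaries k Y)))"

text \<open>As \<open>h \<circ> r\<close> is homotopic to the identity, \<open>r\<close> is
  injective on homology, which carries injectivity over, and \<open>h\<close> pushes the required
  preimages from \<open>W'\<close> to \<open>W\<close>.\<close>

lemma kunneth_sphere_dominated:
  assumes kun: "kunneth_sphere Y n W'"
    and h: "continuous_map W' W h" and r: "continuous_map W W' r"
    and hr: "homotopic_with (\<lambda>_. True) W W (h \<circ> r) id"
  shows "kunneth_sphere Y n W"
proof -
  let ?h = "\<lambda>z. (fst z, h (snd z))" and ?r = "\<lambda>z. (fst z, r (snd z))"
  have H: "continuous_map (prod_topology Y W') (prod_topology Y W) ?h"
    and R: "continuous_map (prod_topology Y W) (prod_topology Y W') ?r"
    using continuous_map_compose[OF continuous_map_snd h, of Y] continuous_map_compose[OF continuous_map_snd r, of Y]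
    by (simp_all add: continuous_map_pairwise o_def continuous_map_fst)
  have fst_h: "rat_chain_map k fst (rat_chain_map k ?h c) = rat_chain_map k fst c"
    and fst_r: "rat_chain_map k fst (rat_chain_map k ?r d) = rat_chain_map k fst d" for k c d
    by (simp_all add: rat_chain_map_compose o_def)
  have hrz: "rat_chain_map k ?h (rat_chain_map k ?r z) - z \<in> rat_boundaries k (prod_topology Y W)"
    if z: "z \<in> rat_cycles k (prod_topology Y W)" for k z
  proof -
    have "homotopic_with (\<lambda>_. True) (prod_topology Y W) (prod_topology Y W)
        (\<lambda>z. (id (fst z), (h \<circ> r) (snd z))) (\<lambda>z. (id (fst z), id (snd z)))"
      by (rule homotopic_with_prod_topology[OF _ hr, where p = "\<lambda>_. True"]) (simp_all add: homotopic_with_refl)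
    from rat_boundaries_homotopic[OF this z] show ?thesis
      using rat_chain_map_id[of z k "prod_topology Y W" "\<lambda>z. z"] z
      by (simp add: rat_chain_map_compose o_def rat_cycles_def)
  qed
  have pull: "z \<in> rat_boundaries k (prod_topology Y W)"
    if "z \<in> rat_cycles k (prod_topology Y W)" "rat_chain_map k ?r z \<in> rat_boundaries k (prod_topology Y W')" for k z
    using rat_boundaries_diff_cancel[OF hrz[OF that(1)]] rat_chain_map_boundaries[OF that(2) H] by blast
  have low: "z \<in> rat_boundaries k (prod_topology Y W')"
    if "k < n" "z \<in> rat_cycles k (prod_topology Y W')" "rat_chain_map k fst z \<in> rat_boundaries k Y" for k z
    using kun that unfolding kunneth_sphere_def by blast
  show ?thesis
    unfolding kunneth_sphere_def
  proof (intro conjI allI impI ballI)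
    fix k z assume "k < n" "z \<in> rat_cycles k (prod_topology Y W)" "rat_chain_map k fst z \<in> rat_boundaries k Y"
    then show "z \<in> rat_boundaries k (prod_topology Y W)"
      using low[of k "rat_chain_map k ?r z"] R by (intro pull) (simp_all add: fst_r rat_chain_map_cycles)
  next
    fix \<psi> k assume \<psi>: "cocycle n W \<psi>" "nontrivial_on n W \<psi>"
    then obtain s where s: "s \<in> rat_cycles n W" "n = 0 \<longrightarrow> pairing (\<lambda>_. 1) s = 0" "pairing \<psi> s \<noteq> 0"
      by (auto simp: nontrivial_on_def)
    let ?\<psi> = "pullback n h \<psi>"
    \<comment> \<open>Moving \<open>s\<close> to \<open>W'\<close> and back keeps its class, so the
      pulled back cocycle is nonzero on the image of \<open>s\<close> under
      \<open>r\<close>.\<close>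
    have "rat_chain_map n h (rat_chain_map n r s) - s \<in> rat_boundaries n W"
      using rat_boundaries_homotopic[OF hr s(1)] rat_chain_map_id[of s n W id] s(1)
      by (simp add: rat_chain_map_compose rat_cycles_def)
    then have "pairing \<psi> (rat_chain_map n h (rat_chain_map n r s)) = pairing \<psi> s"
      using s(1) \<psi>(1) by (intro cocycle_homologous[of n W]) (auto simp: rat_cycles_def)
    then have "nontrivial_on n W' ?\<psi>"
      unfolding nontrivial_on_def using s r
      by (intro bexI[of _ "rat_chain_map n r s"]) (auto simp: pairing_pullback)
    moreover have "cocycle n W' ?\<psi>"
      using \<psi>(1) h by (rule cocycle_pullback)
    ultimately have inj: "z \<in> rat_cycles (k + n) (prod_topology Y W') \<Longrightarrow>
               rat_chain_map (k + n) fst z \<in> rat_boundaries (k + n) Y \<Longrightarrow>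
               slant k n ?\<psi> z \<in> rat_boundaries k Y \<Longrightarrow> z \<in> rat_boundaries (k + n) (prod_topology Y W')"
      and surj: "\<zeta> \<in> rat_cycles k Y \<Longrightarrow> \<exists>z\<in>rat_cycles (k + n) (prod_topology Y W').
               rat_chain_map (k + n) fst z \<in> rat_boundaries (k + n) Y \<and>
               slant k n ?\<psi> z - \<zeta> \<in> rat_boundaries k Y" for z \<zeta>
      using kun unfolding kunneth_sphere_def by blast+
    show "z \<in> rat_boundaries (k + n) (prod_topology Y W)"
      if z: "z \<in> rat_cycles (k + n) (prod_topology Y W)" "rat_chain_map (k + n) fst z \<in> rat_boundaries (k + n) Y"
        "slant k n \<psi> z \<in> rat_boundaries k Y" for z
    proof (rule pull[OF z(1)])
      let ?z = "rat_chain_map (k + n) ?r z"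
      have rz: "?z \<in> rat_cycles (k + n) (prod_topology Y W')"
        using z(1) R by blast
      have "slant k n \<psi> (rat_chain_map (k + n) ?h ?z - z) \<in> rat_boundaries k Y"
        using \<psi>(1) hrz[OF z(1)] by (rule slant_rat_boundaries)
      then have "slant k n ?\<psi> ?z - slant k n \<psi> z \<in> rat_boundaries k Y"
        using rat_cyclesD(3)[OF z(1)] slant_map_snd[OF rat_cyclesD(1)[OF rz], of \<psi> h] by simp
      then have "slant k n ?\<psi> ?z \<in> rat_boundaries k Y"
        using z(3) rat_boundaries_diff_cancel by blast
      then show "?z \<in> rat_boundaries (k + n) (prod_topology Y W')"
        using inj[OF rz] z(2) by (simp add: fst_r)
    qed
    show "\<exists>z\<in>rat_cycles (k + n) (prod_topology Y W).
               rat_chain_map (k + n) fst z \<in> rat_boundaries (k + n) Y \<and>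
               slant k n \<psi> z - \<zeta> \<in> rat_boundaries k Y" if \<zeta>: "\<zeta> \<in> rat_cycles k Y" for \<zeta>
    proof -
      obtain z where z: "z \<in> rat_cycles (k + n) (prod_topology Y W')"
               "rat_chain_map (k + n) fst z \<in> rat_boundaries (k + n) Y"
               "slant k n ?\<psi> z - \<zeta> \<in> rat_boundaries k Y"
        using surj[OF \<zeta>] by blast
      then show ?thesis
        using H slant_map_snd[OF rat_cyclesD(1)[OF z(1)], of \<psi> h]
        by (intro bexI[of _ "rat_chain_map (k + n) ?h z"]) (auto simp: fst_h)
    qed
  qed
qed


section \<open>Mayer-Vietoris argument for two contractible open sets\<close>

locale open_cover =
  fixes Y :: "'y topology" and W :: "'w topology" and U V :: "'w set"
  assumes openin_U: "openin W U" and openin_V: "openin W V" and cover: "topspace W = U \<union> V"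
    and contractible_U: "contractible_space (subtopology W U)"
    and contractible_V: "contractible_space (subtopology W V)"
    and nonempty_U: "U \<noteq> {}" and nonempty_V: "V \<noteq> {}"
begin

abbreviation YU where "YU \<equiv> prod_topology Y (subtopology W U)"
abbreviation YV where "YV \<equiv> prod_topology Y (subtopology W V)"
abbreviation YW where "YW \<equiv> prod_topology Y W"
abbreviation YUV where "YUV \<equiv> prod_topology Y (subtopology W (U \<inter> V))"

lemma topspace_U: "topspace (subtopology W U) = U" and topspace_V: "topspace (subtopology W V) = V"
  using cover by auto

lemma split_cycle:
  assumes "z \<in> rat_cycles k YW"
  obtains u v where "u \<in> rat_chains k YU" "v \<in> rat_chains k YV" "u + v \<in> rat_cycles k YW"
    "z - (u + v) \<in> rat_boundaries k YW"
proof -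
  have "openin YW (topspace Y \<times> U)" "openin YW (topspace Y \<times> V)"
    using openin_U openin_V by (simp_all add: openin_prod_Times_iff)
  moreover have "topspace YW \<subseteq> topspace Y \<times> U \<union> topspace Y \<times> V"
    using cover by auto
  ultimately obtain u v where uv: "u \<in> rat_chains k YU" "v \<in> rat_chains k YV" "z - (u + v) \<in> rat_boundaries k YW"
    using assms unfolding prod_topology_subtopology(2) by (rule rat_cycle_small)
  have "z - (z - (u + v)) \<in> rat_cycles k YW"
    using assms rat_boundaries_cycles[OF uv(3)] by (rule rat_cycles_closed)
  then show thesis
    using uv that by simp
qed

text \<open>The boundary of \<open>v\<close> represents the Mayer-Vietoris connecting map. Being
  minus the boundary of \<open>u\<close>, it lies over both open sets.\<close>

lemma split_boundary:
  assumes "u \<in> rat_chains (Suc k) YU" "v \<in> rat_chains (Suc k) YV" "u + v \<in> rat_cycles (Suc k) YW"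
  shows "rat_boundary (Suc k) v \<in> rat_cycles k YUV" "rat_boundary (Suc k) u = - rat_boundary (Suc k) v"
proof -
  have "rat_boundary (Suc k) u + rat_boundary (Suc k) v = 0"
    using rat_cyclesD(2)[OF assms(3)] rat_chains_fin_supp[OF assms(1)] rat_chains_fin_supp[OF assms(2)] by simp
  then show u: "rat_boundary (Suc k) u = - rat_boundary (Suc k) v"
    by (simp add: eq_neg_iff_add_eq_0)
  have "- rat_boundary (Suc k) u \<in> rat_chains k YU"
    using assms(1) by (intro rat_chains_minus rat_boundary_Suc_in_chains)
  then have "rat_boundary (Suc k) v \<in> rat_chains k YU"
    by (simp add: u)
  moreover have "rat_boundary (Suc k) v \<in> rat_chains k YV"
    using assms(2) by blast
  ultimately have "rat_boundary (Suc k) v \<in> rat_chains k YUV"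
    by (rule rat_chains_prod_Int)
  then show "rat_boundary (Suc k) v \<in> rat_cycles k YUV"
    using rat_boundary_boundary[OF assms(2)] by (simp add: rat_cycles_def)
qed

abbreviation collapse where "collapse p k \<equiv> rat_chain_map k (\<lambda>z. (fst z, p))"

lemma collapse_fst: "collapse p k c = rat_chain_map k (\<lambda>y. (y, p)) (rat_chain_map k fst c)"
  by (simp add: rat_chain_map_compose o_def)

lemma collapse_boundaries:
  assumes "p \<in> topspace W" "rat_chain_map k fst c \<in> rat_boundaries k Y"
  shows "collapse p k c \<in> rat_boundaries k YW"
  unfolding collapse_fst
  by (rule rat_chain_map_boundaries[OF assms(2) continuous_map_section[OF assms(1)]])

lemma collapse_U: "p \<in> U \<Longrightarrow> c \<in> rat_cycles k YU \<Longrightarrow> c - collapse p k c \<in> rat_boundaries k YU"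
  using rat_cycles_prod_contractible[OF contractible_U, of p c k Y] unfolding topspace_U by blast

lemma collapse_V: "p \<in> V \<Longrightarrow> c \<in> rat_cycles k YV \<Longrightarrow> c - collapse p k c \<in> rat_boundaries k YV"
  using rat_cycles_prod_contractible[OF contractible_V, of p c k Y] unfolding topspace_V by blast

text \<open>Correcting by \<open>e\<close> turns \<open>v\<close> and \<open>u\<close> into cycles
  \<open>v - e\<close> and \<open>u + e\<close> over contractible sets. Each is homologous to its
  collapse to the common point \<open>p\<close>; the collapses add up to that of
  \<open>u + v\<close>, which bounds because it factors through \<open>Y\<close>.\<close>

lemma glue:
  assumes u: "u \<in> rat_chains k YU" and v: "v \<in> rat_chains k YV" and e: "e \<in> rat_chains k YUV"
    and bd: "rat_boundary k e = rat_boundary k v" "rat_boundary k u = - rat_boundary k v"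
    and fst: "rat_chain_map k fst (u + v) \<in> rat_boundaries k Y" and p: "p \<in> U \<inter> V"
  shows "u + v \<in> rat_boundaries k YW"
proof -
  have eU: "e \<in> rat_chains k YU" and eV: "e \<in> rat_chains k YV"
    using e by (auto intro: rat_chains_prod_mono)
  note fs = rat_chains_fin_supp[OF u] rat_chains_fin_supp[OF v] rat_chains_fin_supp[OF e]
  have "v - e \<in> rat_cycles k YV" "u + e \<in> rat_cycles k YU"
    using u v eU eV fs by (auto simp: rat_cycles_def bd)
  then have "(v - e) - collapse p k (v - e) \<in> rat_boundaries k YW"
    "(u + e) - collapse p k (u + e) \<in> rat_boundaries k YW"
    using p by (auto intro!: collapse_U collapse_V intro: rat_chains_prod_subtopology)
  then have "((v - e) - collapse p k (v - e)) + ((u + e) - collapse p k (u + e)) \<in> rat_boundaries k YW"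
    by (rule rat_boundaries_closed)
  moreover have "((v - e) - collapse p k (v - e)) + ((u + e) - collapse p k (u + e)) = (u + v) - collapse p k (u + v)"
    using fs by (simp add: algebra_simps)
  moreover have "collapse p k (u + v) \<in> rat_boundaries k YW"
    using fst p cover by (intro collapse_boundaries) auto
  ultimately show ?thesis
    by (metis rat_boundaries_diff_cancel)
qed

text \<open>On each of the two pieces a 0-cocycle is constant, with values \<open>?a\<close> and
  \<open>?b\<close>. So projection and slant product act on the pair of projected cycles by the
  matrix with rows (1, 1) and (\<open>?a\<close>, \<open>?b\<close>), which is invertible when
  \<open>?a\<close> and \<open>?b\<close> differ.\<close>

lemma kunneth_sphere_0:
  assumes disj: "U \<inter> V = {}"
  shows "kunneth_sphere Y 0 W"
proof -
  obtain p p' where p: "p \<in> U" "p' \<in> V"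
    using nonempty_U nonempty_V by blast
  define P where "P a = restrict (\<lambda>_. a) (standard_simplex 0)" for a :: 'w
  have P: "simplex_map 0 (\<lambda>_. a) \<sigma> = P a" for a and \<sigma> :: "'w simplex"
    by (auto simp: P_def simplex_map_def fun_eq_iff)
  \<comment> \<open>A 0-simplex of a contractible piece is homologous to the one at
    \<open>a\<close>, and a cocycle does not distinguish them.\<close>
  have const: "\<psi> \<sigma> = \<psi> (P a)"
    if \<psi>: "cocycle 0 W \<psi>" and \<sigma>: "singular_simplex 0 (subtopology W S) \<sigma>"
      and a: "a \<in> topspace (subtopology W S)" and S: "contractible_space (subtopology W S)" for S \<sigma> a \<psi>
  proof -
    have c: "simplex_chain \<sigma> \<in> rat_cycles 0 (subtopology W S)"
      using \<sigma> by (auto simp: rat_cycles_def)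
    have "homotopic_with (\<lambda>_. True) (subtopology W S) (subtopology W S) id (\<lambda>_. a)"
      using S a by (simp add: contractible_space_alt)
    from rat_boundaries_homotopic[OF this c]
    have "simplex_chain \<sigma> - simplex_chain (P a) \<in> rat_boundaries 0 (subtopology W S)"
      using rat_chain_map_id[OF rat_cyclesD(1)[OF c], of id] by (simp add: P)
    then have "pairing \<psi> (simplex_chain \<sigma> - simplex_chain (P a)) = 0"
      using cocycle_subtopology[OF \<psi>] pairing_cocycle_boundary by blast
    then show ?thesis
      by (simp add: pairing_diff fin_supp_simps(6))
  qed
  have slant_const: "slant k 0 \<psi> c = scale r (rat_chain_map k fst c)"
    if "c \<in> rat_chains k (prod_topology Y (subtopology W S))"
      "\<And>\<sigma>. singular_simplex 0 (subtopology W S) \<sigma> \<Longrightarrow> \<psi> \<sigma> = r" for k c S \<psi> r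
  proof -
    have "slant k 0 \<psi> c = lin_ext (\<lambda>\<sigma>. scale r (simplex_chain (simplex_map k fst \<sigma>))) c"
      unfolding slant_def
    proof (rule lin_ext_cong)
      fix \<sigma> assume "c \<sigma> \<noteq> 0"
      then have \<sigma>: "singular_simplex (k + 0) (prod_topology Y (subtopology W S)) \<sigma>"
        using that(1) by (auto simp: rat_chains_iff)
      then have "singular_simplex 0 (subtopology W S) (simplex_map 0 snd (back_face k 0 \<sigma>))"
        by (meson singular_simplex_simplex_map singular_simplex_back_face continuous_map_snd)
      moreover have "front_face k \<sigma> = \<sigma>"
        using \<sigma> by (simp add: front_face_def singular_simplex_def extensional_restrict)
      ultimately show "scale (\<psi> (simplex_map 0 snd (back_face k 0 \<sigma>))) (simplex_chain (simplex_map k fst (front_face k \<sigma>)))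
          = scale r (simplex_chain (simplex_map k fst \<sigma>))"
        using that(2) by simp
    qed
    also have "\<dots> = scale r (rat_chain_map k fst c)"
      by (simp add: rat_chain_map_lin_ext lin_ext_def scale_def[of r] pairing_left(3) fun_eq_iff)
    finally show ?thesis .
  qed
  show ?thesis
    unfolding kunneth_sphere_def
  proof (intro conjI allI impI ballI)
    fix \<psi> k assume \<psi>: "cocycle 0 W \<psi>" "nontrivial_on 0 W \<psi>"
    let ?a = "\<psi> (P p)" and ?b = "\<psi> (P p')"
    have \<psi>U: "\<psi> \<sigma> = ?a" if "singular_simplex 0 (subtopology W U) \<sigma>" for \<sigma>
      using const[OF \<psi>(1) that _ contractible_U] p unfolding topspace_U by blast
    have \<psi>V: "\<psi> \<sigma> = ?b" if "singular_simplex 0 (subtopology W V) \<sigma>" for \<sigma>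
      using const[OF \<psi>(1) that _ contractible_V] p unfolding topspace_V by blast
    have slU: "slant k 0 \<psi> c = scale ?a (rat_chain_map k fst c)" if "c \<in> rat_chains k YU" for k c
      using that \<psi>U by (rule slant_const)
    have slV: "slant k 0 \<psi> c = scale ?b (rat_chain_map k fst c)" if "c \<in> rat_chains k YV" for k c
      using that \<psi>V by (rule slant_const)
    \<comment> \<open>With equal values \<open>\<psi>\<close> would be a multiple of the
      augmentation, hence 0 on the cycles that \<open>nontrivial_on\<close> admits.\<close>
    have ab: "?a \<noteq> ?b"
    proof
      assume eq: "?a = ?b"
      obtain s where s: "s \<in> rat_cycles 0 W" "pairing (\<lambda>_. 1) s = 0" "pairing \<psi> s \<noteq> 0"
        using \<psi>(2) by (auto simp: nontrivial_on_def)
      \<comment> \<open>The factor 1 gives the cochain the shape of a multiple of the augmentation,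
        as \<open>pairing_left\<close> expects.\<close>
      have "\<psi> \<sigma> = ?a * 1" if "s \<sigma> \<noteq> 0" for \<sigma>
      proof -
        have \<sigma>: "singular_simplex 0 W \<sigma>"
          using s(1) that by (auto simp: rat_cycles_def rat_chains_iff)
        let ?x = "\<sigma> (\<lambda>j. if j = 0 then 1 else 0)"
        have "?x \<in> topspace W"
          using \<sigma> unfolding singular_simplex_def continuous_map_def by (auto simp: standard_simplex_0)
        then have "singular_simplex 0 (subtopology W U) \<sigma> \<or> singular_simplex 0 (subtopology W V) \<sigma>"
          using \<sigma> cover by (auto simp: singular_simplex_subtopology standard_simplex_0)
        then show ?thesis
          using \<psi>U \<psi>V eq by auto
      qed
      then have "pairing \<psi> s = pairing (\<lambda>_. ?a * 1) s"
        by (rule pairing_cong)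
      then show False
        using s by (simp only: pairing_left)
    qed
    show "z \<in> rat_boundaries (k + 0) YW"
      if z: "z \<in> rat_cycles (k + 0) YW" "rat_chain_map (k + 0) fst z \<in> rat_boundaries (k + 0) Y"
        "slant k 0 \<psi> z \<in> rat_boundaries k Y" for z
    proof -
      obtain u v where uv: "u \<in> rat_chains k YU" "v \<in> rat_chains k YV" "u + v \<in> rat_cycles k YW"
        "z - (u + v) \<in> rat_boundaries k YW"
        using split_cycle z(1) by (metis add_0_right)
      note fs = rat_chains_fin_supp[OF uv(1)] rat_chains_fin_supp[OF uv(2)] rat_cyclesD(3)[OF z(1)]
      have bd: "rat_boundary k u = 0" "rat_boundary k v = 0"
      proof -
        have "rat_boundary k u = 0 \<and> rat_boundary k v = 0"
        proof (cases k)
          case (Suc j)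
          \<comment> \<open>The common boundary lives over the empty intersection, so the two pieces
            are cycles separately.\<close>
          have "topspace YUV = {}"
            using disj by auto
          then have "rat_chains j YUV = {0}"
            by (rule rat_chains_empty)
          then show ?thesis
            using split_boundary[of u j v] uv by (auto simp: Suc rat_cycles_def)
        qed simp
        then show "rat_boundary k u = 0" "rat_boundary k v = 0"
          by auto
      qed
      have u: "u \<in> rat_cycles k YU" and v: "v \<in> rat_cycles k YV"
        using uv bd by (auto simp: rat_cycles_def)
      let ?fu = "rat_chain_map k fst u" and ?fv = "rat_chain_map k fst v"
      have "rat_chain_map k fst (z - (u + v)) \<in> rat_boundaries k Y"
        using uv(4) by (rule rat_chain_map_boundaries) (rule continuous_map_fst)
      then have "rat_chain_map k fst z - (?fu + ?fv) \<in> rat_boundaries k Y"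
        using fs by simp
      then have 1: "?fu + ?fv \<in> rat_boundaries k Y"
        using rat_boundaries_diff_cancel z(2) by fastforce
      have "slant k 0 \<psi> (z - (u + v)) \<in> rat_boundaries k Y"
        using \<psi>(1) uv(4) by (intro slant_rat_boundaries[where W = W]) auto
      then have "slant k 0 \<psi> z - (scale ?a ?fu + scale ?b ?fv) \<in> rat_boundaries k Y"
        using fs slU[OF uv(1)] slV[OF uv(2)] by simp
      then have 2: "scale ?a ?fu + scale ?b ?fv \<in> rat_boundaries k Y"
        using rat_boundaries_diff_cancel z(3) by fastforce
      \<comment> \<open>The two linear relations are solved for the projection of
        \<open>u\<close>.\<close>
      have "scale (?a - ?b) ?fu = (scale ?a ?fu + scale ?b ?fv) - scale ?b (?fu + ?fv)"
        by (simp add: fun_eq_iff scale_def algebra_simps)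
      also have "\<dots> \<in> rat_boundaries k Y"
        using 1 2 by blast
      finally have fu: "?fu \<in> rat_boundaries k Y"
        using ab by (simp add: rat_boundaries_scale_iff)
      have "(?fu + ?fv) - ?fu \<in> rat_boundaries k Y"
        using 1 fu by (rule rat_boundaries_closed)
      then have fv: "?fv \<in> rat_boundaries k Y"
        by simp
      have "collapse p k u \<in> rat_boundaries k YW" "collapse p' k v \<in> rat_boundaries k YW"
        using fu fv p cover by (auto intro!: collapse_boundaries)
      moreover have "u - collapse p k u \<in> rat_boundaries k YW" "v - collapse p' k v \<in> rat_boundaries k YW"
        using p u v by (auto intro: rat_chains_prod_subtopology collapse_U collapse_V)
      ultimately have "u + v \<in> rat_boundaries k YW"
        by (meson rat_boundaries_diff_cancel rat_boundaries_closed(2))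
      then show ?thesis
        using rat_boundaries_diff_cancel[OF uv(4)] by simp
    qed
    show "\<exists>z\<in>rat_cycles (k + 0) YW. rat_chain_map (k + 0) fst z \<in> rat_boundaries (k + 0) Y \<and>
               slant k 0 \<psi> z - \<zeta> \<in> rat_boundaries k Y" if \<zeta>: "\<zeta> \<in> rat_cycles k Y" for \<zeta>
    proof -
      \<comment> \<open>The copies of \<open>\<zeta>\<close> over \<open>p\<close> and
        \<open>p'\<close> cancel under the projection, while the slant product weights them by
        \<open>?a\<close> and \<open>?b\<close>.\<close>
      let ?u = "rat_chain_map k (\<lambda>y. (y, p)) \<zeta>" and ?v = "rat_chain_map k (\<lambda>y. (y, p')) \<zeta>"
      have u: "?u \<in> rat_cycles k YU" and v: "?v \<in> rat_cycles k YV"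
        using \<zeta> p topspace_U topspace_V by (auto intro!: rat_chain_map_cycles continuous_map_section)
      have f: "rat_chain_map k fst ?u = \<zeta>" "rat_chain_map k fst ?v = \<zeta>"
        using rat_chain_map_id[OF rat_cyclesD(1)[OF \<zeta>], of "\<lambda>y. y"] by (simp_all add: rat_chain_map_compose o_def)
      have "?u - ?v \<in> rat_cycles k YW"
        using u v by (blast intro: rat_chains_prod_subtopology)
      moreover have "rat_chain_map k fst (?u - ?v) = 0"
        by (simp add: f)
      moreover have "slant k 0 \<psi> (?u - ?v) = scale (?a - ?b) \<zeta>"
        using slU[OF rat_cyclesD(1)[OF u]] slV[OF rat_cyclesD(1)[OF v]] by (simp add: f scale_add)
      ultimately show ?thesis
        using ab by (intro bexI[of _ "scale (1 / (?a - ?b)) (?u - ?v)"]) auto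
    qed
  qed auto
qed

text \<open>The connecting map takes the cycle \<open>u + v\<close> to the boundary of
  \<open>v\<close> over the intersection. Up to sign it turns the slant product by
  \<open>\<psi>\<close> into that by a cocycle \<open>\<omega>\<close> on the intersection, to which
  the hypothesis on \<open>n\<close> applies.\<close>

lemma kunneth_sphere_Suc:
  assumes kun: "kunneth_sphere Y n (subtopology W (U \<inter> V))" and p: "p \<in> U \<inter> V"
  shows "kunneth_sphere Y (Suc n) W"
proof -
  have low: "z \<in> rat_boundaries k YUV"
    if "k < n" "z \<in> rat_cycles k YUV" "rat_chain_map k fst z \<in> rat_boundaries k Y" for k z
    using kun that unfolding kunneth_sphere_def by blast
  have fst_bd: "rat_chain_map k fst (rat_boundary (Suc k) v) \<in> rat_boundaries k Y"
    if v: "v \<in> rat_chains (Suc k) YV" for k v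
  proof -
    have "rat_chain_map k fst (rat_boundary (Suc k) v) = rat_boundary (Suc k) (rat_chain_map (Suc k) fst v)"
      using rat_boundary_chain_map[OF v, of fst] by simp
    moreover have "rat_chain_map (Suc k) fst v \<in> rat_chains (Suc k) Y"
      using v by (rule rat_chain_map_in_chains) (rule continuous_map_fst)
    ultimately show ?thesis
      by (simp add: rat_boundariesI)
  qed
  have fst_split: "rat_chain_map k fst (u + v) \<in> rat_boundaries k Y"
    if "u \<in> rat_chains k YU" "v \<in> rat_chains k YV" "z - (u + v) \<in> rat_boundaries k YW" "fin_supp z"
      "rat_chain_map k fst z \<in> rat_boundaries k Y" for k u v z
  proof -
    have "rat_chain_map k fst (z - (u + v)) \<in> rat_boundaries k Y"
      using that(3) by (rule rat_chain_map_boundaries) (rule continuous_map_fst)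
    then have "rat_chain_map k fst z - rat_chain_map k fst (u + v) \<in> rat_boundaries k Y"
      using that rat_chains_fin_supp[OF that(1)] rat_chains_fin_supp[OF that(2)] by simp
    then show ?thesis
      using rat_boundaries_diff_cancel that(5) by fastforce
  qed
  show ?thesis
    unfolding kunneth_sphere_def
  proof (intro conjI allI impI ballI)
    fix k z
    assume k: "k < Suc n" and z: "z \<in> rat_cycles k YW" "rat_chain_map k fst z \<in> rat_boundaries k Y"
    obtain u v where uv: "u \<in> rat_chains k YU" "v \<in> rat_chains k YV" "u + v \<in> rat_cycles k YW"
      "z - (u + v) \<in> rat_boundaries k YW"
      using split_cycle z(1) by blast
    \<comment> \<open>In degree 0 both boundaries are 0; otherwise the common boundary has degree
      below \<open>n\<close> and a bounding projection.\<close>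
    have "\<exists>e\<in>rat_chains k YUV. rat_boundary k e = rat_boundary k v \<and> rat_boundary k u = - rat_boundary k v"
    proof (cases k)
      case 0
      then show ?thesis
        by (intro bexI[of _ 0]) auto
    next
      case (Suc j)
      have "rat_boundary (Suc j) v \<in> rat_boundaries j YUV"
        using split_boundary(1)[of u j v] uv k by (intro low fst_bd) (auto simp: Suc)
      then show ?thesis
        using split_boundary(2)[of u j v] uv unfolding Suc rat_boundaries_def by fastforce
    qed
    then have "u + v \<in> rat_boundaries k YW"
      using glue[OF uv(1,2) _ _ _ fst_split[OF uv(1,2,4) rat_cyclesD(3)[OF z(1)] z(2)] p] by blast
    then show "z \<in> rat_boundaries k YW"
      using rat_boundaries_diff_cancel[OF uv(4)] by simp
  next
    fix \<psi> k assume \<psi>: "cocycle (Suc n) W \<psi>" "nontrivial_on (Suc n) W \<psi>"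
    have "pairing \<psi> c = 0" if "c \<in> rat_cycles (Suc n) (subtopology W U)" for c
      using rat_cycles_contractible[OF _ contractible_U that] cocycle_subtopology[OF \<psi>(1)]
      by (auto intro: pairing_cocycle_boundary)
    from exists_primitive[OF this] obtain \<eta>
      where \<eta>: "\<And>\<sigma>. singular_simplex (Suc n) (subtopology W U) \<sigma> \<Longrightarrow> cobd n \<eta> \<sigma> = \<psi> \<sigma>"
      by blast
    \<comment> \<open>\<open>\<phi>\<close> is cohomologous to \<open>\<psi>\<close> but vanishes on
      the simplices of \<open>U\<close>.\<close>
    define \<phi> where "\<phi> = (\<lambda>\<sigma>. \<psi> \<sigma> - cobd n \<eta> \<sigma>)"
    have \<phi>: "cocycle (Suc n) W \<phi>"
      unfolding \<phi>_def using \<psi>(1) by (rule cocycle_diff_cobd)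
    have \<phi>U: "\<phi> \<sigma> = 0" if "singular_simplex (Suc n) (subtopology W U) \<sigma>" for \<sigma>
      by (simp add: \<phi>_def \<eta> that)
    have "pairing \<phi> c = 0" if "c \<in> rat_cycles (Suc n) (subtopology W V)" for c
      using rat_cycles_contractible[OF _ contractible_V that] cocycle_subtopology[OF \<phi>]
      by (auto intro: pairing_cocycle_boundary)
    from exists_primitive[OF this] obtain \<omega>
      where \<omega>: "\<And>\<sigma>. singular_simplex (Suc n) (subtopology W V) \<sigma> \<Longrightarrow> cobd n \<omega> \<sigma> = \<phi> \<sigma>"
      by blast
    \<comment> \<open>On the intersection the coboundary of \<open>\<omega>\<close> equals
      \<open>\<phi>\<close>, which is 0 there.\<close>
    have cocycle_\<omega>: "cocycle n (subtopology W (U \<inter> V)) \<omega>"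
      using \<phi>U \<omega> by (auto simp: cocycle_def singular_simplex_subtopology)
    have "nontrivial_on n (subtopology W (U \<inter> V)) \<omega>"
    proof -
      obtain s where s: "s \<in> rat_cycles (Suc n) W" "pairing \<psi> s \<noteq> 0"
        using \<psi>(2) by (auto simp: nontrivial_on_def)
      obtain u v where uv: "u \<in> rat_chains (Suc n) (subtopology W U)" "v \<in> rat_chains (Suc n) (subtopology W V)"
        "s - (u + v) \<in> rat_boundaries (Suc n) W"
        using rat_cycle_small[OF openin_U openin_V _ s(1)] cover by blast
      note fs = rat_chains_fin_supp[OF uv(1)] rat_chains_fin_supp[OF uv(2)] rat_cyclesD(3)[OF s(1)]
      \<comment> \<open>The value of \<open>\<psi>\<close> on \<open>s\<close> is that of
        \<open>\<omega>\<close> on the boundary of \<open>v\<close>: \<open>\<phi>\<close> does not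
        see \<open>u\<close>, and over \<open>V\<close> it is the coboundary of
        \<open>\<omega>\<close>.\<close>
      have "pairing \<psi> s = pairing \<phi> s"
        using rat_cyclesD[OF s(1)] by (simp add: \<phi>_def pairing_left pairing_cobd)
      also have "\<dots> = pairing \<phi> (u + v)"
        using \<phi> uv(3) fs by (intro cocycle_homologous) auto
      also have "\<dots> = pairing \<phi> v"
        using fs pairing_vanish[OF uv(1) \<phi>U] by (simp add: pairing_add)
      also have "\<dots> = pairing (cobd n \<omega>) v"
        using uv(2) \<omega> by (intro pairing_cong) (auto simp: rat_chains_iff)
      also have "\<dots> = pairing \<omega> (rat_boundary (Suc n) v)"
        using fs by (simp add: pairing_cobd)
      finally have nz: "pairing \<omega> (rat_boundary (Suc n) v) \<noteq> 0"
        using s(2) by simp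
      have "s - (s - (u + v)) \<in> rat_cycles (Suc n) W"
        using s(1) rat_boundaries_cycles[OF uv(3)] by (rule rat_cycles_closed)
      then have "rat_boundary (Suc n) (u + v) = 0"
        using rat_cyclesD(2) by fastforce
      then have "rat_boundary (Suc n) u + rat_boundary (Suc n) v = 0"
        using fs by simp
      then have eq: "- rat_boundary (Suc n) u = rat_boundary (Suc n) v"
        by (simp add: add_eq_0_iff)
      have "- rat_boundary (Suc n) u \<in> rat_chains n (subtopology W U)" "rat_boundary (Suc n) v \<in> rat_chains n (subtopology W V)"
        using uv by auto
      then have "rat_boundary (Suc n) v \<in> rat_chains n (subtopology W (U \<inter> V))"
        unfolding eq by (rule rat_chains_Int)
      then have "rat_boundary (Suc n) v \<in> rat_cycles n (subtopology W (U \<inter> V))"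
        using rat_boundary_boundary[OF uv(2)] by (simp add: rat_cycles_def)
      \<comment> \<open>For \<open>n = 0\<close> the cycle is the boundary of a 1-chain, so its
        augmentation is 0.\<close>
      moreover have "n = 0 \<longrightarrow> pairing (\<lambda>_. 1) (rat_boundary (Suc n) v) = 0"
        using pairing_augmentation[OF rat_boundariesI, of v] uv(2) by auto
      ultimately show ?thesis
        using nz by (auto simp: nontrivial_on_def)
    qed
    then have inj: "z \<in> rat_cycles (k + n) YUV \<Longrightarrow> rat_chain_map (k + n) fst z \<in> rat_boundaries (k + n) Y \<Longrightarrow>
               slant k n \<omega> z \<in> rat_boundaries k Y \<Longrightarrow> z \<in> rat_boundaries (k + n) YUV"
      and surj: "\<zeta> \<in> rat_cycles k Y \<Longrightarrow> \<exists>z\<in>rat_cycles (k + n) YUV.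
               rat_chain_map (k + n) fst z \<in> rat_boundaries (k + n) Y \<and>
               slant k n \<omega> z - \<zeta> \<in> rat_boundaries k Y" for z \<zeta>
      using kun cocycle_\<omega> unfolding kunneth_sphere_def by blast+
    have slU: "slant k (Suc n) \<phi> c = 0" if "c \<in> rat_chains (Suc (k + n)) YU" for c
      using slant_cong[of c k "Suc n" Y "subtopology W U" \<phi> "\<lambda>_. 0"] that \<phi>U by (simp add: slant_zero)
    \<comment> \<open>Over \<open>V\<close> the Leibniz rule trades the slant by
      \<open>\<phi>\<close> for the slant of the boundary by \<open>\<omega>\<close>, modulo a
      boundary and with sign \<open>(-1) ^ k\<close>.\<close>
    have slV: "slant k (Suc n) \<phi> c - scale ((-1) ^ k) (slant k n \<omega> (rat_boundary (Suc (k + n)) c)) \<in> rat_boundaries k Y"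
      if c: "c \<in> rat_chains (Suc (k + n)) YV" for c
    proof -
      have "slant k (Suc n) (cobd n \<omega>) c = slant k (Suc n) \<phi> c"
        using slant_cong[of c k "Suc n" Y "subtopology W V" "cobd n \<omega>" \<phi>] c \<omega> by simp
      then have "scale ((-1) ^ Suc k) (rat_boundary (Suc k) (slant (Suc k) n \<omega> c))
          = slant k (Suc n) \<phi> c - scale ((-1) ^ k) (slant k n \<omega> (rat_boundary (Suc (k + n)) c))"
        using slant_boundary[OF rat_chains_fin_supp[OF c], of k n \<omega>]
        by (simp add: scale_add flip: power_mult_distrib)
      moreover have "slant (Suc k) n \<omega> c \<in> rat_chains (Suc k) Y"
        using c by (intro slant_in_chains[where W = "subtopology W V"]) simp
      ultimately show ?thesis
        by (metis rat_boundariesI rat_boundaries_closed(5))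
    qed
    have sl\<psi>: "slant k (Suc n) \<psi> c - slant k (Suc n) \<phi> c \<in> rat_boundaries k Y" if "c \<in> rat_cycles (k + Suc n) YW" for c
      using slant_cobd[of c k n Y W \<eta>] that by (simp add: \<phi>_def slant_diff_left)
    show "z \<in> rat_boundaries (k + Suc n) YW"
      if z: "z \<in> rat_cycles (k + Suc n) YW" "rat_chain_map (k + Suc n) fst z \<in> rat_boundaries (k + Suc n) Y"
        "slant k (Suc n) \<psi> z \<in> rat_boundaries k Y" for z
    proof -
      note z = z[unfolded add_Suc_right]
      obtain u v where uv: "u \<in> rat_chains (Suc (k + n)) YU" "v \<in> rat_chains (Suc (k + n)) YV"
        "u + v \<in> rat_cycles (Suc (k + n)) YW" "z - (u + v) \<in> rat_boundaries (Suc (k + n)) YW"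
        using split_cycle z(1) by blast
      note fs = rat_chains_fin_supp[OF uv(1)] rat_chains_fin_supp[OF uv(2)] rat_cyclesD(3)[OF z(1)]
      let ?b = "rat_boundary (Suc (k + n)) v"
      have "slant k (Suc n) \<phi> (z - (u + v)) \<in> rat_boundaries k Y"
        using \<phi> uv(4) by (intro slant_rat_boundaries[where W = W]) auto
      then have 1: "slant k (Suc n) \<phi> z - slant k (Suc n) \<phi> v \<in> rat_boundaries k Y"
        using fs slU[OF uv(1)] by simp
      have "slant k (Suc n) \<phi> z \<in> rat_boundaries k Y"
        using rat_boundaries_diff_cancel[OF sl\<psi>[of z]] z by simp
      then have "slant k (Suc n) \<phi> v \<in> rat_boundaries k Y"
        using rat_boundaries_diff_cancel[OF 1] by blast
      then have "scale ((-1) ^ k) (slant k n \<omega> ?b) \<in> rat_boundaries k Y"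
        using rat_boundaries_diff_cancel[OF slV[OF uv(2)]] by blast
      then have "slant k n \<omega> ?b \<in> rat_boundaries k Y"
        by (subst (asm) rat_boundaries_scale_iff) auto
      then have "?b \<in> rat_boundaries (k + n) YUV"
        using split_boundary(1)[OF uv(1-3)] fst_bd[OF uv(2)] by (intro inj)
      then obtain e where e: "e \<in> rat_chains (Suc (k + n)) YUV" "rat_boundary (Suc (k + n)) e = ?b"
        unfolding rat_boundaries_def by (metis imageE)
      have "u + v \<in> rat_boundaries (Suc (k + n)) YW"
        using uv(1,2) e split_boundary(2)[OF uv(1-3)] fst_split[OF uv(1,2,4) fs(3) z(2)] p by (rule glue)
      then show ?thesis
        using rat_boundaries_diff_cancel[OF uv(4)] by simp
    qed
    show "\<exists>z\<in>rat_cycles (k + Suc n) YW.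
               rat_chain_map (k + Suc n) fst z \<in> rat_boundaries (k + Suc n) Y \<and>
               slant k (Suc n) \<psi> z - \<zeta> \<in> rat_boundaries k Y" if \<zeta>: "\<zeta> \<in> rat_cycles k Y" for \<zeta>
    proof -
      obtain c where c: "c \<in> rat_cycles (k + n) YUV" "rat_chain_map (k + n) fst c \<in> rat_boundaries (k + n) Y"
               "slant k n \<omega> c - \<zeta> \<in> rat_boundaries k Y"
        using surj[OF \<zeta>] by blast
      \<comment> \<open>Over a contractible set \<open>c\<close> is homologous to its collapse,
        which bounds because its projection to \<open>Y\<close> does.\<close>
      have bounds: "c \<in> rat_boundaries (k + n) (prod_topology Y (subtopology W S))"
        if S: "S = U \<or> S = V" for S
      proof -
        have sub: "U \<inter> V \<subseteq> S" "contractible_space (subtopology W S)" "p \<in> topspace (subtopology W S)"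
          using S p contractible_U contractible_V topspace_U topspace_V by auto
        have "c \<in> rat_cycles (k + n) (prod_topology Y (subtopology W S))"
          using c(1) rat_chains_prod_mono[OF _ sub(1)] by (auto simp: rat_cycles_def)
        then have 1: "c - collapse p (k + n) c \<in> rat_boundaries (k + n) (prod_topology Y (subtopology W S))"
          using sub by (intro rat_cycles_prod_contractible)
        have "collapse p (k + n) c \<in> rat_boundaries (k + n) (prod_topology Y (subtopology W S))"
          unfolding collapse_fst by (rule rat_chain_map_boundaries[OF c(2) continuous_map_section[OF sub(3)]])
        then show ?thesis
          using rat_boundaries_diff_cancel[OF 1] by blast
      qed
      obtain u v where uv: "u \<in> rat_chains (Suc (k + n)) YU" "v \<in> rat_chains (Suc (k + n)) YV"
        "rat_boundary (Suc (k + n)) u = c" "rat_boundary (Suc (k + n)) v = c"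
        using bounds[of U] bounds[of V] unfolding rat_boundaries_def by auto
      note fs = rat_chains_fin_supp[OF uv(1)] rat_chains_fin_supp[OF uv(2)]
      \<comment> \<open>Inverse of the connecting map: two chains with the same boundary
        \<open>c\<close> are glued along it.\<close>
      define z where "z = v - u"
      have z: "z \<in> rat_cycles (Suc (k + n)) YW"
        using rat_chains_prod_subtopology(1)[OF uv(1)] rat_chains_prod_subtopology(1)[OF uv(2)] fs uv
        by (auto simp: rat_cycles_def z_def)
      have slz: "slant k (Suc n) \<phi> z = slant k (Suc n) \<phi> v"
        using fs slU[OF uv(1)] by (simp add: z_def)
      \<comment> \<open>Subtracting the collapse of \<open>z\<close> kills the projection to
        \<open>Y\<close>. It lies over a point of \<open>U\<close>, where \<open>\<phi>\<close>
        vanishes, so the slant product is unaffected.\<close>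
      define f where "f = collapse p (Suc (k + n)) z"
      have pU: "p \<in> topspace (subtopology W U)" and pW: "p \<in> topspace W"
        using p cover topspace_U by auto
      have fst_z: "rat_chain_map (Suc (k + n)) fst z \<in> rat_cycles (Suc (k + n)) Y"
        using z by (rule rat_chain_map_cycles) (rule continuous_map_fst)
      have fU: "f \<in> rat_cycles (Suc (k + n)) YU"
        unfolding f_def collapse_fst by (rule rat_chain_map_cycles[OF fst_z continuous_map_section[OF pU]])
      have f: "f \<in> rat_cycles (Suc (k + n)) YW" "slant k (Suc n) \<phi> f = 0"
        by (fact rat_chains_prod_subtopology(2)[OF fU], fact slU[OF rat_cyclesD(1)[OF fU]])
      \<comment> \<open>The sign compensates the one in \<open>slV\<close>.\<close>
      let ?z = "scale ((-1) ^ k) (z - f)"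
      have zc: "?z \<in> rat_cycles (k + Suc n) YW"
        using z f(1) by auto
      have "rat_chain_map (Suc (k + n)) fst f = rat_chain_map (Suc (k + n)) fst z"
        by (simp add: f_def rat_chain_map_compose o_def)
      then have "rat_chain_map (k + Suc n) fst ?z = 0"
        using rat_cyclesD(3)[OF z] rat_cyclesD(3)[OF f(1)] by simp
      moreover have "slant k (Suc n) \<psi> ?z - \<zeta> \<in> rat_boundaries k Y"
      proof (rule rat_boundaries_trans[OF rat_boundaries_trans])
        show "slant k (Suc n) \<psi> ?z - slant k (Suc n) \<phi> ?z \<in> rat_boundaries k Y"
          using zc by (rule sl\<psi>)
        have "scale ((-1) ^ k) (slant k (Suc n) \<phi> v - scale ((-1) ^ k) (slant k n \<omega> c)) \<in> rat_boundaries k Y"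
          using slV[OF uv(2)] unfolding uv(4) by (rule rat_boundaries_closed)
        moreover have "slant k (Suc n) \<phi> ?z = scale ((-1) ^ k) (slant k (Suc n) \<phi> v)"
          using rat_cyclesD(3)[OF z] rat_cyclesD(3)[OF f(1)] by (simp add: f(2) slz)
        ultimately show "slant k (Suc n) \<phi> ?z - slant k n \<omega> c \<in> rat_boundaries k Y"
          by (simp add: scale_add flip: power_mult_distrib)
        show "slant k n \<omega> c - \<zeta> \<in> rat_boundaries k Y"
          by (rule c(3))
      qed
      ultimately show ?thesis
        using zc by (intro bexI[of _ ?z]) auto
    qed
  qed
qed

end

text \<open>A model of the n-sphere up to homotopy. Coordinates beyond \<open>n\<close> are left
  free, so that removing the conditions on coordinate \<open>n\<close> produces the space for
  \<open>n - 1\<close> itself.\<close>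

definition punctured_space :: "nat \<Rightarrow> (nat \<Rightarrow> real) topology"
  where "punctured_space n = subtopology (powertop_real UNIV) {x. \<exists>i\<le>n. x i \<noteq> 0}"

definition axis :: "nat \<Rightarrow> nat \<Rightarrow> real"
  where "axis n = (\<lambda>i. if i = n then 1 else 0)"

text \<open>\<open>S\<close> is star-shaped about \<open>a\<close>; the straight-line homotopy
  contracts it.\<close>

lemma contractible_space_line:
  fixes a :: "nat \<Rightarrow> real"
  assumes a: "a \<in> S" and star: "\<And>x t. x \<in> S \<Longrightarrow> 0 \<le> t \<Longrightarrow> t \<le> 1 \<Longrightarrow> (\<lambda>i. (1 - t) * x i + t * a i) \<in> S"
  shows "contractible_space (subtopology (powertop_real UNIV) S)"
proof -
  let ?X = "subtopology (powertop_real UNIV) S" and ?h = "\<lambda>(t, x) i. (1 - t) * x i + t * a (i::nat)"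
  have "continuous_map (prod_topology (top_of_set {0..1}) ?X) euclideanreal (\<lambda>z. snd z i)" for i
    using continuous_map_compose[OF continuous_map_snd, of ?X euclideanreal "\<lambda>x. x i"]
      continuous_map_from_subtopology[OF continuous_map_product_projection[of i UNIV "\<lambda>_. euclideanreal"]]
    by (simp add: o_def)
  moreover have "continuous_map (prod_topology (top_of_set {0..1}) ?X) euclideanreal (\<lambda>z. fst z)"
    using continuous_map_fst[of "top_of_set {0..1::real}" ?X] continuous_map_into_fulltopology by blast
  ultimately have "continuous_map (prod_topology (top_of_set {0..1}) ?X) euclideanreal (\<lambda>z. (1 - fst z) * snd z i + fst z * a i)" for i
    by (intro continuous_intros) auto
  then have "continuous_map (prod_topology (top_of_set {0..1}) ?X) (powertop_real UNIV) ?h"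
    by (simp add: continuous_map_componentwise_UNIV case_prod_beta')
  then have "continuous_map (prod_topology (top_of_set {0..1}) ?X) ?X ?h"
    using star by (auto simp: continuous_map_in_subtopology)
  then have "homotopic_with (\<lambda>_. True) ?X ?X id (\<lambda>_. a)"
    unfolding homotopic_with_def by (intro exI[of _ ?h]) auto
  then show ?thesis
    unfolding contractible_space_def by blast
qed

text \<open>Not a half-space: in the coordinates up to \<open>n\<close> it is the complement of the
  closed half-line from the origin in the direction of \<open>- s\<close> times the last axis. It is
  star-shaped about the opposite unit vector.\<close>

definition half_space :: "nat \<Rightarrow> real \<Rightarrow> (nat \<Rightarrow> real) set"
  where "half_space n s = {x. (\<exists>i<n. x i \<noteq> 0) \<or> s * x n > 0}"

lemma half_space_Un: "half_space n 1 \<union> half_space n (-1) = {x. \<exists>i\<le>n. x i \<noteq> 0}"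
  unfolding half_space_def by (auto simp: le_less)

lemma half_space_Int: "half_space n 1 \<inter> half_space n (-1) = {x. \<exists>i<n. x i \<noteq> 0}"
  unfolding half_space_def by auto

lemma openin_half_space: "openin (powertop_real UNIV) (half_space n s)"
proof -
  have "open {x :: nat \<Rightarrow> real. x i \<noteq> 0}" for i
    by (intro open_Collect_neq continuous_intros continuous_on_product_coordinates)
  moreover have "open {x :: nat \<Rightarrow> real. s * x n > 0}"
    by (intro open_Collect_less continuous_intros continuous_on_product_coordinates)
  moreover have "half_space n s = (\<Union>i<n. {x. x i \<noteq> 0}) \<union> {x. s * x n > 0}"
    by (auto simp: half_space_def)
  ultimately have "open (half_space n s)"
    by auto
  then show ?thesis
    by (simp add: euclidean_product_topology)
qed

lemma contractible_half_space:
  assumes "s = 1 \<or> s = -1"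
  shows "contractible_space (subtopology (powertop_real UNIV) (half_space n s))"
proof (rule contractible_space_line[of "\<lambda>i. s * axis n i"])
  show "(\<lambda>i. s * axis n i) \<in> half_space n s"
    using assms by (auto simp: half_space_def axis_def)
  fix x and t :: real assume x: "x \<in> half_space n s" and t: "0 \<le> t" "t \<le> 1"
  show "(\<lambda>i. (1 - t) * x i + t * (s * axis n i)) \<in> half_space n s"
  proof (cases "t < 1 \<and> (\<exists>i<n. x i \<noteq> 0)")
    case True
    then obtain i where "i < n" "x i \<noteq> 0" "t < 1"
      by blast
    then show ?thesis
      unfolding half_space_def axis_def by (auto intro!: exI[of _ i])
  next
    case False
    \<comment> \<open>Here \<open>t = 1\<close>, or only the last coordinate of \<open>x\<close>
      counts. Then \<open>s\<close> times the new last coordinate is the convex combination of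
      \<open>s * x n\<close> and \<open>s * s = 1\<close>.\<close>
    have "s * ((1 - t) * x n + t * s) > 0"
    proof (cases "t = 1")
      case True
      then show ?thesis
        using assms by auto
    next
      case nt: False
      then have "1 - t > 0" "s * x n > 0" "s * s = 1"
        using False x t assms by (auto simp: half_space_def)
      then have "(1 - t) * (s * x n) > 0" "s * s = 1"
        by (auto intro: mult_pos_pos simp only: )
      moreover have "s * ((1 - t) * x n + t * s) = (1 - t) * (s * x n) + t * (s * s)"
        by (simp add: algebra_simps)
      ultimately show ?thesis
        using t by simp
    qed
    then show ?thesis
      by (simp add: half_space_def axis_def)
  qed
qed

lemma open_cover_punctured_space: "open_cover (punctured_space n) (half_space n 1) (half_space n (-1))"
proof
  have sub: "half_space n s \<subseteq> {x. \<exists>i\<le>n. x i \<noteq> 0}" for s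
    by (auto simp: half_space_def le_less)
  then have subtop: "subtopology (punctured_space n) (half_space n s) = subtopology (powertop_real UNIV) (half_space n s)" for s
    by (simp add: punctured_space_def subtopology_subtopology Int_absorb1)
  have "openin (punctured_space n) (half_space n s)" for s
    unfolding punctured_space_def openin_subtopology
    using openin_half_space[of n s] sub[of s] by (intro exI[of _ "half_space n s"]) blast
  then show "openin (punctured_space n) (half_space n 1)" "openin (punctured_space n) (half_space n (-1))"
    by blast+
  show "topspace (punctured_space n) = half_space n 1 \<union> half_space n (-1)"
    by (simp add: punctured_space_def half_space_Un)
  show "contractible_space (subtopology (punctured_space n) (half_space n 1))"
    "contractible_space (subtopology (punctured_space n) (half_space n (-1)))"
    unfolding subtop by (rule contractible_half_space; simp)+
  have "axis n \<in> half_space n 1" "- axis n \<in> half_space n (-1)"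
    by (auto simp: half_space_def axis_def)
  then show "half_space n 1 \<noteq> {}" "half_space n (-1) \<noteq> {}"
    by blast+
qed

lemma kunneth_punctured_space: "kunneth_sphere Y n (punctured_space n)"
proof (induction n)
  case 0
  interpret open_cover Y "punctured_space 0" "half_space 0 1" "half_space 0 (-1)"
    by (rule open_cover_punctured_space)
  show ?case
    by (rule kunneth_sphere_0) (simp add: half_space_Int)
next
  case (Suc n)
  interpret open_cover Y "punctured_space (Suc n)" "half_space (Suc n) 1" "half_space (Suc n) (-1)"
    by (rule open_cover_punctured_space)
  \<comment> \<open>The intersection constrains only the coordinates up to \<open>n\<close>, so the
    induction hypothesis applies to an equal space.\<close>
  have "subtopology (punctured_space (Suc n)) (half_space (Suc n) 1 \<inter> half_space (Suc n) (-1)) = punctured_space n"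
    unfolding punctured_space_def half_space_Int subtopology_subtopology
    by (rule arg_cong[where f = "subtopology _"]) (auto simp: less_Suc_eq_le intro: le_SucI)
  moreover have "axis 0 \<in> half_space (Suc n) 1 \<inter> half_space (Suc n) (-1)"
    unfolding half_space_Int by (auto simp: axis_def)
  ultimately show ?case
    using Suc.IH by (intro kunneth_sphere_Suc) auto
qed

text \<open>Normalization plays the part of \<open>h\<close> and the inclusion that of
  \<open>r\<close>; their composite is the identity on the sphere. The normalization also sets the
  coordinates beyond \<open>n\<close> to 0, as \<open>nsphere\<close> demands.\<close>

lemma kunneth_nsphere: "kunneth_sphere Y n (nsphere n)"
proof (rule kunneth_sphere_dominated[OF kunneth_punctured_space])
  let ?r = "\<lambda>(x::nat \<Rightarrow> real) i. if i \<le> n then x i / sqrt (\<Sum>j\<le>n. (x j)\<^sup>2) else 0"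
  have pos: "(\<Sum>j\<le>n. (x j)\<^sup>2) > 0" if "\<exists>i\<le>n. x i \<noteq> 0" for x :: "nat \<Rightarrow> real"
    using that by (auto intro!: sum_pos2)
  have cont: "continuous_map (punctured_space n) euclideanreal (\<lambda>x. x i)" for i
    unfolding punctured_space_def by (rule continuous_map_from_subtopology[OF continuous_map_product_projection]) simp
  have "continuous_map (punctured_space n) euclideanreal (\<lambda>x. x i / sqrt (\<Sum>j\<le>n. (x j)\<^sup>2))" for i
    using pos by (intro continuous_intros cont continuous_map_sqrt) (fastforce simp: punctured_space_def)+
  then have "continuous_map (punctured_space n) (powertop_real UNIV) ?r"
    by (auto simp: continuous_map_componentwise_UNIV)
  moreover have "(\<Sum>i\<le>n. (?r x i)\<^sup>2) = 1" if "\<exists>i\<le>n. x i \<noteq> 0" for x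
  proof -
    have "(\<Sum>i\<le>n. (?r x i)\<^sup>2) = (\<Sum>i\<le>n. (x i)\<^sup>2 / (\<Sum>j\<le>n. (x j)\<^sup>2))"
      using pos[OF that] by (intro sum.cong) (auto simp: power_divide)
    also have "\<dots> = 1"
      using pos[OF that] by (simp flip: sum_divide_distrib)
    finally show ?thesis .
  qed
  ultimately show r: "continuous_map (punctured_space n) (nsphere n) ?r"
    by (auto simp: nsphere continuous_map_in_subtopology punctured_space_def)
  have nz: "\<exists>i\<le>n. x i \<noteq> 0" if "(\<Sum>i\<le>n. (x i)\<^sup>2) = 1" for x :: "nat \<Rightarrow> real"
    using that by (rule contrapos_pp) simp
  then show i: "continuous_map (nsphere n) (punctured_space n) id"
    by (auto simp: nsphere punctured_space_def continuous_map_in_subtopology intro: continuous_map_from_subtopology)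
  show "homotopic_with (\<lambda>_. True) (nsphere n) (nsphere n) (?r \<circ> id) id"
  proof (rule homotopic_with_equal)
    show "continuous_map (nsphere n) (nsphere n) (?r \<circ> id)"
      using i r by (rule continuous_map_compose)
  qed (auto simp: nsphere)
qed

section \<open>The rational homology of spheres\<close>

text \<open>Clearing denominators in the bounding chain: a rational boundary is integrally a torsion
  class.\<close>

lemma singular_boundary_of_ratify:
  assumes "ratify s \<in> rat_boundaries k X"
  obtains N where "N > 0" "singular_relboundary k X {} (frag_cmul (int N) s)"
proof -
  obtain d where d: "ratify s = rat_boundary (Suc k) d" "d \<in> rat_chains (Suc k) X"
    using assms by (auto simp: rat_boundaries_def)
  obtain N z where N: "N > 0" "singular_chain (Suc k) X z" "ratify z = scale (of_int N) d"
    using clear_denominators[OF d(2)] .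
  have "ratify (frag_cmul N s) = ratify (chain_boundary (Suc k) z)"
    by (simp add: ratify_chain_boundary N d)
  then have "frag_cmul N s = chain_boundary (Suc k) z"
    by (simp only: ratify_inject)
  then have "singular_relboundary k X {} (frag_cmul (int (nat N)) s)"
    using N by (auto simp: singular_boundary)
  then show thesis
    using N(1) that[of "nat N"] by simp
qed

text \<open>The integral homology group is infinite cyclic. A generator that bounds rationally would
  be torsion.\<close>

lemma exists_nonboundary_nsphere:
  assumes "n > 0"
  obtains s where "s \<in> rat_cycles n (nsphere n)" "s \<notin> rat_boundaries n (nsphere n)"
proof -
  let ?X = "nsphere n" and ?G = "homology_group (int n) (nsphere n)"
  let ?cl = "homologous_rel_set n (nsphere n) {}"
  have "?G \<cong> integer_group"
    using reduced_homology_group_nsphere(1)[of n] assms un_reduced_homology_group[of "int n" ?X] by simp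
  then obtain f where f: "f \<in> iso ?G integer_group"
    by (auto simp: is_iso_def)
  have hom: "f (x \<otimes>\<^bsub>?G\<^esub> y) = f x + f y" if "x \<in> carrier ?G" "y \<in> carrier ?G" for x y
    using f that by (auto simp: iso_def hom_def integer_group_def)
  have cl: "?cl s \<in> carrier ?G" if "singular_relcycle n ?X {} s" for s
    using that by (auto simp: carrier_relative_homology_group)
  \<comment> \<open>The group operation is a product of cosets; the resulting coset contains
    \<open>s + t\<close>, hence is its class.\<close>
  have add: "f (?cl (s + t)) = f (?cl s) + f (?cl t)"
    if s: "singular_relcycle n ?X {} s" and t: "singular_relcycle n ?X {} t" for s t
  proof -
    have "?cl s \<otimes>\<^bsub>?G\<^esub> ?cl t \<in> carrier ?G"
      using group.is_monoid[OF group_relative_homology_group] cl[OF s] cl[OF t] by (rule monoid.m_closed)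
    then obtain c where c: "?cl s \<otimes>\<^bsub>?G\<^esub> ?cl t = ?cl c"
      by (auto simp: carrier_relative_homology_group)
    have "s + t \<in> ?cl s \<otimes>\<^bsub>?G\<^esub> ?cl t"
      unfolding mult_relative_homology_group by (rule UN_I[of s], simp, rule UN_I[of t], simp_all)
    then have "?cl c = ?cl (s + t)"
      by (simp add: c homologous_rel_set_eq)
    then show ?thesis
      using hom[OF cl[OF s] cl[OF t]] c by simp
  qed
  have zero: "f (?cl 0) = 0"
    using add[of 0 0] by simp
  have mult: "f (?cl (frag_cmul (int N) s)) = int N * f (?cl s)" if s: "singular_relcycle n ?X {} s" for s N
  proof (induction N)
    case 0
    then show ?case
      using zero by simp
  next
    case (Suc N)
    have "frag_cmul (int (Suc N)) s = s + frag_cmul (int N) s"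
      using frag_cmul_distrib[of 1 "int N" s] by simp
    then show ?case
      using add[OF s singular_relcycle_cmul[OF s, of "int N"]] Suc by (simp add: algebra_simps)
  qed
  have "1 \<in> f ` carrier ?G"
    using f by (auto simp: iso_def bij_betw_def integer_group_def)
  then obtain s where s: "singular_relcycle n ?X {} s" "f (?cl s) = 1"
    by (auto simp: carrier_relative_homology_group)
  have "ratify s \<notin> rat_boundaries n ?X"
  proof
    assume "ratify s \<in> rat_boundaries n ?X"
    then obtain N where N: "N > 0" "singular_relboundary n ?X {} (frag_cmul (int N) s)"
      by (rule singular_boundary_of_ratify)
    then have "homologous_rel n ?X {} (frag_cmul (int N) s) 0"
      by (simp add: homologous_rel_def)
    then have "?cl (frag_cmul (int N) s) = ?cl 0"
      by (simp add: homologous_rel_set_eq)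
    then show False
      using mult[OF s(1), of N] zero s(2) N(1) by simp
  qed
  then show thesis
    using s(1) that by (simp add: singular_cycle_ratify)
qed

lemma singular_simplex_0_const: "simplex_map 0 (\<lambda>_. a) \<sigma> = restrict (\<lambda>_. a) (standard_simplex 0)"
  by (simp add: simplex_map_def o_def)

text \<open>A one-point space has a single 0-simplex, so the augmentation is the only
  coefficient.\<close>

lemma rat_chains_singleton_0:
  assumes "topspace X = {a}" "c \<in> rat_chains 0 X" "pairing (\<lambda>_. 1) c = 0"
  shows "c = 0"
proof -
  have "c = rat_chain_map 0 (\<lambda>_. a) c"
    using rat_chain_map_id[OF assms(2), of "\<lambda>_. a"] assms(1) by simp
  also have "\<dots> = scale (pairing (\<lambda>_. 1) c) (simplex_chain (restrict (\<lambda>_. a) (standard_simplex 0)))"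
  proof
    fix \<tau>
    show "rat_chain_map 0 (\<lambda>_. a) c \<tau>
        = scale (pairing (\<lambda>_. 1) c) (simplex_chain (restrict (\<lambda>_. a) (standard_simplex 0))) \<tau>"
      using pairing_left(3)[of "simplex_chain (restrict (\<lambda>_. a) (standard_simplex 0)) \<tau>" "\<lambda>_. 1" c]
      by (simp only: rat_chain_map_lin_ext lin_ext_def singular_simplex_0_const scale_def mult.commute mult_1_right mult_1_left)
  qed
  finally show ?thesis
    using assms(3) by simp
qed

lemma back_face_0: "singular_simplex n X \<sigma> \<Longrightarrow> back_face 0 n \<sigma> = \<sigma>"
  by (simp add: back_face_def singular_simplex_def extensional_restrict)

lemma pairing_slant:
  "pairing \<phi> (slant k n \<psi> c)
    = pairing (\<lambda>\<sigma>. \<psi> (simplex_map n snd (back_face k n \<sigma>)) * \<phi> (simplex_map k fst (front_face k \<sigma>))) c"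
  by (simp add: slant_def pairing_lin_ext)

text \<open>The back face is the whole simplex, so only the projection to \<open>W\<close> is
  evaluated.\<close>

lemma pairing_slant_0:
  assumes "c \<in> rat_chains n (prod_topology Y W)"
  shows "pairing (\<lambda>_. 1) (slant 0 n \<psi> c) = pairing \<psi> (rat_chain_map n snd c)"
  unfolding pairing_slant pairing_pullback[symmetric] pullback_def
  using assms by (intro pairing_cong) (auto simp: rat_chains_iff back_face_0)

definition sphere_class :: "nat \<Rightarrow> ((nat \<Rightarrow> real) simplex \<Rightarrow> rat) \<Rightarrow> bool"
  where "sphere_class n \<psi> \<longleftrightarrow> cocycle n (nsphere n) \<psi> \<and> nontrivial_on n (nsphere n) \<psi>"

lemma exists_sphere_class:
  assumes "n > 0"
  obtains \<psi> where "sphere_class n \<psi>"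
proof -
  obtain s where s: "s \<in> rat_cycles n (nsphere n)" "s \<notin> rat_boundaries n (nsphere n)"
    using exists_nonboundary_nsphere[OF assms] .
  obtain \<psi> where "cocycle n (nsphere n) \<psi>" "pairing \<psi> s = 1"
    using exists_cocycle[OF s] .
  then show thesis
    using that s assms by (force simp: sphere_class_def nontrivial_on_def)
qed

lemma kunneth_nsphere_low:
  assumes "k < n" "z \<in> rat_cycles k (prod_topology Y (nsphere n))" "rat_chain_map k fst z \<in> rat_boundaries k Y"
  shows "z \<in> rat_boundaries k (prod_topology Y (nsphere n))"
  using kunneth_nsphere[of Y n] assms unfolding kunneth_sphere_def by blast

lemma kunneth_nsphere_inj:
  assumes "sphere_class n \<psi>" "z \<in> rat_cycles (k + n) (prod_topology Y (nsphere n))"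
    "rat_chain_map (k + n) fst z \<in> rat_boundaries (k + n) Y" "slant k n \<psi> z \<in> rat_boundaries k Y"
  shows "z \<in> rat_boundaries (k + n) (prod_topology Y (nsphere n))"
  using kunneth_nsphere[of Y n] assms unfolding kunneth_sphere_def sphere_class_def by blast

lemma kunneth_nsphere_surj:
  assumes "sphere_class n \<psi>" "\<zeta> \<in> rat_cycles k Y"
  obtains z where "z \<in> rat_cycles (k + n) (prod_topology Y (nsphere n))"
    "slant k n \<psi> z - \<zeta> \<in> rat_boundaries k Y"
  using kunneth_nsphere[of Y n] assms unfolding kunneth_sphere_def sphere_class_def by blast

text \<open>The sphere is the product of a point with itself; apply the Kuenneth statement with
  \<open>Y\<close> a point, where cycles bound except for the augmentation in degree 0.\<close>

lemma nsphere_homology: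
  assumes n: "n > 0" and \<psi>: "sphere_class n \<psi>" and z: "z \<in> rat_cycles k (nsphere n)"
    and 0: "k = 0 \<Longrightarrow> pairing (\<lambda>_. 1) z = 0" and top: "k = n \<Longrightarrow> pairing \<psi> z = 0"
  shows "z \<in> rat_boundaries k (nsphere n)"
proof -
  let ?P = "discrete_topology {()}" and ?j = "\<lambda>x. ((), x)"
  have P: "c \<in> rat_boundaries l ?P" if "c \<in> rat_cycles l ?P" "l = 0 \<Longrightarrow> pairing (\<lambda>_. 1) c = 0" for c l
  proof (cases "l = 0")
    case True
    then show ?thesis
      using rat_chains_singleton_0[of ?P "()" c] that rat_boundaries_closed(1) by (auto simp: rat_cycles_def)
  next
    case False
    then show ?thesis
      using rat_cycles_singleton[of l ?P "()" c] that by simp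
  qed
  have "continuous_map (nsphere n) (prod_topology ?P (nsphere n)) ?j"
    by (auto simp: continuous_map_pairwise o_def)
  then have jz: "rat_chain_map k ?j z \<in> rat_cycles k (prod_topology ?P (nsphere n))"
    using z by blast
  have "rat_chain_map k fst (rat_chain_map k ?j z) \<in> rat_cycles k ?P"
    using jz by (rule rat_chain_map_cycles) (rule continuous_map_fst)
  then have fst: "rat_chain_map k fst (rat_chain_map k ?j z) \<in> rat_boundaries k ?P"
    by (rule P) (simp add: 0)
  have snd: "rat_chain_map k snd (rat_chain_map k ?j z) = z"
    using rat_chain_map_id[OF rat_cyclesD(1)[OF z], of "\<lambda>x. x"] by (simp add: rat_chain_map_compose o_def)
  have "rat_chain_map k ?j z \<in> rat_boundaries k (prod_topology ?P (nsphere n))"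
  proof (cases "k < n")
    case True
    then show ?thesis
      using jz fst by (rule kunneth_nsphere_low)
  next
    case False
    then obtain l where l: "k = l + n"
      by (metis add.commute le_Suc_ex not_less)
    have "slant l n \<psi> (rat_chain_map k ?j z) \<in> rat_cycles l ?P"
      using \<psi> jz unfolding l sphere_class_def by (intro slant_cycles) auto
    then have "slant l n \<psi> (rat_chain_map k ?j z) \<in> rat_boundaries l ?P"
    proof (rule P)
      assume "l = 0"
      then show "pairing (\<lambda>_. 1) (slant l n \<psi> (rat_chain_map k ?j z)) = 0"
        using pairing_slant_0[of "rat_chain_map k ?j z" n ?P "nsphere n" \<psi>] rat_cyclesD(1)[OF jz] snd top l by simp
    qed
    then show ?thesis
      using \<psi> jz fst unfolding l by (intro kunneth_nsphere_inj)
  qed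
  then have "rat_chain_map k snd (rat_chain_map k ?j z) \<in> rat_boundaries k (nsphere n)"
    by (rule rat_chain_map_boundaries) (rule continuous_map_snd)
  then show ?thesis
    by (simp add: snd)
qed


section \<open>The rational homology of a product of two spheres\<close>

text \<open>The homology in degree \<open>k\<close> is one-dimensional, \<open>s\<close> generates
  it and \<open>\<phi>\<close> is the dual coordinate.\<close>

definition rank_one :: "nat \<Rightarrow> 'a topology \<Rightarrow> ('a simplex \<Rightarrow> rat) \<Rightarrow> ('a simplex \<Rightarrow> rat) \<Rightarrow> bool"
  where "rank_one k X \<phi> s \<longleftrightarrow> cocycle k X \<phi> \<and> s \<in> rat_cycles k X \<and> pairing \<phi> s = 1 \<and>
    (\<forall>z\<in>rat_cycles k X. pairing \<phi> z = 0 \<longrightarrow> z \<in> rat_boundaries k X)"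

lemma rank_oneI:
  assumes "cocycle k X \<phi>" "s \<in> rat_cycles k X" "pairing \<phi> s \<noteq> 0"
    "\<And>z. z \<in> rat_cycles k X \<Longrightarrow> pairing \<phi> z = 0 \<Longrightarrow> z \<in> rat_boundaries k X"
  shows "rank_one k X \<phi> (scale (1 / pairing \<phi> s) s)"
  using assms by (auto simp: rank_one_def)

text \<open>The external product: the cup product of \<open>\<phi>\<close> and \<open>\<psi>\<close>
  pulled back from the two factors.\<close>

definition cross :: "nat \<Rightarrow> nat \<Rightarrow> ('y simplex \<Rightarrow> rat) \<Rightarrow> ('w simplex \<Rightarrow> rat) \<Rightarrow> ('y \<times> 'w) simplex \<Rightarrow> rat"
  where "cross k n \<phi> \<psi> = (\<lambda>\<sigma>. \<psi> (simplex_map n snd (back_face k n \<sigma>)) * \<phi> (simplex_map k fst (front_face k \<sigma>)))"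

lemma pairing_cross: "pairing (cross k n \<phi> \<psi>) c = pairing \<phi> (slant k n \<psi> c)"
  by (simp add: cross_def pairing_slant)

lemma cocycle_cross:
  assumes "cocycle k Y \<phi>" "cocycle n W \<psi>"
  shows "cocycle (k + n) (prod_topology Y W) (cross k n \<phi> \<psi>)"
proof (rule cocycleI)
  fix c assume "c \<in> rat_boundaries (k + n) (prod_topology Y W)"
  with assms(2) have "slant k n \<psi> c \<in> rat_boundaries k Y"
    by (rule slant_rat_boundaries)
  then show "pairing (cross k n \<phi> \<psi>) c = 0"
    unfolding pairing_cross using assms(1) pairing_cocycle_boundary by blast
qed

text \<open>The guarded conditions treat all degrees at once. The slant product lies in degree
  \<open>k - q\<close> of the first sphere, where the obstructions in degrees 0 and \<open>p\<close>
  become those for \<open>k = q\<close> and \<open>k = p + q\<close>.\<close>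

lemma sphere_product_homology:
  assumes pq: "p > 0" "q > 0" and x: "sphere_class p x" and y: "sphere_class q y"
    and z: "z \<in> rat_cycles k (sphere_product p q)"
    and "k = 0 \<Longrightarrow> pairing (\<lambda>_. 1) z = 0"
    and P: "k = p \<Longrightarrow> pairing (pullback p fst x) z = 0"
    and Q: "k = q \<Longrightarrow> pairing (pullback q snd y) z = 0"
    and PQ: "k = p + q \<Longrightarrow> pairing (cross p q x y) z = 0"
  shows "z \<in> rat_boundaries k (sphere_product p q)"
proof -
  have "rat_chain_map k fst z \<in> rat_cycles k (nsphere p)"
    using z by (rule rat_chain_map_cycles) (rule continuous_map_fst)
  then have fst: "rat_chain_map k fst z \<in> rat_boundaries k (nsphere p)"
    using assms by (intro nsphere_homology[OF pq(1) x]) (auto simp: pairing_pullback)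
  show ?thesis
  proof (cases "k < q")
    case True
    then show ?thesis
      using z fst by (rule kunneth_nsphere_low)
  next
    case False
    then obtain l where l: "k = l + q"
      by (metis add.commute le_Suc_ex not_less)
    have "slant l q y z \<in> rat_cycles l (nsphere p)"
      using y z unfolding l sphere_class_def by (intro slant_cycles) auto
    then have "slant l q y z \<in> rat_boundaries l (nsphere p)"
    proof (rule nsphere_homology[OF pq(1) x])
      assume "l = 0"
      then show "pairing (\<lambda>_. 1) (slant l q y z) = 0"
        using pairing_slant_0[of z q "nsphere p" "nsphere q" y] rat_cyclesD(1)[OF z] l Q by (simp add: pairing_pullback)
    next
      assume "l = p"
      then show "pairing x (slant l q y z) = 0"
        using PQ l by (simp add: pairing_cross)
    qed
    then show ?thesis
      using y z fst unfolding l by (intro kunneth_nsphere_inj)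
  qed
qed

text \<open>The generators are slices of the two factors and a cycle whose slant product is the
  class of the first sphere. Since \<open>p\<close> and \<open>q\<close> differ and are positive,
  each of the three degrees meets only one obstruction.\<close>

lemma sphere_product_rank_one:
  assumes pq: "p > 0" "q > 0" "p \<noteq> q" and x: "sphere_class p x" and y: "sphere_class q y"
  obtains s t w where "rank_one p (sphere_product p q) (pullback p fst x) s"
    "rank_one q (sphere_product p q) (pullback q snd y) t"
    "rank_one (p + q) (sphere_product p q) (cross p q x y) w"
proof -
  let ?X = "sphere_product p q"
  note cls = x[unfolded sphere_class_def] y[unfolded sphere_class_def]
  obtain s0 t0 where s0: "s0 \<in> rat_cycles p (nsphere p)" "pairing x s0 \<noteq> 0"
    and t0: "t0 \<in> rat_cycles q (nsphere q)" "pairing y t0 \<noteq> 0"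
    using cls by (auto simp: nontrivial_on_def)
  \<comment> \<open>This unit vector lies in every sphere, so it is a base point for both
    factors.\<close>
  define a :: "nat \<Rightarrow> real" where "a = (\<lambda>n. if n = 0 then 1 else 0)"
  have a: "a \<in> topspace (nsphere n)" for n
    unfolding a_def by (rule in_topspace_nsphere)
  have "rank_one p ?X (pullback p fst x) (scale (1 / pairing (pullback p fst x) (rat_chain_map p (\<lambda>u. (u, a)) s0))
      (rat_chain_map p (\<lambda>u. (u, a)) s0))"
  proof (rule rank_oneI)
    show "cocycle p ?X (pullback p fst x)"
      using cls by (intro cocycle_pullback[OF _ continuous_map_fst]) auto
    show "rat_chain_map p (\<lambda>u. (u, a)) s0 \<in> rat_cycles p ?X"
      using s0(1) continuous_map_section[OF a] by blast
    show "pairing (pullback p fst x) (rat_chain_map p (\<lambda>u. (u, a)) s0) \<noteq> 0"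
      using s0 rat_chain_map_id[OF rat_cyclesD(1)[OF s0(1)], of "\<lambda>x. x"]
      by (simp add: pairing_pullback rat_chain_map_compose o_def)
    show "z \<in> rat_boundaries p ?X" if "z \<in> rat_cycles p ?X" "pairing (pullback p fst x) z = 0" for z
      using that pq by (intro sphere_product_homology[OF pq(1,2) x y]) auto
  qed
  moreover have "rank_one q ?X (pullback q snd y) (scale (1 / pairing (pullback q snd y) (rat_chain_map q (Pair a) t0))
      (rat_chain_map q (Pair a) t0))"
  proof (rule rank_oneI)
    show "cocycle q ?X (pullback q snd y)"
      using cls by (intro cocycle_pullback[OF _ continuous_map_snd]) auto
    have "continuous_map (nsphere q) ?X (Pair a)"
      using a by (auto simp: continuous_map_pairwise o_def)
    then show "rat_chain_map q (Pair a) t0 \<in> rat_cycles q ?X"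
      using t0(1) by blast
    show "pairing (pullback q snd y) (rat_chain_map q (Pair a) t0) \<noteq> 0"
      using t0 rat_chain_map_id[OF rat_cyclesD(1)[OF t0(1)], of "\<lambda>x. x"]
      by (simp add: pairing_pullback rat_chain_map_compose o_def)
    show "z \<in> rat_boundaries q ?X" if "z \<in> rat_cycles q ?X" "pairing (pullback q snd y) z = 0" for z
      using that pq by (intro sphere_product_homology[OF pq(1,2) x y]) auto
  qed
  moreover obtain w where w: "w \<in> rat_cycles (p + q) ?X" "slant p q y w - s0 \<in> rat_boundaries p (nsphere p)"
    using kunneth_nsphere_surj[OF y s0(1)] .
  have "rank_one (p + q) ?X (cross p q x y) (scale (1 / pairing (cross p q x y) w) w)"
  proof (rule rank_oneI)
    show "cocycle (p + q) ?X (cross p q x y)"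
      using cls by (intro cocycle_cross) auto
    have "pairing x (slant p q y w) = pairing x s0"
      using cls w(2) rat_cyclesD(3)[OF s0(1)] by (intro cocycle_homologous) auto
    then show "pairing (cross p q x y) w \<noteq> 0"
      using s0(2) by (simp add: pairing_cross)
    show "z \<in> rat_boundaries (p + q) ?X" if "z \<in> rat_cycles (p + q) ?X" "pairing (cross p q x y) z = 0" for z
      using that pq by (intro sphere_product_homology[OF pq(1,2) x y]) auto
  qed (use w in auto)
  ultimately show thesis
    using that by blast
qed

section \<open>Degrees and eigenvalues\<close>

lemma rank_oneD:
  assumes "rank_one k X \<phi> s"
  shows "cocycle k X \<phi>" "s \<in> rat_cycles k X" "pairing \<phi> s = 1"
    "\<And>z. z \<in> rat_cycles k X \<Longrightarrow> pairing \<phi> z = 0 \<Longrightarrow> z \<in> rat_boundaries k X"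
  using assms by (auto simp: rank_one_def)

lemma rank_one_decompose:
  assumes "rank_one k X \<phi> s" "z \<in> rat_cycles k X"
  shows "z - scale (pairing \<phi> z) s \<in> rat_boundaries k X"
proof (rule rank_oneD(4)[OF assms(1)])
  note s = rank_oneD(2)[OF assms(1)]
  show "z - scale (pairing \<phi> z) s \<in> rat_cycles k X"
    using assms(2) s by blast
  show "pairing \<phi> (z - scale (pairing \<phi> z) s) = 0"
    using rat_cyclesD(3)[OF assms(2)] rat_cyclesD(3)[OF s] rank_oneD(3)[OF assms(1)] by (simp add: pairing_diff)
qed

text \<open>On cycles every cocycle is a multiple of \<open>\<phi>\<close>, the factor being its
  value on \<open>s\<close>.\<close>

lemma rank_one_cocycle:
  assumes r: "rank_one k X \<phi> s" and "cocycle k X \<psi>" and z: "z \<in> rat_cycles k X"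
  shows "pairing \<psi> z = pairing \<phi> z * pairing \<psi> s"
proof -
  have "pairing \<psi> (z - scale (pairing \<phi> z) s) = 0"
    using assms(2) rank_one_decompose[OF r z] by (rule pairing_cocycle_boundary)
  then show ?thesis
    using rat_cyclesD(3)[OF z] rat_cyclesD(3)[OF rank_oneD(2)[OF r]] by (simp add: pairing_diff)
qed

definition map_degree :: "nat \<Rightarrow> ('a \<Rightarrow> 'a) \<Rightarrow> ('a simplex \<Rightarrow> rat) \<Rightarrow> ('a simplex \<Rightarrow> rat) \<Rightarrow> rat"
  where "map_degree k f \<phi> s = pairing \<phi> (rat_chain_map k f s)"

lemma pairing_map_degree:
  assumes r: "rank_one k X \<phi> s" and f: "continuous_map X X f" and z: "z \<in> rat_cycles k X"
  shows "pairing \<phi> (rat_chain_map k f z) = map_degree k f \<phi> s * pairing \<phi> z"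
  using rank_one_cocycle[OF r cocycle_pullback[OF rank_oneD(1)[OF r] f] z]
  by (simp add: pairing_pullback map_degree_def)

lemma continuous_map_funpow: "continuous_map X X f \<Longrightarrow> continuous_map X X (f ^^ m)"
  by (induction m) (auto intro: continuous_map_compose)

lemma map_degree_funpow:
  assumes r: "rank_one k X \<phi> s" and f: "continuous_map X X f"
  shows "map_degree k (f ^^ m) \<phi> s = map_degree k f \<phi> s ^ m"
proof (induction m)
  case 0
  then show ?case
    using rat_chain_map_id[OF rat_cyclesD(1)[OF rank_oneD(2)[OF r]], of id] rank_oneD(3)[OF r]
    by (simp add: map_degree_def id_def)
next
  case (Suc m)
  have "rat_chain_map k (f ^^ m) s \<in> rat_cycles k X"
    using rank_oneD(2)[OF r] continuous_map_funpow[OF f] by blast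
  from pairing_map_degree[OF r f this] show ?case
    using Suc by (simp add: map_degree_def rat_chain_map_compose o_def)
qed

text \<open>Universal coefficients over a field: a cohomology class is determined by its values on
  cycles.\<close>

lemma rat_coboundaries_iff:
  assumes \<psi>: "\<psi> \<in> rat_cochains (Suc j) X"
  shows "\<psi> \<in> rat_coboundaries (Suc j) X \<longleftrightarrow> (\<forall>z\<in>rat_cycles (Suc j) X. pairing \<psi> z = 0)"
proof
  assume "\<psi> \<in> rat_coboundaries (Suc j) X"
  then obtain u where u: "\<psi> = rat_coboundary j X u"
    by (auto simp: rat_coboundaries_def)
  show "\<forall>z\<in>rat_cycles (Suc j) X. pairing \<psi> z = 0"
  proof
    fix z assume z: "z \<in> rat_cycles (Suc j) X"
    have "pairing \<psi> z = pairing (cobd j u) z"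
      using rat_cyclesD(1)[OF z] by (intro pairing_cong) (auto simp: u rat_coboundary_def cobd_def rat_chains_iff)
    then show "pairing \<psi> z = 0"
      using rat_cyclesD(2,3)[OF z] by (simp add: pairing_cobd)
  qed
next
  assume "\<forall>z\<in>rat_cycles (Suc j) X. pairing \<psi> z = 0"
  then have "\<And>z. z \<in> rat_cycles (Suc j) X \<Longrightarrow> pairing \<psi> z = 0"
    by blast
  from exists_primitive[OF this] obtain u
    where u: "\<And>\<sigma>. singular_simplex (Suc j) X \<sigma> \<Longrightarrow> cobd j u \<sigma> = \<psi> \<sigma>"
    by blast
  \<comment> \<open>The cutoff makes the primitive a cochain of \<open>X\<close>. Faces of simplices
    of \<open>X\<close> lie in \<open>X\<close>, so the coboundary is unaffected there.\<close>
  define v where "v = (\<lambda>\<sigma>. if singular_simplex j X \<sigma> then u \<sigma> else 0)"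
  have "rat_coboundary j X v = \<psi>"
  proof
    fix \<sigma>
    show "rat_coboundary j X v \<sigma> = \<psi> \<sigma>"
    proof (cases "singular_simplex (Suc j) X \<sigma>")
      case True
      then have "v (singular_face (Suc j) i \<sigma>) = u (singular_face (Suc j) i \<sigma>)" if "i \<le> Suc j" for i
        using that singular_simplex_singular_face[OF True, of i] by (simp add: v_def)
      then show ?thesis
        using True u[OF True] by (simp del: sum.atMost_Suc add: rat_coboundary_def cobd_def)
    next
      case False
      then show ?thesis
        using \<psi> by (auto simp: rat_coboundary_def rat_cochains_def)
    qed
  qed
  moreover have "v \<in> rat_cochains j X"
    by (auto simp: v_def rat_cochains_def)
  ultimately show "\<psi> \<in> rat_coboundaries (Suc j) X"
    by (auto simp: rat_coboundaries_def)
qed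

text \<open>The passage from cohomology to homology. An eigenclass is nonzero on \<open>s\<close>,
  and evaluating the eigenvalue equation on \<open>s\<close> leaves the factor by which
  \<open>f\<close> acts on the class of \<open>s\<close>.\<close>

lemma rat_eigenvalue_eq_map_degree:
  assumes r: "rank_one k X \<phi> s" and f: "continuous_map X X f" and k: "k > 0"
    and ev: "is_eigenvalue (rat_cohomology k X) (rat_cochain_map k X f) a"
  shows "a = map_degree k f \<phi> s"
proof -
  obtain j where j: "k = Suc j"
    using k gr0_implies_Suc by blast
  obtain \<psi> where \<psi>: "\<psi> \<in> rat_cocycles k X" "\<psi> \<notin> rat_coboundaries k X"
    "rat_cochain_map k X f \<psi> - scale a \<psi> \<in> rat_coboundaries k X"
    using ev by (auto simp: is_eigenvalue_def rat_cohomology_def reps_def class_eq_def)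
  note s = rank_oneD(2)[OF r]
  have chain: "\<psi> \<in> rat_cochains k X" "rat_cochain_map k X f \<psi> - scale a \<psi> \<in> rat_cochains k X"
    using \<psi>(1) by (auto simp: rat_cocycles_def rat_cochains_def rat_cochain_map_def scale_def split: if_splits)
  have "rat_coboundary k X \<psi> = 0"
    using \<psi>(1) by (simp add: rat_cocycles_def)
  then have cocycle: "cocycle k X \<psi>"
    unfolding cocycle_def by (metis cobd_def rat_coboundary_def zero_fun_apply)
  have nz: "pairing \<psi> s \<noteq> 0"
    using \<psi>(2) rat_coboundaries_iff[OF chain(1)[unfolded j]] rank_one_cocycle[OF r cocycle] by (auto simp: j)
  have "pairing (rat_cochain_map k X f \<psi> - scale a \<psi>) s = 0"
    using \<psi>(3) rat_coboundaries_iff[OF chain(2)[unfolded j]] s by (auto simp: j)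
  moreover have "pairing (rat_cochain_map k X f \<psi> - scale a \<psi>) s = pairing (\<lambda>\<sigma>. pullback k f \<psi> \<sigma> - a * \<psi> \<sigma>) s"
    using rat_cyclesD(1)[OF s] by (intro pairing_cong) (auto simp: rat_cochain_map_def pullback_def scale_def rat_chains_iff)
  moreover have "pairing (pullback k f \<psi>) s = map_degree k f \<phi> s * pairing \<psi> s"
    using rank_one_cocycle[OF r cocycle rat_chain_map_cycles[OF s f]] by (simp add: pairing_pullback map_degree_def)
  ultimately show ?thesis
    using nz by (simp add: pairing_left)
qed

text \<open>Pairing \<open>\<phi> \<times> \<psi>\<close> with the image of a cycle under the diagonal is pairing the cup product of
  \<open>\<phi>\<close> and \<open>\<psi>\<close> with the cycle. So this is the multiplicativity of \<open>f\<^sup>*\<close> for the cup product.\<close>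

lemma map_degree_cross:
  assumes f: "continuous_map (prod_topology Y W) (prod_topology Y W) f"
    and rp: "rank_one p (prod_topology Y W) (pullback p fst x) s"
    and rq: "rank_one q (prod_topology Y W) (pullback q snd y) t" and q: "q > 0"
    and rw: "rank_one (p + q) (prod_topology Y W) (cross p q x y) w"
  shows "map_degree (p + q) f (cross p q x y) w
    = map_degree p f (pullback p fst x) s * map_degree q f (pullback q snd y) t"
proof -
  let ?X = "prod_topology Y W" and ?\<phi> = "pullback p fst x" and ?\<psi> = "pullback q snd y" and ?n = "p + q"
  obtain j where j: "q = Suc j"
    using q gr0_implies_Suc by blast
  define \<Delta> where "\<Delta> = rat_chain_map ?n (\<lambda>z::'a \<times> 'b. (z, z))"
  have diag: "continuous_map ?X (prod_topology ?X ?X) (\<lambda>z. (z, z))"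
    by (simp add: continuous_map_pairwise o_def)
  have nat: "pairing (cross p q \<alpha> \<beta>) (rat_chain_map ?n (\<lambda>z. (g (fst z), h (snd z))) c)
      = pairing (cross p q (pullback p g \<alpha>) (pullback q h \<beta>)) c" for \<alpha> \<beta> g h c
    unfolding pairing_cross slant_natural pairing_pullback ..
  \<comment> \<open>Composing the diagonal with the two projections gives back the identity of the
    product.\<close>
  have \<Delta>: "pairing (cross p q x y) z = pairing (cross p q ?\<phi> ?\<psi>) (\<Delta> z)" if z: "z \<in> rat_cycles ?n ?X" for z
    unfolding nat[symmetric] \<Delta>_def rat_chain_map_compose o_def
    using rat_chain_map_id[OF rat_cyclesD(1)[OF z], of "\<lambda>z. z"] by simp
  note w = rank_oneD(2)[OF rw]
  let ?c = "\<Delta> w"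
  have c: "?c \<in> rat_cycles ?n (prod_topology ?X ?X)"
    unfolding \<Delta>_def using w diag by blast
  let ?f\<psi> = "pullback q f ?\<psi>"
  have f\<psi>: "cocycle q ?X ?f\<psi>"
    using rank_oneD(1)[OF rq] f by (rule cocycle_pullback)
  let ?a = "map_degree p f ?\<phi> s" and ?b = "map_degree q f ?\<psi> t"
  have "map_degree ?n f (cross p q x y) w = pairing (cross p q ?\<phi> ?\<psi>) (\<Delta> (rat_chain_map ?n f w))"
    unfolding map_degree_def using w f by (intro \<Delta>) blast
  also have "\<Delta> (rat_chain_map ?n f w) = rat_chain_map ?n (\<lambda>z. (f (fst z), f (snd z))) ?c"
    by (simp add: \<Delta>_def rat_chain_map_compose o_def)
  also have "pairing (cross p q ?\<phi> ?\<psi>) \<dots> = pairing (pullback p f ?\<phi>) (slant p q ?f\<psi> ?c)"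
    unfolding nat unfolding pairing_cross ..
  \<comment> \<open>The slant product is a p-cycle of the product space, so \<open>f\<close>
    contributes the factor \<open>?a\<close>.\<close>
  also have "\<dots> = ?a * pairing ?\<phi> (slant p q ?f\<psi> ?c)"
    unfolding pairing_pullback[of p f] using slant_cycles[OF f\<psi> c] by (rule pairing_map_degree[OF rp f])
  \<comment> \<open>The pullback of \<open>?\<psi>\<close> minus \<open>?b\<close> times
    \<open>?\<psi>\<close> vanishes on cycles, so it is a coboundary and its slant product with a
    cycle bounds.\<close>
  also have "pairing ?\<phi> (slant p q ?f\<psi> ?c) = ?b * pairing ?\<phi> (slant p q ?\<psi> ?c)"
  proof -
    let ?d = "\<lambda>\<sigma>. ?f\<psi> \<sigma> - ?b * ?\<psi> \<sigma>"
    have "pairing ?d z = 0" if "z \<in> rat_cycles (Suc j) ?X" for z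
      using pairing_map_degree[OF rq f that[folded j]] by (simp add: pairing_left pairing_pullback[of q f])
    from exists_primitive[OF this] obtain u where u: "\<And>\<sigma>. singular_simplex (Suc j) ?X \<sigma> \<Longrightarrow> cobd j u \<sigma> = ?d \<sigma>"
      by blast
    have "slant p q ?d ?c = slant p (Suc j) (cobd j u) ?c"
      unfolding j using rat_cyclesD(1)[OF c] u by (intro slant_cong[of _ _ _ ?X ?X]) (auto simp: j)
    also have "\<dots> \<in> rat_boundaries p ?X"
      using c by (intro slant_cobd) (simp add: j)
    finally have "pairing ?\<phi> (slant p q ?d ?c) = 0"
      by (rule pairing_cocycle_boundary[OF rank_oneD(1)[OF rp]])
    then show ?thesis
      by (simp add: slant_diff_left slant_scale_left pairing_diff)
  qed
  also have "pairing ?\<phi> (slant p q ?\<psi> ?c) = 1"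
    using \<Delta>[OF w] rank_oneD(3)[OF rw] by (simp add: pairing_cross)
  finally show ?thesis
    by simp
qed


section \<open>Homology relative to an acyclic subspace\<close>

lemma rat_chains_trivial_topology: "rat_chains k trivial_topology = {0}"
  by (rule rat_chains_empty) simp

lemma rat_relcycles_empty: "rat_relcycles k X {} = rat_cycles k X"
  by (auto simp: rat_relcycles_def rat_cycles_def rat_chains_trivial_topology)

lemma rat_relboundaries_empty: "rat_relboundaries k X {} = rat_boundaries k X"
  by (auto simp: rat_relboundaries_def rat_boundaries_def rat_chains_trivial_topology)

text \<open>The sum over an empty basis is 0 and the only coefficient function is 0, so the
  condition says that every representative is null.\<close>

lemma has_dim_0: "has_dim (Z, B) 0 \<longleftrightarrow> Z \<subseteq> B"
proof -
  have "(\<exists>!c. (\<forall>i\<ge>0::nat. c i = (0::rat)) \<and> z - 0 \<in> B) \<longleftrightarrow> z \<in> B" for z :: "'a \<Rightarrow> rat"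
    by (auto intro!: ex1I[of _ "\<lambda>_. 0"] simp: fun_eq_iff)
  then show ?thesis
    by (auto simp: has_dim_def is_basis_def reps_def class_eq_def)
qed

lemma rat_relboundariesI:
  "c - b \<in> rat_chains k (subtopology X A) \<Longrightarrow> b \<in> rat_boundaries k X \<Longrightarrow> c \<in> rat_chains k X \<Longrightarrow> c \<in> rat_relboundaries k X A"
  by (auto simp: rat_relboundaries_def rat_boundaries_def)

lemma rat_relboundariesE:
  assumes "c \<in> rat_relboundaries k X A"
  obtains b where "b \<in> rat_boundaries k X" "c - b \<in> rat_chains k (subtopology X A)" "c \<in> rat_chains k X"
  using assms by (auto simp: rat_relboundaries_def rat_boundaries_def)

lemma rat_boundaries_relboundaries: "c \<in> rat_boundaries k X \<Longrightarrow> c \<in> rat_relboundaries k X A"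
  using rat_boundaries_cycles[of c k X] by (intro rat_relboundariesI[of c c]) (auto simp: rat_cycles_def)

lemma rat_relboundaries_scale:
  assumes "c \<in> rat_relboundaries k X A"
  shows "scale r c \<in> rat_relboundaries k X A"
proof -
  obtain b where b: "b \<in> rat_boundaries k X" "c - b \<in> rat_chains k (subtopology X A)" "c \<in> rat_chains k X"
    using assms by (rule rat_relboundariesE)
  have "scale r c - scale r b = scale r (c - b)"
    by (simp add: scale_add)
  then show ?thesis
    using b by (intro rat_relboundariesI[of _ "scale r b"]) auto
qed

lemma rat_relboundaries_diff:
  assumes "c \<in> rat_relboundaries k X A" "d \<in> rat_relboundaries k X A"
  shows "c - d \<in> rat_relboundaries k X A"
proof -
  obtain b where b: "b \<in> rat_boundaries k X" "c - b \<in> rat_chains k (subtopology X A)" "c \<in> rat_chains k X"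
    using assms(1) by (rule rat_relboundariesE)
  obtain b' where b': "b' \<in> rat_boundaries k X" "d - b' \<in> rat_chains k (subtopology X A)" "d \<in> rat_chains k X"
    using assms(2) by (rule rat_relboundariesE)
  have "c - d - (b - b') = (c - b) - (d - b')"
    by simp
  also have "\<dots> \<in> rat_chains k (subtopology X A)"
    using b(2) b'(2) by (rule rat_chains_diff)
  finally show ?thesis
    using b b' by (intro rat_relboundariesI[of _ "b - b'"]) auto
qed

lemma rat_relboundaries_chain_map:
  assumes "c \<in> rat_relboundaries k X A" and f: "continuous_map X X f" "f ` A \<subseteq> A"
  shows "rat_chain_map k f c \<in> rat_relboundaries k X A"
proof -
  obtain b where b: "b \<in> rat_boundaries k X" "c - b \<in> rat_chains k (subtopology X A)" "c \<in> rat_chains k X"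
    using assms(1) by (rule rat_relboundariesE)
  have "continuous_map (subtopology X A) (subtopology X A) f"
    using f by (auto simp: continuous_map_in_subtopology continuous_map_from_subtopology)
  then have "rat_chain_map k f (c - b) \<in> rat_chains k (subtopology X A)"
    using b(2) by blast
  then have "rat_chain_map k f c - rat_chain_map k f b \<in> rat_chains k (subtopology X A)"
    using rat_boundaries_fin_supp[OF b(1)] rat_chains_fin_supp[OF b(3)] by simp
  then show ?thesis
    using b f(1) by (intro rat_relboundariesI[of _ "rat_chain_map k f b"]) auto
qed

text \<open>In degree 0 the coordinate of a class in the given basis is its augmentation divided by
  that of the generator.\<close>

lemma rat_acyclicD:
  assumes "rat_acyclic X"
  shows "topspace X \<noteq> {}"
    and "c \<in> rat_cycles k X \<Longrightarrow> (k = 0 \<Longrightarrow> pairing (\<lambda>_. 1) c = 0) \<Longrightarrow> c \<in> rat_boundaries k X"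
proof -
  obtain e where e: "is_basis (rat_homology 0 X {}) 1 e"
    using assms by (auto simp: rat_acyclic_def has_dim_def)
  then have e0: "e 0 \<in> rat_cycles 0 X"
    and ex1: "\<And>z. z \<in> rat_cycles 0 X \<Longrightarrow>
      \<exists>!a :: nat \<Rightarrow> rat. (\<forall>i\<ge>Suc 0. a i = 0) \<and> z - scale (a 0) (e 0) \<in> rat_boundaries 0 X"
    by (simp_all add: is_basis_def rat_homology_def reps_def class_eq_def rat_relcycles_empty rat_relboundaries_empty)
  show ne: "topspace X \<noteq> {}"
  proof
    assume "topspace X = {}"
    \<comment> \<open>With a null generator the zero class has the coordinates 1 and 0, against
      uniqueness.\<close>
    then have "e 0 = 0"
      using e0 rat_chains_empty by (auto simp: rat_cycles_def)
    moreover obtain a where a: "\<And>c. (\<forall>i\<ge>Suc 0. c i = 0) \<and> 0 - scale (c 0) (e 0) \<in> rat_boundaries 0 X \<Longrightarrow> c = a"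
      using ex1[OF rat_cycles_closed(1)] by (elim ex1E) blast
    ultimately have "(\<lambda>i. if i = 0 then 1 else 0) = a" "(\<lambda>_. 0) = a"
      by (auto intro!: a)
    then have "(\<lambda>i::nat. if i = 0 then 1 else 0 :: rat) = (\<lambda>_. 0)"
      by simp
    then show False
      by (auto dest: fun_cong[of _ _ 0])
  qed
  show "c \<in> rat_boundaries k X" if c: "c \<in> rat_cycles k X" and aug: "k = 0 \<Longrightarrow> pairing (\<lambda>_. 1) c = 0"
  proof (cases "k = 0")
    case False
    then show ?thesis
      using assms c by (auto simp: rat_acyclic_def rat_homology_def rat_relcycles_empty rat_relboundaries_empty has_dim_0)
  next
    case True
    note k = True
    have coeff: "\<exists>r. z - scale r (e 0) \<in> rat_boundaries 0 X" if "z \<in> rat_cycles 0 X" for z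
      using ex1[OF that] by blast
    have pair: "pairing (\<lambda>_. 1) z = r * pairing (\<lambda>_. 1) (e 0)"
      if "z \<in> rat_cycles 0 X" "z - scale r (e 0) \<in> rat_boundaries 0 X" for z r
      using pairing_augmentation[OF that(2)] rat_cyclesD(3)[OF that(1)] rat_cyclesD(3)[OF e0]
      by (simp add: pairing_diff)
    obtain a where "a \<in> topspace X"
      using ne by blast
    then have "singular_simplex 0 X (restrict (\<lambda>_. a) (standard_simplex 0))"
      by (simp add: singular_simplex_def continuous_map_eq[OF continuous_map_const[THEN iffD2]])
    then have v: "simplex_chain (restrict (\<lambda>_. a) (standard_simplex 0)) \<in> rat_cycles 0 X"
      by (auto simp: rat_cycles_def)
    \<comment> \<open>A single vertex has augmentation 1, so the generator cannot have augmentation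
      0.\<close>
    then have nz: "pairing (\<lambda>_. 1) (e 0) \<noteq> 0"
      using coeff[OF v] pair[OF v] by auto
    obtain r where "c - scale r (e 0) \<in> rat_boundaries 0 X"
      using coeff c k by blast
    moreover from this have "r = 0"
      using pair[of c r] c aug k nz by auto
    ultimately show ?thesis
      using k by simp
  qed
qed

text \<open>Absolute homology maps onto relative homology: the boundary of \<open>c\<close> is a
  cycle of the acyclic subspace, of augmentation 0 in degree 0, hence bounds some \<open>e\<close>
  there.\<close>

lemma rat_relcycle_absolute:
  assumes acyc: "rat_acyclic (subtopology X A)" and c: "c \<in> rat_relcycles (Suc k) X A"
  obtains z e where "z \<in> rat_cycles (Suc k) X" "e \<in> rat_chains (Suc k) (subtopology X A)" "c = z + e"
proof -
  have c': "c \<in> rat_chains (Suc k) X" "rat_boundary (Suc k) c \<in> rat_chains k (subtopology X A)"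
    using c by (auto simp: rat_relcycles_def)
  then have "rat_boundary (Suc k) c \<in> rat_cycles k (subtopology X A)"
    by (simp add: rat_cycles_def rat_boundary_boundary)
  moreover have "pairing (\<lambda>_. 1) (rat_boundary (Suc k) c) = 0" if "k = 0"
    using pairing_augmentation[OF rat_boundariesI, of c X] c'(1) that by simp
  ultimately have "rat_boundary (Suc k) c \<in> rat_boundaries k (subtopology X A)"
    by (rule rat_acyclicD(2)[OF acyc])
  then obtain e where e: "e \<in> rat_chains (Suc k) (subtopology X A)" "rat_boundary (Suc k) c = rat_boundary (Suc k) e"
    unfolding rat_boundaries_def by auto
  have "c - e \<in> rat_cycles (Suc k) X"
    using c'(1) rat_chains_mono(2)[OF e(1)] e(2) rat_chains_fin_supp[OF e(1)] rat_chains_fin_supp[OF c'(1)]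
    by (auto simp: rat_cycles_def)
  then show thesis
    using that[of "c - e" e] e(1) by simp
qed

text \<open>Injectivity: the defect \<open>z - b\<close> is a cycle of the acyclic subspace in
  positive degree.\<close>

lemma rat_relboundary_absolute:
  assumes acyc: "rat_acyclic (subtopology X A)" and z: "z \<in> rat_cycles k X" and k: "k > 0"
    and bd: "z \<in> rat_relboundaries k X A"
  shows "z \<in> rat_boundaries k X"
proof -
  obtain b where b: "b \<in> rat_boundaries k X" "z - b \<in> rat_chains k (subtopology X A)"
    using bd by (rule rat_relboundariesE)
  have "z - b \<in> rat_cycles k X"
    using z rat_boundaries_cycles[OF b(1)] by (rule rat_cycles_closed)
  then have "z - b \<in> rat_cycles k (subtopology X A)"
    using b(2) by (simp add: rat_cycles_def)
  then have "z - b \<in> rat_boundaries k (subtopology X A)"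
    using k by (intro rat_acyclicD(2)[OF acyc]) auto
  then have "z - b \<in> rat_boundaries k X"
    by (rule rat_boundaries_mono)
  then show ?thesis
    using rat_boundaries_diff_cancel b(1) by fastforce
qed

text \<open>The definite description in \<open>endo_trace\<close> needs uniqueness: every basis has
  length 1, and its only matrix entry is \<open>d\<close>.\<close>

lemma endo_trace_one_dimensional:
  fixes B :: "('b \<Rightarrow> rat) set"
  assumes diff: "\<And>u v. u \<in> B \<Longrightarrow> v \<in> B \<Longrightarrow> u - v \<in> B" and scaled: "\<And>r u. u \<in> B \<Longrightarrow> scale r u \<in> B"
    and s: "s \<in> Z" "s \<notin> B" and span: "\<And>z. z \<in> Z \<Longrightarrow> \<exists>r. z - scale r s \<in> B"
    and T: "\<And>z r. z \<in> Z \<Longrightarrow> z - scale r s \<in> B \<Longrightarrow> T z - scale r (T s) \<in> B"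
    and d: "T s - scale d s \<in> B"
  shows "endo_trace (Z, B) T = d"
proof -
  have s_mult: "r = 0" if "scale r s \<in> B" for r
    using scaled[OF that, of "1 / r"] s(2) by (cases "r = 0") auto
  have coeff_unique: "r = r'" if "z - scale r s \<in> B" "z - scale r' s \<in> B" for z r r'
    using diff[OF that(2,1)] s_mult[of "r - r'"] by (simp add: scale_add)
  show ?thesis
    unfolding endo_trace_def
  proof (rule the_equality)
    have "is_basis (Z, B) 1 (\<lambda>_. s)"
      unfolding is_basis_def reps_def class_eq_def
    proof (intro conjI ballI)
      fix z assume "z \<in> fst (Z, B)"
      then obtain r where r: "z - scale r s \<in> B"
        using span by auto
      show "\<exists>!c :: nat \<Rightarrow> rat. (\<forall>i\<ge>1. c i = 0) \<and> z - (\<Sum>i<1. scale (c i) s) \<in> snd (Z, B)"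
      proof (rule ex1I)
        show "(\<forall>i\<ge>1::nat. (if i = 0 then r else 0) = 0) \<and> z - (\<Sum>i<1::nat. scale (if i = 0 then r else 0) s) \<in> snd (Z, B)"
          using r by (auto simp: lessThan_Suc)
        fix c :: "nat \<Rightarrow> rat" assume c: "(\<forall>i\<ge>1. c i = 0) \<and> z - (\<Sum>i<1. scale (c i) s) \<in> snd (Z, B)"
        show "c = (\<lambda>i. if i = 0 then r else 0)"
        proof
          fix i show "c i = (if i = 0 then r else 0)"
            using c coeff_unique[OF r, of "c 0"] by (cases "i = 0") (auto simp: lessThan_Suc)
        qed
      qed
    qed (use s in auto)
    moreover have "is_matrix_of (Z, B) T 1 (\<lambda>_. s) (\<lambda>_ _. d)"
      using d by (simp add: is_matrix_of_def class_eq_def)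
    ultimately show "\<exists>n e M. is_basis (Z, B) n e \<and> is_matrix_of (Z, B) T n e M \<and> d = (\<Sum>i<n. M i i)"
      by (intro exI[of _ 1] exI[of _ "\<lambda>_. s"] exI[of _ "\<lambda>_ _. d"]) simp
  next
    fix t assume "\<exists>n e M. is_basis (Z, B) n e \<and> is_matrix_of (Z, B) T n e M \<and> t = (\<Sum>i<n. M i i)"
    then obtain n e M where basis: "is_basis (Z, B) n e" and M: "is_matrix_of (Z, B) T n e M"
      and t: "t = (\<Sum>i<n. M i i)"
      by blast
    have eZ: "e i \<in> Z" if "i < n" for i
      using basis that by (simp add: is_basis_def reps_def)
    have unique: "c = c'"
      if "z \<in> Z" "\<forall>i\<ge>n. c i = 0" "z - (\<Sum>i<n. scale (c i) (e i)) \<in> B"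
        "\<forall>i\<ge>n. c' i = 0" "z - (\<Sum>i<n. scale (c' i) (e i)) \<in> B" for z c c'
      using basis that unfolding is_basis_def reps_def class_eq_def fst_conv snd_conv by blast
    have single: "(\<Sum>i<n. scale (if i = j then r else 0) (e i)) = scale r (e j)" if "j < n" for j r
      using that by (simp add: if_distrib[of "\<lambda>r. scale r _"] cong: if_cong)
    have zero: "0 \<in> B"
      using diff[OF d d] by simp
    obtain r where r: "e i - scale (r i) s \<in> B" if "i < n" for i
      using span[OF eZ] by metis
    \<comment> \<open>A null basis vector would have two coordinate vectors, 0 and its own unit
      vector.\<close>
    have r_nz: "r i \<noteq> 0" if i: "i < n" for i
    proof
      assume "r i = 0"
      then have "e i \<in> B"
        using r[OF i] by simp
      then have "(\<lambda>_. 0) = (\<lambda>j. if j = i then 1 else (0::rat))"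
        using eZ[OF i] zero i single[OF i, of 1] by (intro unique[of "e i"]) auto
      then show False
        by (auto dest: fun_cong[of _ _ i])
    qed
    have "n \<noteq> 0"
    proof
      assume "n = 0"
      then have "\<exists>c. s - (\<Sum>i<0. scale (c i) (e i)) \<in> B"
        using basis s(1) unfolding is_basis_def reps_def class_eq_def by auto
      then show False
        using s(2) by simp
    qed
    \<comment> \<open>Both vectors being multiples of \<open>s\<close>, the first would also be a
      multiple of the second, against uniqueness.\<close>
    moreover have "\<not> n > 1"
    proof
      assume n: "n > 1"
      have "scale (r 0 / r 1) (e 1 - scale (r 1) s) \<in> B"
        using r n by (intro scaled) auto
      then have "scale (r 0 / r 1) (e 1) - scale (r 0) s \<in> B"
        using r_nz[of 1] n by (simp add: scale_add)
      then have "e 0 - scale (r 0 / r 1) (e 1) \<in> B"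
        using diff[OF r[of 0]] n by fastforce
      then have "(\<lambda>j::nat. if j = 1 then r 0 / r 1 else 0) = (\<lambda>j. if j = 0 then 1 else (0::rat))"
        using eZ[of 0] zero n single[of 0 1] single[of 1 "r 0 / r 1"] by (intro unique[of "e 0"]) auto
      then show False
        by (auto dest: fun_cong[of _ _ 0])
    qed
    ultimately have n: "n = 1"
      by linarith
    have 1: "T (e 0) - scale (M 0 0) (e 0) \<in> B"
      using M by (simp add: is_matrix_of_def class_eq_def n)
    have 2: "scale (M 0 0) (e 0 - scale (r 0) s) \<in> B" "scale (r 0) (T s - scale d s) \<in> B"
      using r[of 0] d n by (auto intro: scaled)
    have 3: "T (e 0) - scale (r 0) (T s) \<in> B"
      using T eZ[of 0] r[of 0] n by auto
    \<comment> \<open>A combination of elements of \<open>B\<close> in which everything but the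
      multiples of \<open>s\<close> cancels.\<close>
    have "((T (e 0) - scale (r 0) (T s)) - (T (e 0) - scale (M 0 0) (e 0)))
        - (scale (M 0 0) (e 0 - scale (r 0) s) - scale (r 0) (T s - scale d s))
        = scale (r 0 * (M 0 0 - d)) s"
      by (simp add: fun_eq_iff scale_def algebra_simps)
    then have "scale (r 0 * (M 0 0 - d)) s \<in> B"
      using diff[OF diff[OF 3 1] diff[OF 2]] by simp
    then have "r 0 * (M 0 0 - d) = 0"
      by (rule s_mult)
    then show "t = d"
      using r_nz[of 0] n t by simp
  qed
qed

text \<open>Relative to an acyclic subspace \<open>s\<close> still generates and is still nonzero,
  so the relative trace is the absolute degree.\<close>

lemma rank_one_endo_trace:
  assumes r: "rank_one k X \<phi> s" and k: "k > 0" and acyc: "rat_acyclic (subtopology X A)"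
    and f: "continuous_map X X f" "f ` A \<subseteq> A"
  shows "\<not> has_dim (rat_homology k X A) 0"
    "endo_trace (rat_homology k X A) (rat_chain_map k f) = map_degree k f \<phi> s"
proof -
  note s = rank_oneD(2)[OF r]
  have "s \<notin> rat_boundaries k X"
    using pairing_cocycle_boundary[OF rank_oneD(1)[OF r], of s] rank_oneD(3)[OF r] by auto
  then have ns: "s \<notin> rat_relboundaries k X A"
    using rat_relboundary_absolute[OF acyc s k] by blast
  have sZ: "s \<in> rat_relcycles k X A"
    using s by (simp add: rat_relcycles_def rat_cycles_def)
  show "\<not> has_dim (rat_homology k X A) 0"
    using ns sZ by (auto simp: rat_homology_def has_dim_0)
  have fin: "fin_supp c" if "c \<in> rat_relcycles k X A" for c
    using that by (auto simp: rat_relcycles_def)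
  show "endo_trace (rat_homology k X A) (rat_chain_map k f) = map_degree k f \<phi> s"
    unfolding rat_homology_def
  proof (rule endo_trace_one_dimensional)
    fix c assume c: "c \<in> rat_relcycles k X A"
    obtain j where j: "k = Suc j"
      using k gr0_implies_Suc by blast
    obtain z e where ze: "z \<in> rat_cycles k X" "e \<in> rat_chains k (subtopology X A)" "c = z + e"
      using rat_relcycle_absolute[OF acyc c[unfolded j]] unfolding j .
    let ?d = "c - scale (pairing \<phi> z) s"
    have "?d - (z - scale (pairing \<phi> z) s) = e"
      by (simp add: ze(3))
    moreover have "c \<in> rat_chains k X" "s \<in> rat_chains k X"
      using c s by (auto simp: rat_relcycles_def rat_cycles_def)
    ultimately show "\<exists>r. c - scale r s \<in> rat_relboundaries k X A"
      using rank_one_decompose[OF r ze(1)] ze(2)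
      by (intro exI[of _ "pairing \<phi> z"] rat_relboundariesI[of _ "z - scale (pairing \<phi> z) s"]) auto
  next
    fix c \<rho> assume c: "c \<in> rat_relcycles k X A" "c - scale \<rho> s \<in> rat_relboundaries k X A"
    from rat_relboundaries_chain_map[OF c(2) f]
    show "rat_chain_map k f c - scale \<rho> (rat_chain_map k f s) \<in> rat_relboundaries k X A"
      using fin[OF c(1)] fin[OF sZ] by simp
  next
    show "rat_chain_map k f s - scale (map_degree k f \<phi> s) s \<in> rat_relboundaries k X A"
      unfolding map_degree_def using s f
      by (intro rat_boundaries_relboundaries rank_one_decompose[OF r]) blast
  qed (use ns sZ in \<open>auto intro: rat_relboundaries_diff rat_relboundaries_scale\<close>)
qed

text \<open>In positive degree relative cycles come from absolute ones, which bound; degree 0 uses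
  that \<open>A\<close> is nonempty.\<close>

lemma sphere_product_relative_trivial:
  assumes pq: "p > 0" "q > 0" and acyc: "rat_acyclic (subtopology (sphere_product p q) A)"
    and k: "k \<noteq> p" "k \<noteq> q" "k \<noteq> p + q"
  shows "has_dim (rat_homology k (sphere_product p q) A) 0"
proof -
  let ?X = "sphere_product p q"
  obtain x y where x: "sphere_class p x" and y: "sphere_class q y"
    using exists_sphere_class pq by metis
  have van: "z \<in> rat_boundaries k ?X" if "z \<in> rat_cycles k ?X" "k = 0 \<Longrightarrow> pairing (\<lambda>_. 1) z = 0" for z
    using that k by (intro sphere_product_homology[OF pq x y]) auto
  have "c \<in> rat_relboundaries k ?X A" if c: "c \<in> rat_relcycles k ?X A" for c
  proof (cases k)
    case 0
    have cX: "c \<in> rat_chains 0 ?X"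
      using c by (simp add: rat_relcycles_def 0)
    obtain a where a: "a \<in> topspace (subtopology ?X A)"
      using rat_acyclicD(1)[OF acyc] by blast
    \<comment> \<open>All vertices are moved to one point of \<open>A\<close>; this keeps the
      augmentation, so the difference bounds.\<close>
    let ?v = "rat_chain_map 0 (\<lambda>_. a) c"
    have v: "?v \<in> rat_chains 0 (subtopology ?X A)"
      using cX a by (intro rat_chain_map_in_chains) auto
    have "c - ?v \<in> rat_boundaries 0 ?X"
      using van[of "c - ?v"] cX rat_chains_mono(2)[OF v] rat_chains_fin_supp[OF cX]
      by (auto simp: 0 rat_cycles_def pairing_diff)
    then show ?thesis
      using v cX by (intro rat_relboundariesI[of c "c - ?v"]) (auto simp: 0)
  next
    case (Suc j)
    obtain z e where ze: "z \<in> rat_cycles k ?X" "e \<in> rat_chains k (subtopology ?X A)" "c = z + e"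
      using rat_relcycle_absolute[OF acyc c[unfolded Suc]] unfolding Suc .
    then show ?thesis
      using van[OF ze(1)] c Suc by (intro rat_relboundariesI[of c z]) (auto simp: rat_relcycles_def)
  qed
  then show ?thesis
    by (auto simp: rat_homology_def has_dim_0)
qed

section \<open>Lefschetz numbers of the iterates\<close>

theorem theorem3p5:
  fixes p q :: nat
    and A :: "((nat \<Rightarrow> real) \<times> (nat \<Rightarrow> real)) set"
    and f :: "(nat \<Rightarrow> real) \<times> (nat \<Rightarrow> real) \<Rightarrow> (nat \<Rightarrow> real) \<times> (nat \<Rightarrow> real)"
    and a b :: rat
  assumes "p \<ge> 2" and "q \<ge> 2" and "even p" and "even q" and "p \<noteq> q"
    and "A \<subseteq> topspace (sphere_product p q)"
    and "sphere_product p q interior_of A \<noteq> {}"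
    and "rat_acyclic (subtopology (sphere_product p q) A)"
    and "continuous_map (sphere_product p q) (sphere_product p q) f"
    and "f ` A \<subseteq> A"
    and "is_eigenvalue (rat_cohomology p (sphere_product p q))
           (rat_cochain_map p (sphere_product p q) f) a"
    and "is_eigenvalue (rat_cohomology q (sphere_product p q))
           (rat_cochain_map q (sphere_product p q) f) b"
  shows "(\<forall>m\<ge>1. lefschetz_number (f ^^ m) (sphere_product p q) A = 0) \<longleftrightarrow> a = 0 \<and> b = 0"
proof -
  let ?X = "sphere_product p q"
  have pq: "p > 0" "q > 0"
    using assms(1,2) by auto
  note acyc = assms(8) and f = assms(9)
  obtain x y where x: "sphere_class p x" and y: "sphere_class q y"
    using exists_sphere_class pq by metis
  obtain s t w where r: "rank_one p ?X (pullback p fst x) s" "rank_one q ?X (pullback q snd y) t"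
    "rank_one (p + q) ?X (cross p q x y) w"
    using sphere_product_rank_one[OF pq assms(5) x y] .
  have a: "map_degree p f (pullback p fst x) s = a"
    using rat_eigenvalue_eq_map_degree[OF r(1) f pq(1) assms(11)] by simp
  have b: "map_degree q f (pullback q snd y) t = b"
    using rat_eigenvalue_eq_map_degree[OF r(2) f pq(2) assms(12)] by simp
  have ab: "map_degree (p + q) f (cross p q x y) w = a * b"
    using map_degree_cross[OF f r(1,2) pq(2) r(3)] a b by simp
  have L: "lefschetz_number (f ^^ m) ?X A = a ^ m + b ^ m + (a * b) ^ m" for m
  proof -
    have fm: "continuous_map ?X ?X (f ^^ m)"
      using f by (rule continuous_map_funpow)
    have fA: "(f ^^ m) ` A \<subseteq> A"
      using assms(10) by (induction m) auto
    note tr = rank_one_endo_trace[OF r(1) pq(1) acyc fm fA] rank_one_endo_trace[OF r(2) pq(2) acyc fm fA]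
      rank_one_endo_trace[OF r(3) _ acyc fm fA]
    \<comment> \<open>Positivity and \<open>p \<noteq> q\<close> keep these three degrees distinct,
      so the sum has one term for each.\<close>
    have "{k. \<not> has_dim (rat_homology k ?X A) 0} = {p, q, p + q}"
      using sphere_product_relative_trivial[OF pq acyc] tr(1,3,5) pq by auto
    then show ?thesis
      using tr assms(3-5) pq map_degree_funpow[OF r(1) f, of m] map_degree_funpow[OF r(2) f, of m]
        map_degree_funpow[OF r(3) f, of m]
      by (simp add: lefschetz_number_def a b ab)
  qed
  show ?thesis
  proof
    assume "\<forall>m\<ge>1. lefschetz_number (f ^^ m) ?X A = 0"
    then have "a\<^sup>2 + b\<^sup>2 + (a * b)\<^sup>2 = 0"
      using L[of 2] by simp
    moreover have "a\<^sup>2 \<ge> 0" "b\<^sup>2 \<ge> 0" "(a * b)\<^sup>2 \<ge> 0"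
      by simp_all
    ultimately have "a\<^sup>2 = 0" "b\<^sup>2 = 0"
      by linarith+
    then show "a = 0 \<and> b = 0"
      by simp
  next
    assume "a = 0 \<and> b = 0"
    then show "\<forall>m\<ge>1. lefschetz_number (f ^^ m) ?X A = 0"
      using L by simp
  qed
qed

end
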